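(* Let $\pi$ be a bivector field on an open subset $M\subset\mathbb{R}^n$. The set $C_\pi^{S^1}$ of cotangent loops is a coisotropic subset of the set $\mathfrak{L}$ of smooth loops valued in $T^*M$ if and only if $\pi$ is a Poisson bivector.
   Context: Let $I=[0,1]$, $M\subset\mathbb{R}^n$ open, and identify $T^*M\simeq M\times\mathbb{R}^n$. $\mathfrak{P}$ is the set of smooth paths $a=(q,p):I\to T^*M$; $q$ is called the base path of $a$. $\mathfrak{L}\subset\mathfrak{P}$ is the set of smooth loops, i.e. those paths whose values and derivatives of all orders at $t=0$ and $t=1$ coincide; they are seen as smooth maps $S^1\to T^*M$. Local functions: a function $F:\mathfrak{P}\to\mathbb{R}$ is local if there are integers $k,l\ge0$ and a smooth real function $f$ of $(t,q,q',\dots,q^{(k)},p,p',\dots,p^{(l)})$, with $t\in I$, $q\in M$ and all other variables in $\mathbb{R}^n$, such that $F(a)=\int_I f(t,q(t),\dots,q^{(k)}(t),p(t),\dots,p^{(l)}(t))\,dt$ for all $a=(q,p)\in\mathfrak{P}$. A local function on $\mathfrak{L}$ is the restriction to $\mathfrak{L}$ of a local function on $\mathfrak{P}$. Gradient: tangent vectors to $\mathfrak{L}$ at $a$ are the elements $\delta_a=(\delta_q,\delta_p)\in C^\infty(S^1,\mathbb{R}^n\times\mathbb{R}^n)$. For $F$ local on $\mathfrak{L}$ and $a\in\mathfrak{L}$, the gradient of $F$ at $a$ is the unique $(A_F,B_F)\in C^\infty(S^1,\mathbb{R}^n\times\mathbb{R}^n)$ such that $\frac{d}{d\epsilon}\big|_{\epsilon=0}F(a+\epsilon\delta_a)=\int_I\langle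 A_F,\delta_q\rangle dt+\int_I\langle B_F,\delta_p\rangle dt$ for all tangent vectors $\delta_a$, with $\langle\cdot,\cdot\rangle$ the standard scalar product of $\mathbb{R}^n$; it is given by $A_F=\sum_{i=0}^k(-1)^i\frac{d^i}{dt^i}\frac{\partial f}{\partial q^{(i)}}$ and $B_F=\sum_{j=0}^l(-1)^j\frac{d^j}{dt^j}\frac{\partial f}{\partial p^{(j)}}$, evaluated along $a$. Bracket: for $F,G$ local on $\mathfrak{L}$, $\{F,G\}(a)=\int_I(\langle A_F,B_G\rangle-\langle A_G,B_F\rangle)\,dt$, with gradients taken at $a$. Coisotropic subset: a subset $C\subset\mathfrak{L}$ is coisotropic if and only if the local functions vanishing on $C$ are stable under the bracket $\{\cdot,\cdot\}$. Cotangent loops: $\pi$ is given by a skew-symmetric matrix $(\pi_{ij})$ of smooth functions on $M$, and $\pi^\#_q(p)$ has $s$-th component $\sum_j\pi_{sj}(q)p_j$. $C_\pi^{S^1}$ is the set of loops $a=(q,p)\in\mathfrak{L}$ with $q'(t)=\pi^\#_{q(t)}(p(t))$ for all $t$. $\pi$ is Poisson if the associated biderivation $\{f,g\}=\sum_{i,j}\pi_{ij}\frac{\partial f}{\partial q_i}\frac{\partial g}{\partial q_j}$ on $C^\infty(M)$ satisfies the Jacobi identity.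
   Formalization: Coisotropic is read as stability of the bracket for those local functions vanishing on the subset whose gradients exist at all loops, since local functions depending non-periodically on t may have no gradient on the circle. *)

theory Defs
  imports "HOL-Analysis.Analysis"
begin

section \<open>Smooth functions on open subsets of Euclidean space\<close>

primrec Ck_on :: "nat \<Rightarrow> 'a::euclidean_space set \<Rightarrow> ('a \<Rightarrow> 'b::real_normed_vector) \<Rightarrow> bool" where
  "Ck_on 0 M f \<longleftrightarrow> continuous_on M f"
| "Ck_on (Suc k) M f \<longleftrightarrow>
     f differentiable_on M \<and> (\<forall>v. Ck_on k M (\<lambda>x. frechet_derivative f (at x) v))"

text \<open>The definition is meant for open \<open>M\<close>, where \<open>at x\<close> and \<open>at x within M\<close> agree.\<close>

definition smooth_on :: "'a::euclidean_space set \<Rightarrow> ('a \<Rightarrow> 'b::real_normed_vector) \<Rightarrow> bool" where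
  "smooth_on M f \<longleftrightarrow> (\<forall>k. Ck_on k M f)"


section \<open>Poisson bivector fields\<close>

definition bivector_field :: "(real^'n) set \<Rightarrow> (real^'n \<Rightarrow> real^'n^'n) \<Rightarrow> bool" where
  "bivector_field M \<pi> \<longleftrightarrow>
     (\<forall>i j. smooth_on M (\<lambda>x. \<pi> x $ i $ j)) \<and> (\<forall>x\<in>M. \<forall>i j. \<pi> x $ i $ j = - \<pi> x $ j $ i)"

definition biderivation ::
  "(real^'n \<Rightarrow> real^'n^'n) \<Rightarrow> (real^'n \<Rightarrow> real) \<Rightarrow> (real^'n \<Rightarrow> real) \<Rightarrow> real^'n \<Rightarrow> real" where
  "biderivation \<pi> f g x =
     (\<Sum>i\<in>UNIV. \<Sum>j\<in>UNIV. \<pi> x $ i $ j * frechet_derivative f (at x) (axis i 1)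
                                      * frechet_derivative g (at x) (axis j 1))"

definition poisson_bivector :: "(real^'n) set \<Rightarrow> (real^'n \<Rightarrow> real^'n^'n) \<Rightarrow> bool" where
  "poisson_bivector M \<pi> \<longleftrightarrow>
     (\<forall>f g h. smooth_on M f \<longrightarrow> smooth_on M g \<longrightarrow> smooth_on M h \<longrightarrow>
        (\<forall>x\<in>M. biderivation \<pi> f (biderivation \<pi> g h) x
              + biderivation \<pi> g (biderivation \<pi> h f) x
              + biderivation \<pi> h (biderivation \<pi> f g) x = 0))"


section \<open>Smooth paths and loops\<close>

text \<open>
  A map defined on \<open>[0,1]\<close> is represented by a total function on \<open>real\<close>; its values outside \<open>[0,1]\<close>
  are irrelevant to all notions below. Derivatives at the endpoints are one-sided.
\<close>

primrec nderiv :: "nat \<Rightarrow> (real \<Rightarrow> 'a::real_normed_vector) \<Rightarrow> real \<Rightarrow> 'a" where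
  "nderiv 0 u = u"
| "nderiv (Suc k) u = (\<lambda>t. vector_derivative (nderiv k u) (at t within {0..1}))"

definition smooth_curve :: "(real \<Rightarrow> 'a::real_normed_vector) \<Rightarrow> bool" where
  "smooth_curve u \<longleftrightarrow> (\<forall>k. nderiv k u differentiable_on {0..1})"

text \<open>The smooth maps on the circle \<open>S\<^sup>1\<close>, obtained from \<open>[0,1]\<close> by identifying the endpoints.\<close>

definition smooth_closed :: "(real \<Rightarrow> 'a::real_normed_vector) \<Rightarrow> bool" where
  "smooth_closed u \<longleftrightarrow> smooth_curve u \<and> (\<forall>k. nderiv k u 0 = nderiv k u 1)"

type_synonym 'n cpath = "(real \<Rightarrow> real^'n) \<times> (real \<Rightarrow> real^'n)"

definition cpaths :: "(real^'n) set \<Rightarrow> 'n::finite cpath set" where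
  "cpaths M = {(q, p). smooth_curve q \<and> smooth_curve p \<and> q ` {0..1} \<subseteq> M}"

definition loops :: "(real^'n) set \<Rightarrow> 'n::finite cpath set" where
  "loops M = {(q, p) \<in> cpaths M. smooth_closed q \<and> smooth_closed p}"


section \<open>Local functions\<close>

text \<open>
  Since the orders \<open>k\<close> and \<open>l\<close> of a local function are arbitrary, all jets live in one space of
  families of coordinates: \<open>Pos i s\<close> is the \<open>s\<close>-th component of the \<open>i\<close>-th derivative of \<open>q\<close>,
  and \<open>Mom j s\<close> that of the \<open>j\<close>-th derivative of \<open>p\<close>. A function of
  \<open>(t, q, \<dots>, q\<^sup>(\<^sup>k\<^sup>), p, \<dots>, p\<^sup>(\<^sup>l\<^sup>))\<close> is a function of such families which
  depends on finitely many coordinates only; for these, continuity in the product topology is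
  continuity in the finitely many variables.
\<close>

datatype 'n jet_coord = Time | Pos nat 'n | Mom nat 'n

type_synonym 'n jet = "'n jet_coord \<Rightarrow> real"

definition jet_domain :: "(real^'n) set \<Rightarrow> 'n::finite jet set" where
  "jet_domain M = {x. x Time \<in> {0..1} \<and> (\<chi> s. x (Pos 0 s)) \<in> M}"

definition jet_coords :: "nat \<Rightarrow> nat \<Rightarrow> 'n jet_coord set" where
  "jet_coords k l = {Time} \<union> {Pos i s |i s. i \<le> k} \<union> {Mom j s |j s. j \<le> l}"

definition depends_only_on :: "'c set \<Rightarrow> ('c \<Rightarrow> real) set \<Rightarrow> (('c \<Rightarrow> real) \<Rightarrow> real) \<Rightarrow> bool" where
  "depends_only_on J S f \<longleftrightarrow> (\<forall>x\<in>S. \<forall>y\<in>S. (\<forall>c\<in>J. x c = y c) \<longrightarrow> f x = f y)"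

text \<open>
  Smoothness on \<open>[0,1] \<times> M \<times> \<dots>\<close>: all iterated partial derivatives exist and are continuous.
  They are taken within the domain, hence one-sided in \<open>Time\<close> at \<open>0\<close> and \<open>1\<close>.
\<close>

definition coord_slice :: "('c \<Rightarrow> real) set \<Rightarrow> 'c \<Rightarrow> ('c \<Rightarrow> real) \<Rightarrow> real set" where
  "coord_slice S c x = {r. x(c := r) \<in> S}"

definition coord_deriv ::
  "('c \<Rightarrow> real) set \<Rightarrow> 'c \<Rightarrow> (('c \<Rightarrow> real) \<Rightarrow> real) \<Rightarrow> ('c \<Rightarrow> real) \<Rightarrow> real" where
  "coord_deriv S c f x =
     vector_derivative (\<lambda>r. f (x(c := r))) (at (x c) within coord_slice S c x)"

primrec coord_Ck_on :: "nat \<Rightarrow> ('c \<Rightarrow> real) set \<Rightarrow> (('c \<Rightarrow> real) \<Rightarrow> real) \<Rightarrow> bool" where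
  "coord_Ck_on 0 S f \<longleftrightarrow> continuous_on S f"
| "coord_Ck_on (Suc k) S f \<longleftrightarrow>
     continuous_on S f \<and>
     (\<forall>c. (\<forall>x\<in>S. (\<lambda>r. f (x(c := r))) differentiable (at (x c) within coord_slice S c x)) \<and>
          coord_Ck_on k S (coord_deriv S c f))"

definition coord_smooth_on :: "('c \<Rightarrow> real) set \<Rightarrow> (('c \<Rightarrow> real) \<Rightarrow> real) \<Rightarrow> bool" where
  "coord_smooth_on S f \<longleftrightarrow> (\<forall>k. coord_Ck_on k S f)"

fun jet_at :: "'n::finite cpath \<Rightarrow> real \<Rightarrow> 'n jet" where
  "jet_at (q, p) t Time = t"
| "jet_at (q, p) t (Pos i s) = nderiv i q t $ s"
| "jet_at (q, p) t (Mom j s) = nderiv j p t $ s"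

definition local_on_paths :: "(real^'n) set \<Rightarrow> ('n::finite cpath \<Rightarrow> real) \<Rightarrow> bool" where
  "local_on_paths M F \<longleftrightarrow>
     (\<exists>k l f. coord_smooth_on (jet_domain M) f \<and> depends_only_on (jet_coords k l) (jet_domain M) f \<and>
        (\<forall>a\<in>cpaths M. F a = integral {0..1} (\<lambda>t. f (jet_at a t))))"

definition local_on_loops :: "(real^'n) set \<Rightarrow> ('n::finite cpath \<Rightarrow> real) \<Rightarrow> bool" where
  "local_on_loops M F \<longleftrightarrow> (\<exists>F'. local_on_paths M F' \<and> (\<forall>a\<in>loops M. F a = F' a))"


section \<open>Gradient and bracket\<close>

definition has_gradient ::
  "('n::finite cpath \<Rightarrow> real) \<Rightarrow> 'n cpath \<Rightarrow> 'n cpath \<Rightarrow> bool" where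
  "has_gradient F a = (\<lambda>(A, B). smooth_closed A \<and> smooth_closed B \<and>
     (\<forall>\<delta>q \<delta>p. smooth_closed \<delta>q \<longrightarrow> smooth_closed \<delta>p \<longrightarrow>
        ((\<lambda>\<epsilon>. F (\<lambda>t. fst a t + \<epsilon> *\<^sub>R \<delta>q t, \<lambda>t. snd a t + \<epsilon> *\<^sub>R \<delta>p t)) has_real_derivative
           integral {0..1} (\<lambda>t. A t \<bullet> \<delta>q t) + integral {0..1} (\<lambda>t. B t \<bullet> \<delta>p t)) (at 0)))"

text \<open>
  Two gradients of \<open>F\<close> at \<open>a\<close> agree on \<open>[0,1]\<close> (lemma \<open>has_gradient_unique\<close> below), so the choice
  only affects irrelevant values outside \<open>[0,1]\<close>.
\<close>

definition gradient :: "('n::finite cpath \<Rightarrow> real) \<Rightarrow> 'n cpath \<Rightarrow> 'n cpath" where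
  "gradient F a = (SOME AB. has_gradient F a AB)"

definition loop_bracket ::
  "('n::finite cpath \<Rightarrow> real) \<Rightarrow> ('n cpath \<Rightarrow> real) \<Rightarrow> 'n cpath \<Rightarrow> real" where
  "loop_bracket F G a =
     (let (A\<^sub>F, B\<^sub>F) = gradient F a; (A\<^sub>G, B\<^sub>G) = gradient G a
      in integral {0..1} (\<lambda>t. A\<^sub>F t \<bullet> B\<^sub>G t - A\<^sub>G t \<bullet> B\<^sub>F t))"

text \<open>
  If the integrand of \<open>F\<close> depends on \<open>t\<close> non-periodically, integration by parts on the circle
  produces boundary terms and \<open>F\<close> may have no gradient: e.g. the derivative of
  \<open>\<integral> t \<langle>c, q'\<rangle> dt\<close> contains \<open>\<langle>c, \<delta>q 0\<rangle>\<close>.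
  The bracket is thus a partial operation on local functions.
\<close>

definition has_gradients :: "(real^'n) set \<Rightarrow> ('n::finite cpath \<Rightarrow> real) \<Rightarrow> bool" where
  "has_gradients M F \<longleftrightarrow> (\<forall>a\<in>loops M. \<exists>AB. has_gradient F a AB)"


section \<open>Coisotropic subsets and cotangent loops\<close>

definition vanishing_local :: "(real^'n) set \<Rightarrow> 'n::finite cpath set \<Rightarrow> ('n cpath \<Rightarrow> real) set" where
  "vanishing_local M C = {F. local_on_loops M F \<and> (\<forall>a\<in>C. F a = 0)}"

definition coisotropic :: "(real^'n) set \<Rightarrow> 'n::finite cpath set \<Rightarrow> bool" where
  "coisotropic M C \<longleftrightarrow> C \<subseteq> loops M \<and>
     (\<forall>F \<in> vanishing_local M C. \<forall>G \<in> vanishing_local M C.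
        has_gradients M F \<longrightarrow> has_gradients M G \<longrightarrow> loop_bracket F G \<in> vanishing_local M C)"

definition cotangent_loops ::
  "(real^'n) set \<Rightarrow> (real^'n \<Rightarrow> real^'n^'n) \<Rightarrow> 'n::finite cpath set" where
  "cotangent_loops M \<pi> = {(q, p) \<in> loops M.
     \<forall>t\<in>{0..1}. (q has_vector_derivative (\<pi> (q t) *v p t)) (at t within {0..1})}"


section \<open>Uniqueness of the gradient\<close>

lemma smooth_curve_has_deriv:
  assumes "smooth_curve u" "t \<in> {0..1}"
  shows "(nderiv k u has_vector_derivative nderiv (Suc k) u t) (at t within {0..1})"
  using assms unfolding smooth_curve_def differentiable_on_def nderiv.simps
  by (metis vector_derivative_works)

lemma smooth_curve_continuous: "smooth_curve u \<Longrightarrow> continuous_on {0..1} u"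
  by (metis smooth_curve_def nderiv.simps(1) differentiable_imp_continuous_on)

lemma nderiv_eq_family:
  assumes 0: "\<And>t. t \<in> {0..1} \<Longrightarrow> u t = D 0 t"
    and D: "\<And>k t. t \<in> {0..1} \<Longrightarrow> (D k has_vector_derivative D (Suc k) t) (at t within {0..1})"
    and t: "t \<in> {0..1}"
  shows "nderiv k u t = D k t \<and> (nderiv k u has_vector_derivative D (Suc k) t) (at t within {0..1})"
  using t
proof (induction k arbitrary: t)
  case 0
  then show ?case
    using has_vector_derivative_transform[OF 0 _ D[OF 0], where g = u] assms(1) by simp
next
  case (Suc k)
  have eq: "nderiv (Suc k) u s = D (Suc k) s" if "s \<in> {0..1}" for s
    unfolding nderiv.simps
    by (rule vector_derivative_within_cbox[of 0 1, unfolded cbox_interval]) (use that Suc.IH[OF that] in auto)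
  then show ?case
    using has_vector_derivative_transform[OF Suc.prems eq D[OF Suc.prems]] Suc.prems by blast
qed

lemma smooth_curve_family:
  assumes "\<And>t. t \<in> {0..1} \<Longrightarrow> u t = D 0 t"
    and "\<And>k t. t \<in> {0..1} \<Longrightarrow> (D k has_vector_derivative D (Suc k) t) (at t within {0..1})"
  shows "smooth_curve u"
  unfolding smooth_curve_def differentiable_on_def
  using nderiv_eq_family[of u D, OF assms] by (blast intro: differentiableI_vector)

lemma smooth_curve_diff:
  assumes u: "smooth_curve u" and v: "smooth_curve v"
  shows "smooth_curve (\<lambda>t. u t - v t)"
    and "t \<in> {0..1} \<Longrightarrow> nderiv k (\<lambda>t. u t - v t) t = nderiv k u t - nderiv k v t"
proof -
  define D where "D = (\<lambda>k t. nderiv k u t - nderiv k v t)"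
  have D: "(D k has_vector_derivative D (Suc k) t) (at t within {0..1})" if "t \<in> {0..1}" for k t
    unfolding D_def by (intro has_vector_derivative_diff smooth_curve_has_deriv u v that)
  show "smooth_curve (\<lambda>t. u t - v t)"
    by (rule smooth_curve_family[where D = D]) (use D in \<open>simp_all add: D_def\<close>)
  show "nderiv k (\<lambda>t. u t - v t) t = nderiv k u t - nderiv k v t" if "t \<in> {0..1}"
    using nderiv_eq_family[of "\<lambda>t. u t - v t" D t k] D that by (simp add: D_def)
qed

lemma smooth_closed_diff:
  assumes "smooth_closed u" "smooth_closed v"
  shows "smooth_closed (\<lambda>t. u t - v t)"
  using assms by (simp add: smooth_closed_def smooth_curve_diff)

lemma L2_zero_imp_zero:
  fixes u :: "real \<Rightarrow> 'a::real_inner"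
  assumes "smooth_curve u" "integral {0..1} (\<lambda>t. u t \<bullet> u t) = 0" "t \<in> {0..1}"
  shows "u t = 0"
proof -
  have c: "continuous_on {0..1} (\<lambda>t. u t \<bullet> u t)"
    by (intro continuous_intros smooth_curve_continuous assms)
  have "\<forall>t\<in>{0..1}. u t \<bullet> u t = 0"
    using integral_eq_0_iff[OF c] assms(2) by auto
  then show ?thesis using assms(3) by simp
qed

lemma smooth_closed_zero: "smooth_closed (\<lambda>_. 0 :: 'a::real_normed_vector)"
proof -
  have D: "((\<lambda>_. 0 :: 'a) has_vector_derivative 0) (at t within {0..1})" for t :: real by simp
  show ?thesis
    unfolding smooth_closed_def
    using smooth_curve_family[of "\<lambda>_. 0 :: 'a" "\<lambda>_ _. 0"]
      nderiv_eq_family[of "\<lambda>_. 0 :: 'a" "\<lambda>_ _. 0" 0] nderiv_eq_family[of "\<lambda>_. 0 :: 'a" "\<lambda>_ _. 0" 1] D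
    by simp
qed

lemma has_gradient_unique:
  assumes 1: "has_gradient F a (A, B)" and 2: "has_gradient F a (A', B')" and t: "t \<in> {0..1}"
  shows "A t = A' t" "B t = B' t"
proof -
  have closed: "smooth_closed A" "smooth_closed A'" "smooth_closed B" "smooth_closed B'"
    using 1 2 by (auto simp: has_gradient_def)
  have pairing: "integral {0..1} (\<lambda>t. A t \<bullet> u t) + integral {0..1} (\<lambda>t. B t \<bullet> v t)
      = integral {0..1} (\<lambda>t. A' t \<bullet> u t) + integral {0..1} (\<lambda>t. B' t \<bullet> v t)"
    if "smooth_closed u" "smooth_closed v" for u v
    by (rule DERIV_unique[of "\<lambda>\<epsilon>. F (\<lambda>t. fst a t + \<epsilon> *\<^sub>R u t, \<lambda>t. snd a t + \<epsilon> *\<^sub>R v t)" _ 0])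
       (use 1 2 that in \<open>simp_all add: has_gradient_def\<close>)
  have L2: "X t = Y t"
    if X: "smooth_closed X" and Y: "smooth_closed Y"
      and eq: "integral {0..1} (\<lambda>t. X t \<bullet> (X t - Y t)) = integral {0..1} (\<lambda>t. Y t \<bullet> (X t - Y t))"
    for X Y :: "real \<Rightarrow> real^'b"
  proof -
    have cX: "continuous_on {0..1} X" and cY: "continuous_on {0..1} Y"
      using X Y by (auto simp: smooth_closed_def intro: smooth_curve_continuous)
    have "integral {0..1} (\<lambda>t. (X t - Y t) \<bullet> (X t - Y t)) =
        integral {0..1} (\<lambda>t. X t \<bullet> (X t - Y t)) - integral {0..1} (\<lambda>t. Y t \<bullet> (X t - Y t))"
      by (subst integral_diff[symmetric])
         (auto intro!: integrable_continuous_real continuous_intros cX cY simp: inner_diff_left)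
    also have "\<dots> = 0" using eq by simp
    finally have "X t - Y t = 0"
      using L2_zero_imp_zero[of "\<lambda>t. X t - Y t" t] t smooth_closed_diff[OF X Y]
      by (simp add: smooth_closed_def)
    then show ?thesis by simp
  qed
  show "A t = A' t"
    using pairing[OF smooth_closed_diff[OF closed(1,2)] smooth_closed_zero]
    by (intro L2 closed) simp
  show "B t = B' t"
    using pairing[OF smooth_closed_zero smooth_closed_diff[OF closed(3,4)]]
    by (intro L2 closed) simp
qed

end

theory Submission
  imports Defs
begin

text \<open>
  Let \<open>a = (q, p)\<close> be a cotangent loop of a Poisson bivector \<open>\<pi>\<close> and let \<open>F\<close>, \<open>G\<close> be local functions
  that vanish on cotangent loops, and let \<open>(A, B)\<close> be the gradient of \<open>F\<close> at \<open>a\<close>. Write \<open>D v\<close> for the vector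
  \<open>D\<pi> q v *v p\<close> and \<open>D\<^sup>*\<close> for the adjoint of \<open>D\<close>. Every closed \<open>\<beta>\<close> generates the gauge flow
  \<open>\<delta>q = \<pi> \<beta>\<close>, \<open>\<delta>p = \<beta>' + D\<^sup>* \<beta>\<close>, which preserves cotangent loops; that it kills \<open>F\<close> amounts to
  \<open>B' = D B - \<pi> A\<close>. Moreover \<open>p\<close> may be shifted by covectors in the kernel of
  \<open>\<pi>\<close>, so \<open>B 0\<close> lies in the range of \<open>\<pi>\<close>. Solving \<open>\<alpha>' = - D\<^sup>* \<alpha> - A\<close> with \<open>\<pi> (\<alpha> 0) = B 0\<close> gives
  \<open>B = \<pi> \<alpha>\<close> on \<open>[0,1]\<close>. The integrand of the bracket is then minus the derivative of the product of \<open>\<alpha>\<close>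
  with the momentum gradient of \<open>G\<close>. The boundary term vanishes although \<open>\<alpha>\<close> need not be periodic:
  \<open>\<alpha> 1 - \<alpha> 0\<close> is in the kernel of the skew map \<open>\<pi>\<close>, the momentum gradient of \<open>G\<close> in its range.
  The bracket is local because gradients are given by the Euler-Lagrange expressions.

  Conversely, the brackets of the linear functions \<open>\<integral> w (q' - \<pi> p)\<^sub>i dt\<close> at a cotangent loop are integrals of
  the jacobiator of \<open>\<pi>\<close> contracted with \<open>p\<close>. Running back and forth along a short integral curve of
  \<open>\<pi> (axis m 1)\<close> gives a cotangent loop that stays near a given point, with \<open>p\<close> parallel to \<open>axis m 1\<close>,
  so the jacobiator vanishes at that point.
\<close>

section \<open>Ordinary differential equations with a parameter\<close>

text \<open>Local functions involve jets of every order. To differentiate them along the gauge flow,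
  the flow must be smooth in the loop parameter t, with d/ds commuting with all t-derivatives; the
  theory of differential equations is developed for this. The gauge field contains \<beta>', so it
  acts pointwise in t only once \<beta> and \<beta>' are adjoined as frozen coordinates. The
  equation for B transports membership in the range of \<pi> along the loop but cannot create it;
  that is the task of the kernel shifts. A transported kernel covector need not close up around the
  loop, so it is multiplied by a function flat at both ends. The same flat functions identify
  gradients: the integrand may depend on t without being periodic, and variations flat at the ends
  avoid the boundary terms. In the converse the momentum of the back-and-forth loop is odd under t
  -> 1 - t while the base path is even, so a constant weight w would integrate to 0. The weight sin
  (2 pi t), proportional to that momentum, gives a square times the jacobiator, of constant sign
  near the point.\<close>

lemma gronwall_weak:
  fixes \<phi> :: "real \<Rightarrow> real"
  assumes cont: "continuous_on {0..e} \<phi>" and L: "0 \<le> L" and c: "0 \<le> c"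
    and le: "\<And>s. s \<in> {0..e} \<Longrightarrow> \<phi> s \<le> c + integral {0..s} (\<lambda>r. L * \<phi> r)"
    and s: "s \<in> {0..e}"
  shows "\<phi> s \<le> 2 * c * exp (2 * L * s)"
proof -
  \<comment> \<open>With the doubled rate in the weight, integrating L * m * exp (2 * L * r) returns
    only half of m * exp (2 * L * x); the other half stays on the left and bounds m by 2 * c. Hence
    the factor 2 in the conclusion, which is harmless for uniqueness and for
    differentiability.\<close>
  define \<psi> where "\<psi> = (\<lambda>s. \<phi> s * exp (- (2 * L * s)))"
  have "continuous_on {0..e} \<psi>" unfolding \<psi>_def by (intro continuous_intros cont)
  then obtain x where x: "x \<in> {0..e}" and max: "\<And>y. y \<in> {0..e} \<Longrightarrow> \<psi> y \<le> \<psi> x"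
    using continuous_attains_sup[of "{0..e}" \<psi>] s by auto
  define m where "m = \<psi> x"
  have \<phi>m: "\<phi> r \<le> m * exp (2 * L * r)" if "r \<in> {0..e}" for r
    using max[OF that] by (simp add: \<psi>_def m_def exp_minus field_simps)
  have "m \<le> 2 * c"
  proof (cases "m \<le> 0")
    case False
    have I: "((\<lambda>r. L * (m * exp (2 * L * r))) has_integral
        m/2 * exp (2 * L * x) - m/2 * exp (2 * L * 0)) {0..x}"
      by (rule fundamental_theorem_of_calculus)
         (use x in \<open>auto intro!: derivative_eq_intros simp: has_real_derivative_iff_has_vector_derivative[symmetric]\<close>)
    have "\<phi> x \<le> c + integral {0..x} (\<lambda>r. L * \<phi> r)" by (rule le[OF x])
    also have "integral {0..x} (\<lambda>r. L * \<phi> r) \<le> integral {0..x} (\<lambda>r. L * (m * exp (2 * L * r)))"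
      by (rule integral_le)
         (use x L \<phi>m I in \<open>auto intro!: integrable_continuous_real continuous_intros
            continuous_on_subset[OF cont] mult_left_mono\<close>)
    also have "integral {0..x} (\<lambda>r. L * (m * exp (2 * L * r))) = m/2 * exp (2 * L * x) - m/2" unfolding integral_unique[OF I] by simp
    also have "\<phi> x = m * exp (2 * L * x)" by (simp add: m_def \<psi>_def exp_minus)
    finally have "m * exp (2 * L * x) \<le> c + (m/2 * exp (2 * L * x) - m/2)"
      by linarith
    then have "m/2 * exp (2 * L * x) \<le> c" using False by linarith
    moreover have "m/2 * 1 \<le> m/2 * exp (2 * L * x)"
      using False x L by (intro mult_left_mono) auto
    ultimately show ?thesis by linarith
  qed (use c in auto)
  then have "m * exp (2 * L * s) \<le> 2 * c * exp (2 * L * s)" by (intro mult_right_mono) auto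
  then show ?thesis using \<phi>m[OF s] by linarith
qed

text \<open>Gronwall with c = 0. Besides uniqueness, this is what keeps the flow of closed data
  closed: it is applied to the difference of the two end values.\<close>

lemma linear_growth_zero:
  fixes f :: "real \<Rightarrow> 'a::banach"
  assumes der: "\<And>s. s \<in> {0..e} \<Longrightarrow> (f has_vector_derivative f' s) (at s within {0..e})"
    and L: "0 \<le> L" "\<And>s. s \<in> {0..e} \<Longrightarrow> norm (f' s) \<le> L * norm (f s)"
    and 0: "f 0 = 0" and s: "s \<in> {0..e}"
  shows "f s = 0"
proof -
  have cf: "continuous_on {0..e} f"
    using der by (meson continuous_on_eq_continuous_within has_vector_derivative_continuous)
  have "norm (f s) \<le> 2 * 0 * exp (2 * L * s)"
  proof (rule gronwall_weak[OF _ L(1) order_refl _ s])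
    fix r assume r: "r \<in> {0..e}"
    have I: "(f' has_integral f r - f 0) {0..r}"
      by (rule fundamental_theorem_of_calculus)
         (use r in \<open>auto intro!: has_vector_derivative_within_subset[OF der]\<close>)
    have "norm (integral {0..r} f') \<le> integral {0..r} (\<lambda>r. L * norm (f r))"
      by (rule integral_norm_bound_integral)
         (use r L in \<open>auto intro!: has_integral_integrable[OF I] integrable_continuous_real[where f = "\<lambda>r. L * norm (f r)"]
            continuous_intros continuous_on_subset[OF cf]\<close>)
    then show "norm (f r) \<le> 0 + integral {0..r} (\<lambda>r. L * norm (f r))"
      using I 0 by (simp add: integral_unique)
  qed (intro continuous_intros cf)
  then show ?thesis by simp
qed

text \<open>Stretching r to s * r moves the variable upper limit into the integrand; the domain of
  integration is then the fixed unit interval, where continuity in parameters is available.\<close>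

lemma integral_upper_limit_continuous:
  fixes g :: "real \<Rightarrow> real \<Rightarrow> 'a::banach"
  assumes g: "continuous_on ({0..e} \<times> T) (\<lambda>(s, t). g s t)"
  shows "continuous_on ({0..e} \<times> T) (\<lambda>(s, t). integral {0..s} (\<lambda>r. g r t))"
proof -
  have eq: "integral {0..s} (\<lambda>r. g r t) = s *\<^sub>R integral (cbox 0 1) (\<lambda>r. g (s * r) t)"
    if "s \<in> {0..e}" "t \<in> T" for s t
  proof (cases "s = 0")
    case False
    then have s: "s > 0" using that by auto
    have "continuous_on {0..s} (\<lambda>r. g r t)"
      by (rule continuous_on_compose2[OF g, where f = "\<lambda>r. (r, t)", simplified])
         (use that in \<open>auto intro!: continuous_intros\<close>)
    then have "((\<lambda>r. g r t) has_integral integral {0..s} (\<lambda>r. g r t)) {0..s}"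
      by (intro integrable_integral integrable_continuous_real)
    from has_integral_stretch_real[OF this, of s] s
    have "((\<lambda>r. g (s * r) t) has_integral (1/s) *\<^sub>R integral {0..s} (\<lambda>r. g r t)) ((\<lambda>x. x / s) ` {0..s})"
      by simp
    moreover have "(\<lambda>x. x / s) ` {0..s} = {0..1}"
      using s by (simp add: image_divide_atLeastAtMost)
    ultimately have "integral (cbox 0 1) (\<lambda>r. g (s * r) t) = (1/s) *\<^sub>R integral {0..s} (\<lambda>r. g r t)"
      by (simp add: integral_unique)
    then show ?thesis using s by simp
  qed simp
  have mem: "a * b \<le> e" if "0 \<le> a" "a \<le> e" "0 \<le> b" "b \<le> 1" for a b :: real
    using mult_left_le[OF that(4,1)] that(2) by linarith
  have 1: "continuous_on (({0..e} \<times> T) \<times> cbox 0 1) (\<lambda>(x, r). g (fst x * r) (snd x))"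
    unfolding split_beta
    by (rule continuous_on_compose2[OF g[unfolded split_beta],
          where f = "\<lambda>z. (fst (fst z) * snd z, snd (fst z))", simplified])
       (auto intro!: continuous_intros mem)
  have "continuous_on ({0..e} \<times> T) (\<lambda>x. fst x *\<^sub>R integral (cbox 0 1) (\<lambda>r. g (fst x * r) (snd x)))"
    by (intro continuous_intros integral_continuous_on_param[OF 1])
  then show ?thesis
    by (rule continuous_on_eq) (auto simp: eq)
qed

lemma continuous_on_slice1:
  assumes "continuous_on (S \<times> T) (\<lambda>(s, t). g s t)" "t \<in> T"
  shows "continuous_on S (\<lambda>s. g s t)"
  by (rule continuous_on_compose2[OF assms(1), where f = "\<lambda>s. (s, t)", simplified])
     (use assms in \<open>auto intro!: continuous_intros\<close>)

lemma continuous_on_slice2: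
  assumes "continuous_on (S \<times> T) (\<lambda>(s, t). g s t)" "s \<in> S"
  shows "continuous_on T (\<lambda>t. g s t)"
  by (rule continuous_on_compose2[OF assms(1), where f = "\<lambda>t. (s, t)", simplified])
     (use assms in \<open>auto intro!: continuous_intros\<close>)

text \<open>All parameters t are treated at once, which gives joint continuity in s and t instead of
  continuity of each curve. The length e is not restricted by the Lipschitz constant; a restriction
  enters only through \<open>inv\<close>, which is trivial for linear equations (\<open>Y t\<close>
  the whole space) and forces a short time when \<open>Y t\<close> is a ball.\<close>

theorem picard:
  fixes u0 :: "real \<Rightarrow> 'a::banach" and G :: "real \<Rightarrow> real \<Rightarrow> 'a \<Rightarrow> 'a"
  assumes T: "compact T" and u0: "continuous_on T u0" "\<And>t. t \<in> T \<Longrightarrow> u0 t \<in> Y t"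
    and Y: "\<And>t. t \<in> T \<Longrightarrow> closed (Y t)"
    and G: "\<And>u. continuous_on ({0..e} \<times> T) (\<lambda>(s, t). u s t) \<Longrightarrow>
              (\<And>s t. s \<in> {0..e} \<Longrightarrow> t \<in> T \<Longrightarrow> u s t \<in> Y t) \<Longrightarrow>
              continuous_on ({0..e} \<times> T) (\<lambda>(s, t). G s t (u s t))"
    and L: "0 \<le> L" "\<And>s t y z. s \<in> {0..e} \<Longrightarrow> t \<in> T \<Longrightarrow> y \<in> Y t \<Longrightarrow> z \<in> Y t \<Longrightarrow>
              norm (G s t y - G s t z) \<le> L * norm (y - z)"
    and inv: "\<And>u s t. continuous_on ({0..e} \<times> T) (\<lambda>(s, t). u s t) \<Longrightarrow>
              (\<And>s t. s \<in> {0..e} \<Longrightarrow> t \<in> T \<Longrightarrow> u s t \<in> Y t) \<Longrightarrow> s \<in> {0..e} \<Longrightarrow> t \<in> T \<Longrightarrow>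
              u0 t + integral {0..s} (\<lambda>r. G r t (u r t)) \<in> Y t"
  obtains u where "continuous_on ({0..e} \<times> T) (\<lambda>(s, t). u s t)"
    "\<And>s t. s \<in> {0..e} \<Longrightarrow> t \<in> T \<Longrightarrow> u s t \<in> Y t"
    "\<And>s t. s \<in> {0..e} \<Longrightarrow> t \<in> T \<Longrightarrow> u s t = u0 t + integral {0..s} (\<lambda>r. G r t (u r t))"
proof -
  let ?R = "{0..e} \<times> T"
  define U where "U = rec_nat (\<lambda>s t. u0 t) (\<lambda>n u s t. u0 t + integral {0..s} (\<lambda>r. G r t (u r t)))"
  have U0: "U 0 = (\<lambda>s t. u0 t)"
    and US: "U (Suc n) = (\<lambda>s t. u0 t + integral {0..s} (\<lambda>r. G r t (U n r t)))" for n
    by (simp_all add: U_def)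
  have U: "continuous_on ?R (\<lambda>(s, t). U n s t) \<and> (\<forall>s\<in>{0..e}. \<forall>t\<in>T. U n s t \<in> Y t)" for n
  proof (induction n)
    case 0
    have "continuous_on ?R (\<lambda>x. u0 (snd x))"
      by (rule continuous_on_compose2[OF u0(1)]) (auto intro!: continuous_intros)
    then show ?case using u0 by (simp add: U0 split_beta)
  next
    case (Suc n)
    have "continuous_on ?R (\<lambda>(s, t). G s t (U n s t))" using Suc by (intro G) auto
    note I = integral_upper_limit_continuous[OF this]
    have "continuous_on ?R (\<lambda>x. u0 (snd x))"
      by (rule continuous_on_compose2[OF u0(1)]) (auto intro!: continuous_intros)
    from continuous_on_add[OF this I[unfolded split_beta]]
    show ?case using Suc inv[of "U n"] by (auto simp: US split_beta)
  qed
  have GU: "continuous_on ?R (\<lambda>(s, t). G s t (U n s t))" for n using U by (intro G) auto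
  have "compact ((\<lambda>x. U 1 (fst x) (snd x) - U 0 (fst x) (snd x)) ` ?R)"
    using U[of 1] U[of 0] T by (intro compact_continuous_image compact_Times) (auto simp: split_beta intro!: continuous_intros)
  then obtain C where C': "\<And>x. x \<in> ?R \<Longrightarrow> norm (U 1 (fst x) (snd x) - U 0 (fst x) (snd x)) \<le> C"
    unfolding bounded_iff by (meson bounded_iff compact_imp_bounded imageI)
  have C: "norm (U 1 s t - U 0 s t) \<le> C" if "s \<in> {0..e}" "t \<in> T" for s t
    using C'[of "(s, t)"] that by simp
  \<comment> \<open>Differences of consecutive iterates are measured against exp (2 * L * s). In
    this weight one integration with factor L contracts by 1/2, so the series converges
    geometrically on the whole of {0..e}.\<close>
  have step: "norm (U (Suc n) s t - U n s t) \<le> \<bar>C\<bar> * (1/2)^n * exp (2 * L * s)"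
    if "s \<in> {0..e}" "t \<in> T" for n s t
    using that
  proof (induction n arbitrary: s t)
    case 0
    have "\<bar>C\<bar> * 1 \<le> \<bar>C\<bar> * exp (2 * L * s)" using 0 L by (intro mult_left_mono) auto
    then show ?case using C[OF 0] by auto
  next
    case (Suc n)
    define c where "c = \<bar>C\<bar> * (1/2)^n"
    have c0: "c \<ge> 0" by (simp add: c_def)
    have ci: "(\<lambda>r. G r t (U n r t)) integrable_on {0..s}" for n
      by (rule integrable_continuous_real, rule continuous_on_subset[OF continuous_on_slice1[OF GU Suc.prems(2)]])
         (use Suc.prems in auto)
    have I: "((\<lambda>r. L * (c * exp (2 * L * r))) has_integral
        c/2 * exp (2 * L * s) - c/2 * exp (2 * L * 0)) {0..s}"
      by (rule fundamental_theorem_of_calculus)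
         (use Suc.prems in \<open>auto intro!: derivative_eq_intros simp: has_real_derivative_iff_has_vector_derivative[symmetric]\<close>)
    have "norm (U (Suc (Suc n)) s t - U (Suc n) s t)
        = norm (integral {0..s} (\<lambda>r. G r t (U (Suc n) r t) - G r t (U n r t)))"
      unfolding US[of "Suc n"] US[of n]
      by (subst integral_diff) (use ci[of "Suc n"] ci[of n] in \<open>auto simp: US\<close>)
    also have "\<dots> \<le> integral {0..s} (\<lambda>r. L * (c * exp (2 * L * r)))"
    proof (rule integral_norm_bound_integral)
      show "(\<lambda>r. G r t (U (Suc n) r t) - G r t (U n r t)) integrable_on {0..s}"
        by (intro integrable_diff ci)
      show "(\<lambda>r. L * (c * exp (2 * L * r))) integrable_on {0..s}" using I by blast
      fix r assume "r \<in> {0..s}"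
      then have r: "r \<in> {0..e}" using Suc.prems by auto
      have "norm (G r t (U (Suc n) r t) - G r t (U n r t)) \<le> L * norm (U (Suc n) r t - U n r t)"
        using U r Suc.prems by (intro L) auto
      also have "\<dots> \<le> L * (c * exp (2 * L * r))"
        using Suc.IH[OF r Suc.prems(2)] L by (intro mult_left_mono) (auto simp: c_def)
      finally show "norm (G r t (U (Suc n) r t) - G r t (U n r t)) \<le> L * (c * exp (2 * L * r))" .
    qed
    also have "\<dots> = c/2 * exp (2 * L * s) - c/2" unfolding integral_unique[OF I] by simp
    also have "\<dots> \<le> c/2 * exp (2 * L * s)" using c0 by simp
    finally show ?case by (simp add: c_def)
  qed
  define u where "u = (\<lambda>s t. U 0 s t + (\<Sum>n. U (Suc n) s t - U n s t))"
  have lim: "uniform_limit ?R (\<lambda>n x. \<Sum>i<n. U (Suc i) (fst x) (snd x) - U i (fst x) (snd x))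
      (\<lambda>x. \<Sum>n. U (Suc n) (fst x) (snd x) - U n (fst x) (snd x)) sequentially"
  proof (rule Weierstrass_m_test)
    show "summable (\<lambda>n. \<bar>C\<bar> * (1/2)^n * exp (2 * L * e))"
      by (intro summable_mult2 summable_mult summable_geometric) simp
    fix n x assume x: "x \<in> ?R"
    have "\<bar>C\<bar> * (1/2)^n * exp (2 * L * fst x) \<le> \<bar>C\<bar> * (1/2)^n * exp (2 * L * e)"
      using x L by (intro mult_left_mono) (auto intro!: mult_left_mono)
    then show "norm (U (Suc n) (fst x) (snd x) - U n (fst x) (snd x)) \<le> \<bar>C\<bar> * (1/2)^n * exp (2 * L * e)"
      using step[of "fst x" "snd x" n] x by auto
  qed
  have tele: "(\<Sum>i<n. U (Suc i) s t - U i s t) = U n s t - U 0 s t" for n s t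
    by (rule sum_lessThan_telescope)
  have "uniform_limit ?R (\<lambda>n x. U 0 (fst x) (snd x) + (\<Sum>i<n. U (Suc i) (fst x) (snd x) - U i (fst x) (snd x)))
      (\<lambda>x. u (fst x) (snd x)) sequentially"
    unfolding u_def by (intro uniform_limit_intros lim)
  then have ulim: "uniform_limit ?R (\<lambda>n x. U n (fst x) (snd x)) (\<lambda>x. u (fst x) (snd x)) sequentially"
    by (simp add: tele)
  have cu: "continuous_on ?R (\<lambda>x. u (fst x) (snd x))"
    by (rule uniform_limit_theorem[OF _ ulim]) (use U in \<open>auto simp: split_beta\<close>)
  have plim: "(\<lambda>n. U n s t) \<longlonglongrightarrow> u s t" if "s \<in> {0..e}" "t \<in> T" for s t
    using tendsto_uniform_limitI[OF ulim, of "(s, t)"] that by simp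
  have uY: "u s t \<in> Y t" if "s \<in> {0..e}" "t \<in> T" for s t
    by (rule closed_sequentially[OF Y[OF that(2)] _ plim[OF that]]) (use U that in auto)
  have cu': "continuous_on ?R (\<lambda>(s, t). u s t)" using cu by (simp add: split_beta)
  have eq: "u s t = u0 t + integral {0..s} (\<lambda>r. G r t (u r t))" if s: "s \<in> {0..e}" and t: "t \<in> T" for s t
  proof -
    have ui: "uniform_limit {0..s} (\<lambda>n r. G r t (U n r t)) (\<lambda>r. G r t (u r t)) sequentially"
    proof (rule uniform_limitI)
      fix \<epsilon> :: real assume \<epsilon>: "\<epsilon> > 0"
      have "\<forall>\<^sub>F n in sequentially. \<forall>x\<in>?R. dist (U n (fst x) (snd x)) (u (fst x) (snd x)) < \<epsilon> / (L + 1)"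
        using uniform_limitD[OF ulim, of "\<epsilon> / (L+1)"] \<epsilon> L by simp
      then show "\<forall>\<^sub>F n in sequentially. \<forall>x\<in>{0..s}. dist (G x t (U n x t)) (G x t (u x t)) < \<epsilon>"
      proof eventually_elim
        case (elim n)
        show ?case
        proof
          fix r assume "r \<in> {0..s}"
          then have r: "r \<in> {0..e}" using s by auto
          have "norm (G r t (U n r t) - G r t (u r t)) \<le> L * norm (U n r t - u r t)"
            using U r t uY by (intro L) auto
          also have "\<dots> \<le> L * (\<epsilon> / (L + 1))"
            using elim r t L(1) by (intro mult_left_mono) (force simp: dist_norm intro: less_imp_le)+
          also have "\<dots> < \<epsilon>" using \<epsilon> L by (simp add: field_simps)
          finally show "dist (G r t (U n r t)) (G r t (u r t)) < \<epsilon>" by (simp add: dist_norm)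
        qed
      qed
    qed
    have sub: "{0..s} \<subseteq> {0..e}" using s by auto
    obtain I J where I: "\<And>n. ((\<lambda>r. G r t (U n r t)) has_integral I n) {0..s}"
      and J: "((\<lambda>r. G r t (u r t)) has_integral J) {0..s}" and IJ: "I \<longlonglongrightarrow> J"
      by (rule uniform_limit_integral[OF ui])
         (auto intro!: continuous_on_subset[OF continuous_on_slice1[OF GU t] sub])
    have "(\<lambda>n. u0 t + I n) \<longlonglongrightarrow> u0 t + J" by (intro tendsto_intros IJ)
    moreover have "I n = integral {0..s} (\<lambda>r. G r t (U n r t))" for n using integral_unique[OF I] by simp
    then have "(\<lambda>n. u0 t + I n) = (\<lambda>n. U (Suc n) s t)" by (simp add: US)
    moreover have "(\<lambda>n. U (Suc n) s t) \<longlonglongrightarrow> u s t" by (rule LIMSEQ_Suc[OF plim[OF s t]])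
    ultimately have "u s t = u0 t + J" by (metis LIMSEQ_unique)
    then show ?thesis using J by (simp add: integral_unique)
  qed
  show ?thesis by (rule that[OF cu' uY eq])
qed


lemma picard_derivative:
  fixes u :: "real \<Rightarrow> real \<Rightarrow> 'a::banach"
  assumes g: "continuous_on ({0..e} \<times> T) (\<lambda>(s, t). g s t)"
    and u: "\<And>s t. s \<in> {0..e} \<Longrightarrow> t \<in> T \<Longrightarrow> u s t = u0 t + integral {0..s} (\<lambda>r. g r t)"
    and s: "s \<in> {0..e}" and t: "t \<in> T"
  shows "((\<lambda>s. u s t) has_vector_derivative g s t) (at s within {0..e})"
proof -
  have "((\<lambda>s. u0 t + integral {0..s} (\<lambda>r. g r t)) has_vector_derivative 0 + g s t) (at s within {0..e})"
    by (intro has_vector_derivative_add has_vector_derivative_const integral_has_vector_derivative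
        continuous_on_slice1[OF g t] s)
  then have "((\<lambda>s. u0 t + integral {0..s} (\<lambda>r. g r t)) has_vector_derivative g s t) (at s within {0..e})"
    by simp
  from has_vector_derivative_transform[OF s _ this, of "\<lambda>s. u s t"] show ?thesis
    using u t by simp
qed

text \<open>\<open>w\<close> solves the variational equation, with \<open>A\<close> the
  linearization in the unknown and \<open>H\<close> the partial derivative in t. The first-order
  remainder of u obeys an integral inequality whose inhomogeneity is of size \<eta> times the
  increment of t, so Gronwall makes it small. \<open>g\<close> is the right-hand side already
  evaluated on the solution, so that linear and nonlinear equations are covered together.\<close>

lemma ode_parameter_derivative:
  fixes u :: "real \<Rightarrow> real \<Rightarrow> 'a::euclidean_space"
  assumes e: "0 \<le> e" and t: "t \<in> T"
    and g: "continuous_on ({0..e} \<times> T) (\<lambda>(s, t). g s t)"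
    and u: "\<And>s t. s \<in> {0..e} \<Longrightarrow> t \<in> T \<Longrightarrow> u s t = u0 t + integral {0..s} (\<lambda>r. g r t)"
    and u0: "(u0 has_vector_derivative u0') (at t within T)"
    and A: "\<And>r. r \<in> {0..e} \<Longrightarrow> linear (A r)" "\<And>r v. r \<in> {0..e} \<Longrightarrow> norm (A r v) \<le> L * norm v" "0 \<le> L"
    and w: "continuous_on {0..e} w" "continuous_on {0..e} (\<lambda>r. A r (w r) + H r)"
      "\<And>s. s \<in> {0..e} \<Longrightarrow> w s = u0' + integral {0..s} (\<lambda>r. A r (w r) + H r)"
    and expand: "\<And>\<eta>. \<eta> > 0 \<Longrightarrow> \<forall>\<^sub>F t' in at t within T. \<forall>r\<in>{0..e}.
        norm (g r t' - g r t - (t' - t) *\<^sub>R H r - A r (u r t' - u r t))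
          \<le> \<eta> * (\<bar>t' - t\<bar> + norm (u r t' - u r t))"
    and s: "s \<in> {0..e}"
  shows "((\<lambda>t. u s t) has_vector_derivative w s) (at t within T)"
proof -
  obtain W where W: "\<And>r. r \<in> {0..e} \<Longrightarrow> norm (w r) \<le> W" "W \<ge> 0"
  proof -
    have "bounded (w ` {0..e})" by (intro compact_imp_bounded compact_continuous_image w(1)) simp
    then obtain W where "\<And>r. r \<in> {0..e} \<Longrightarrow> norm (w r) \<le> W" unfolding bounded_iff by blast
    moreover have "0 \<in> {0..e}" using e by auto
    ultimately show ?thesis using that[of W] by (meson norm_ge_zero order_trans)
  qed
  have cu: "continuous_on {0..e} (\<lambda>s. u s t')" if "t' \<in> T" for t'
    using picard_derivative[of e T g u u0, OF g u _ that]
    by (meson continuous_on_eq_continuous_within has_vector_derivative_continuous)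
  \<comment> \<open>Gronwall's bound for the remainder, divided by \<eta> and by the increment of t;
    \<open>e\<close> stands in place of s so that one constant serves all s.\<close>
  define K where "K = 2 * (1 + e * (1 + W)) * exp (2 * (L + 1) * e)"
  have K: "K > 0" using e W(2) by (simp add: K_def add_pos_nonneg)
  show ?thesis
    unfolding has_vector_derivative_def has_derivative_within_alt
  proof (intro conjI allI impI)
    show "bounded_linear (\<lambda>x. x *\<^sub>R w s)" by (rule bounded_linear_scaleR_left)
    fix \<epsilon> :: real assume \<epsilon>: "\<epsilon> > 0"
    \<comment> \<open>The cap 1 lets \<eta> * norm (\<rho> r) be absorbed as norm (\<rho> r), which
      is where L + 1 comes from; \<epsilon> / K is what the final estimate asks for.\<close>
    define \<eta> where "\<eta> = min 1 (\<epsilon> / K)"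
    have \<eta>: "0 < \<eta>" "\<eta> \<le> 1" "K * \<eta> \<le> \<epsilon>" using K \<epsilon> by (auto simp: \<eta>_def min_def field_simps)
    obtain d0 where d0: "d0 > 0" "\<And>y. y \<in> T \<Longrightarrow> norm (y - t) < d0 \<Longrightarrow>
        norm (u0 y - u0 t - (y - t) *\<^sub>R u0') \<le> \<eta> * norm (y - t)"
      using u0 \<eta>(1) unfolding has_vector_derivative_def has_derivative_within_alt by blast
    obtain d1 where d1: "d1 > 0" "\<And>y. y \<in> T \<Longrightarrow> y \<noteq> t \<Longrightarrow> dist y t < d1 \<Longrightarrow> \<forall>r\<in>{0..e}.
        norm (g r y - g r t - (y - t) *\<^sub>R H r - A r (u r y - u r t))
          \<le> \<eta> * (\<bar>y - t\<bar> + norm (u r y - u r t))"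
      using expand[OF \<eta>(1)] unfolding eventually_at by blast
    show "\<exists>d>0. \<forall>y\<in>T. norm (y - t) < d \<longrightarrow> norm (u s y - u s t - (y - t) *\<^sub>R w s) \<le> \<epsilon> * norm (y - t)"
    proof (intro exI[of _ "min d0 d1"] conjI ballI impI)
      show "min d0 d1 > 0" using d0 d1 by simp
      fix y assume y: "y \<in> T" "norm (y - t) < min d0 d1"
      show "norm (u s y - u s t - (y - t) *\<^sub>R w s) \<le> \<epsilon> * norm (y - t)"
      proof (cases "y = t")
        case False
        define h where "h = y - t"
        define \<rho> where "\<rho> = (\<lambda>r. u r y - u r t - h *\<^sub>R w r)"
        define d where "d = (\<lambda>r. g r y - g r t - h *\<^sub>R (A r (w r) + H r))"
        have ex: "norm (g r y - g r t - h *\<^sub>R H r - A r (u r y - u r t)) \<le> \<eta> * (\<bar>h\<bar> + norm (u r y - u r t))"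
          if "r \<in> {0..e}" for r
          using d1(2)[OF y(1) False] y(2) that by (auto simp: h_def dist_norm)
        have dle: "norm (d r) \<le> \<eta> * (1 + W) * \<bar>h\<bar> + (L + 1) * norm (\<rho> r)" if r: "r \<in> {0..e}" for r
        proof -
          interpret linear "A r" by (rule A(1)[OF r])
          have "d r = (g r y - g r t - h *\<^sub>R H r - A r (u r y - u r t)) + A r (\<rho> r)"
            by (simp add: d_def \<rho>_def add diff scale algebra_simps)
          then have "norm (d r) \<le> \<eta> * (\<bar>h\<bar> + norm (u r y - u r t)) + L * norm (\<rho> r)"
            using norm_triangle_mono[OF ex[OF r] A(2)[OF r, of "\<rho> r"]] by metis
          moreover have "norm (u r y - u r t) \<le> norm (\<rho> r) + \<bar>h\<bar> * W"
          proof -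
            have "u r y - u r t = \<rho> r + h *\<^sub>R w r" by (simp add: \<rho>_def)
            then show ?thesis
              using norm_triangle_ineq[of "\<rho> r" "h *\<^sub>R w r"] mult_left_mono[OF W(1)[OF r], of "\<bar>h\<bar>"] by simp
          qed
          then have "\<eta> * norm (u r y - u r t) \<le> \<eta> * (norm (\<rho> r) + \<bar>h\<bar> * W)"
            using \<eta> by (intro mult_left_mono) auto
          moreover have "\<eta> * norm (\<rho> r) \<le> 1 * norm (\<rho> r)" using \<eta> by (intro mult_right_mono) auto
          ultimately show ?thesis by (simp add: algebra_simps)
        qed
        have g1: "continuous_on {0..e} (\<lambda>r. g r y)" and g2: "continuous_on {0..e} (\<lambda>r. g r t)"
          by (rule continuous_on_slice1[OF g y(1)], rule continuous_on_slice1[OF g t])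
        have cd: "continuous_on {0..e} d" unfolding d_def by (intro continuous_intros g1 g2 w(2))
        have c\<rho>: "continuous_on {0..e} \<rho>" unfolding \<rho>_def by (intro continuous_intros cu y t w(1))
        have \<rho>eq: "\<rho> r = (u0 y - u0 t - h *\<^sub>R u0') + integral {0..r} d" if r: "r \<in> {0..e}" for r
        proof -
          have sub: "{0..r} \<subseteq> {0..e}" using r by auto
          have "(d has_integral integral {0..r} (\<lambda>r. g r y) - integral {0..r} (\<lambda>r. g r t)
              - h *\<^sub>R integral {0..r} (\<lambda>r. A r (w r) + H r)) {0..r}"
            unfolding d_def
            by (intro has_integral_diff has_integral_cmul integrable_integral integrable_continuous_real
                continuous_on_subset[OF g1 sub] continuous_on_subset[OF g2 sub] continuous_on_subset[OF w(2) sub])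
          then have "integral {0..r} d = integral {0..r} (\<lambda>r. g r y) - integral {0..r} (\<lambda>r. g r t)
              - h *\<^sub>R integral {0..r} (\<lambda>r. A r (w r) + H r)"
            by (rule integral_unique)
          then show ?thesis
            using u[OF r y(1)] u[OF r t] w(3)[OF r] by (simp add: \<rho>_def algebra_simps)
        qed
        have "norm (\<rho> s) \<le> 2 * (\<eta> * \<bar>h\<bar> + e * (\<eta> * (1 + W) * \<bar>h\<bar>)) * exp (2 * (L + 1) * s)"
        proof (rule gronwall_weak[OF _ _ _ _ s])
          show "continuous_on {0..e} (\<lambda>r. norm (\<rho> r))" by (intro continuous_intros c\<rho>)
          fix r assume r: "r \<in> {0..e}"
          have sub: "{0..r} \<subseteq> {0..e}" using r by auto
          have "norm (integral {0..r} d) \<le> integral {0..r} (\<lambda>r. \<eta> * (1 + W) * \<bar>h\<bar> + (L + 1) * norm (\<rho> r))"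
            by (rule integral_norm_bound_integral)
               (use r dle in \<open>auto intro!: integrable_continuous_real continuous_intros
                   continuous_on_subset[OF cd sub] continuous_on_subset[OF c\<rho> sub]\<close>)
          also have "\<dots> = r * (\<eta> * (1 + W) * \<bar>h\<bar>) + integral {0..r} (\<lambda>r. (L + 1) * norm (\<rho> r))"
            by (subst integral_add)
               (use r in \<open>auto intro!: integrable_continuous_real continuous_intros
                   continuous_on_subset[OF c\<rho> sub]\<close>)
          also have "r * (\<eta> * (1 + W) * \<bar>h\<bar>) \<le> e * (\<eta> * (1 + W) * \<bar>h\<bar>)"
            using r \<eta> W by (intro mult_right_mono) auto
          finally have "norm (integral {0..r} d) \<le> e * (\<eta> * (1 + W) * \<bar>h\<bar>) + integral {0..r} (\<lambda>r. (L + 1) * norm (\<rho> r))"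
            by simp
          moreover have "norm (u0 y - u0 t - h *\<^sub>R u0') \<le> \<eta> * \<bar>h\<bar>"
            using d0(2)[OF y(1)] y(2) by (simp add: h_def)
          ultimately show "norm (\<rho> r) \<le> (\<eta> * \<bar>h\<bar> + e * (\<eta> * (1 + W) * \<bar>h\<bar>)) + integral {0..r} (\<lambda>r. (L + 1) * norm (\<rho> r))"
            unfolding \<rho>eq[OF r] by (metis (no_types, lifting) add.assoc norm_triangle_mono)
        qed (use A(3) \<eta> W e in \<open>auto intro!: add_nonneg_nonneg mult_nonneg_nonneg\<close>)
        also have "\<dots> \<le> 2 * (\<eta> * \<bar>h\<bar> + e * (\<eta> * (1 + W) * \<bar>h\<bar>)) * exp (2 * (L + 1) * e)"
          using A(3) \<eta> W e s by (intro mult_left_mono) (auto intro!: mult_left_mono add_nonneg_nonneg mult_nonneg_nonneg)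
        also have "\<dots> = K * \<eta> * \<bar>h\<bar>" by (simp add: K_def algebra_simps)
        also have "\<dots> \<le> \<epsilon> * \<bar>h\<bar>" using \<eta> by (intro mult_right_mono) auto
        finally show ?thesis by (simp add: \<rho>_def h_def)
      qed simp
    qed
  qed
qed

section \<open>Smooth families of curves\<close>

lemma Ck_on_continuous: "Ck_on k M f \<Longrightarrow> continuous_on M f"
  by (cases k) (auto intro: differentiable_imp_continuous_on)

lemma Ck_on_mono: "Ck_on (Suc k) M f \<Longrightarrow> Ck_on k M f"
  by (induction k arbitrary: f) (auto intro: differentiable_imp_continuous_on)

lemma Ck_on_has_derivative:
  assumes "open M" "Ck_on (Suc k) M f" "x \<in> M"
  shows "(f has_derivative frechet_derivative f (at x)) (at x)"
  using assms by (simp add: differentiable_on_eq_differentiable_at frechet_derivative_works)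

text \<open>One notion of smooth family serves paths, loops and test functions. The one-sided flat
  conditions serve to build a bump as the product of a factor flat at 0 and a factor flat at
  1.\<close>

datatype endpoints = Free | Closed | Left_Flat | Right_Flat | Flat

primrec endpoints_ok :: "endpoints \<Rightarrow> 'a::real_normed_vector \<Rightarrow> 'a \<Rightarrow> bool" where
  "endpoints_ok Free x y = True"
| "endpoints_ok Closed x y = (x = y)"
| "endpoints_ok Left_Flat x y = (x = 0)"
| "endpoints_ok Right_Flat x y = (y = 0)"
| "endpoints_ok Flat x y = (x = 0 \<and> y = 0)"

text \<open>\<open>g s t\<close> is a curve in \<open>t\<close> for each \<open>s\<close>; the endpoint condition is imposed on all derivatives.\<close>

primrec Ck_family :: "endpoints \<Rightarrow> real set \<Rightarrow> nat \<Rightarrow> (real \<Rightarrow> real \<Rightarrow> 'a::real_normed_vector) \<Rightarrow> bool" where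
  "Ck_family m S 0 g \<longleftrightarrow> continuous_on (S \<times> {0..1}) (\<lambda>(s, t). g s t) \<and> (\<forall>s\<in>S. endpoints_ok m (g s 0) (g s 1))"
| "Ck_family m S (Suc k) g \<longleftrightarrow>
     continuous_on (S \<times> {0..1}) (\<lambda>(s, t). g s t) \<and> (\<forall>s\<in>S. endpoints_ok m (g s 0) (g s 1)) \<and>
     (\<exists>g'. (\<forall>s\<in>S. \<forall>t\<in>{0..1}. (g s has_vector_derivative g' s t) (at t within {0..1})) \<and> Ck_family m S k g')"

definition smooth_family :: "endpoints \<Rightarrow> real set \<Rightarrow> (real \<Rightarrow> real \<Rightarrow> 'a::real_normed_vector) \<Rightarrow> bool" where
  "smooth_family m S g \<longleftrightarrow> (\<forall>k. Ck_family m S k g)"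

definition smooth_ends :: "endpoints \<Rightarrow> (real \<Rightarrow> 'a::real_normed_vector) \<Rightarrow> bool" where
  "smooth_ends m u \<longleftrightarrow> smooth_curve u \<and> (\<forall>k. endpoints_ok m (nderiv k u 0) (nderiv k u 1))"

lemma smooth_ends_simps:
  "smooth_ends Free u \<longleftrightarrow> smooth_curve u" "smooth_ends Closed u \<longleftrightarrow> smooth_closed u"
  by (simp_all add: smooth_ends_def smooth_closed_def)

lemma Ck_family_continuous: "Ck_family m S k g \<Longrightarrow> continuous_on (S \<times> {0..1}) (\<lambda>(s, t). g s t)"
  by (cases k) auto

lemma Ck_family_endpoints: "Ck_family m S k g \<Longrightarrow> s \<in> S \<Longrightarrow> endpoints_ok m (g s 0) (g s 1)"
  by (cases k) auto

lemma Ck_family_mono: "Ck_family m S (Suc k) g \<Longrightarrow> Ck_family m S k g"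
proof (induction k arbitrary: g)
  case (Suc k)
  then obtain g' where g': "\<forall>s\<in>S. \<forall>t\<in>{0..1}. (g s has_vector_derivative g' s t) (at t within {0..1})"
    "Ck_family m S (Suc k) g'" by auto
  show ?case using Suc.prems g'(1) Suc.IH[OF g'(2)] by auto
qed auto

lemma Ck_family_SucE:
  assumes "Ck_family m S (Suc k) g"
  obtains g' where
    "\<And>s t. s \<in> S \<Longrightarrow> t \<in> {0..1} \<Longrightarrow> (g s has_vector_derivative g' s t) (at t within {0..1})" "Ck_family m S k g'"
  using assms unfolding Ck_family.simps by blast

lemma Ck_family_SucI:
  assumes "Ck_family m S k g" "Ck_family m S k g'"
    and "\<And>s t. s \<in> S \<Longrightarrow> t \<in> {0..1} \<Longrightarrow> (g s has_vector_derivative g' s t) (at t within {0..1})"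
  shows "Ck_family m S (Suc k) g"
  unfolding Ck_family.simps using assms Ck_family_continuous Ck_family_endpoints by blast

lemma Ck_family_cong:
  assumes "\<And>s t. s \<in> S \<Longrightarrow> t \<in> {0..1} \<Longrightarrow> g s t = h s t"
  shows "Ck_family m S k g \<longleftrightarrow> Ck_family m S k h"
proof -
  have c: "continuous_on (S \<times> {0..1}) (\<lambda>(s, t). g s t) \<longleftrightarrow> continuous_on (S \<times> {0..1}) (\<lambda>(s, t). h s t)"
    by (rule continuous_on_cong) (use assms in auto)
  have e: "(\<forall>s\<in>S. endpoints_ok m (g s 0) (g s 1)) \<longleftrightarrow> (\<forall>s\<in>S. endpoints_ok m (h s 0) (h s 1))"
    using assms by simp
  have d: "(g s has_vector_derivative x) (at t within {0..1}) \<longleftrightarrow> (h s has_vector_derivative x) (at t within {0..1})"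
    if "s \<in> S" "t \<in> {0..1}" for s t x
    using has_vector_derivative_transform[OF that(2), of "h s" "g s" x]
      has_vector_derivative_transform[OF that(2), of "g s" "h s" x] assms[OF that(1)] by auto
  show ?thesis
    by (cases k) (use c e d in auto)
qed

lemma Ck_family_Flat_Closed: "Ck_family Flat S k g \<Longrightarrow> Ck_family Closed S k g"
  by (induction k arbitrary: g) auto

lemma Ck_family_const: "m \<in> {Free, Closed} \<Longrightarrow> Ck_family m S k (\<lambda>s t. c)"
proof (induction k arbitrary: c)
  case 0
  then show ?case by (cases m) auto
next
  case (Suc k)
  have "Ck_family m S k (\<lambda>s t. 0 :: 'a)" using Suc by simp
  then show ?case using Suc.prems Ck_family_endpoints[OF Suc.IH[OF Suc.prems]]
    by (auto intro!: exI[of _ "\<lambda>s t. 0"])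
qed

lemma Ck_family_zero: "Ck_family m S k (\<lambda>s t. 0)"
  by (induction k) (cases m; auto intro!: exI[of _ "\<lambda>s t. 0"])+

lemma endpoints_ok_add: "endpoints_ok m x y \<Longrightarrow> endpoints_ok m x' y' \<Longrightarrow> endpoints_ok m (x + x') (y + y')"
  by (cases m) auto

lemma Ck_family_add:
  "Ck_family m S k f \<Longrightarrow> Ck_family m S k g \<Longrightarrow> Ck_family m S k (\<lambda>s t. f s t + g s t)"
proof (induction k arbitrary: f g)
  case 0
  then show ?case by (auto simp: split_beta intro!: continuous_intros endpoints_ok_add)
next
  case (Suc k)
  obtain f' g' where
    "\<forall>s\<in>S. \<forall>t\<in>{0..1}. (f s has_vector_derivative f' s t) (at t within {0..1})" "Ck_family m S k f'"
    "\<forall>s\<in>S. \<forall>t\<in>{0..1}. (g s has_vector_derivative g' s t) (at t within {0..1})" "Ck_family m S k g'"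
    using Suc.prems by auto
  with Suc.IH[of f' g']
  have "\<exists>h'. (\<forall>s\<in>S. \<forall>t\<in>{0..1}. ((\<lambda>t. f s t + g s t) has_vector_derivative h' s t) (at t within {0..1})) \<and> Ck_family m S k h'"
    by (intro exI[of _ "\<lambda>s t. f' s t + g' s t"]) (auto intro!: has_vector_derivative_add)
  then show ?case
    using Suc.prems by (auto simp: split_beta intro!: continuous_intros endpoints_ok_add)
qed

lemma Ck_family_linear:
  assumes L: "bounded_linear L"
  shows "Ck_family m S k f \<Longrightarrow> Ck_family m S k (\<lambda>s t. L (f s t))"
proof (induction k arbitrary: f)
  interpret bounded_linear L by fact
  have ok: "endpoints_ok m (L x) (L y)" if "endpoints_ok m x y" for x y
    using that by (cases m) (auto simp: zero)
  {
    case 0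
    then show ?case by (auto simp: split_beta intro!: continuous_on ok)
  next
    case (Suc k)
    obtain f' where f': "\<forall>s\<in>S. \<forall>t\<in>{0..1}. (f s has_vector_derivative f' s t) (at t within {0..1})" "Ck_family m S k f'"
      using Suc.prems by auto
    with Suc.IH[of f']
    have "\<exists>h'. (\<forall>s\<in>S. \<forall>t\<in>{0..1}. ((\<lambda>t. L (f s t)) has_vector_derivative h' s t) (at t within {0..1})) \<and> Ck_family m S k h'"
      by (intro exI[of _ "\<lambda>s t. L (f' s t)"]) (auto intro!: has_vector_derivative)
    then show ?case
      using Suc.prems by (auto simp: split_beta intro!: continuous_on ok)
  }
qed

lemma Ck_family_bilinear_endpoints:
  assumes P: "bounded_bilinear pr"
    and ok: "\<And>x y x' y'. endpoints_ok m x y \<Longrightarrow> endpoints_ok m' x' y' \<Longrightarrow> endpoints_ok m'' (pr x x') (pr y y')"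
  shows "Ck_family m S k f \<Longrightarrow> Ck_family m' S k g \<Longrightarrow> Ck_family m'' S k (\<lambda>s t. pr (f s t) (g s t))"
proof (induction k arbitrary: f g)
  interpret bounded_bilinear pr by fact
  {
    case 0
    then show ?case by (auto simp: split_beta intro!: continuous_on ok)
  next
    case (Suc k)
    obtain f' g' where d:
      "\<forall>s\<in>S. \<forall>t\<in>{0..1}. (f s has_vector_derivative f' s t) (at t within {0..1})" "Ck_family m S k f'"
      "\<forall>s\<in>S. \<forall>t\<in>{0..1}. (g s has_vector_derivative g' s t) (at t within {0..1})" "Ck_family m' S k g'"
      using Suc.prems by auto
    have "Ck_family m'' S k (\<lambda>s t. pr (f s t) (g' s t) + pr (f' s t) (g s t))"
      using Suc.IH[of f g'] Suc.IH[of f' g] Ck_family_mono[OF Suc.prems(1)] Ck_family_mono[OF Suc.prems(2)] d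
      by (intro Ck_family_add) auto
    then have "\<exists>h'. (\<forall>s\<in>S. \<forall>t\<in>{0..1}. ((\<lambda>t. pr (f s t) (g s t)) has_vector_derivative h' s t) (at t within {0..1})) \<and> Ck_family m'' S k h'"
      using d by (intro exI[of _ "\<lambda>s t. pr (f s t) (g' s t) + pr (f' s t) (g s t)"]) (auto intro!: has_vector_derivative)
    then show ?case
      using Suc.prems by (auto simp: split_beta intro!: continuous_on ok)
  }
qed

text \<open>Every Leibniz term keeps a derivative of the first factor, so if that factor is flat,
  the product is flat whatever the second factor does at the ends. This turns arbitrary smooth
  curves into admissible variations.\<close>

lemma Ck_family_bilinear:
  assumes P: "bounded_bilinear pr" and m: "m' = m \<or> m = Flat"
  shows "Ck_family m S k f \<Longrightarrow> Ck_family m' S k g \<Longrightarrow> Ck_family m S k (\<lambda>s t. pr (f s t) (g s t))"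
proof (rule Ck_family_bilinear_endpoints[OF P])
  interpret bounded_bilinear pr by fact
  show "endpoints_ok m (pr x x') (pr y y')" if "endpoints_ok m x y" "endpoints_ok m' x' y'" for x y x' y'
    using that m by (cases m) (auto simp: zero_left)
qed

lemma Ck_family_sum:
  "(\<And>i. i \<in> I \<Longrightarrow> Ck_family m S k (f i)) \<Longrightarrow> Ck_family m S k (\<lambda>s t. \<Sum>i\<in>I. f i s t)"
  by (induction I rule: infinite_finite_induct) (auto intro: Ck_family_zero Ck_family_add)

text \<open>Equality of end values survives any \<open>V\<close>, but vanishing does not, since
  \<open>V 0\<close> may be nonzero; hence only \<open>Free\<close> and
  \<open>Closed\<close>.\<close>

lemma Ck_family_compose:
  fixes V :: "'a::euclidean_space \<Rightarrow> 'b::real_normed_vector"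
  assumes M: "open M" and m: "m \<in> {Free, Closed}"
  shows "Ck_on k M V \<Longrightarrow> Ck_family m S k u \<Longrightarrow> (\<And>s t. s \<in> S \<Longrightarrow> t \<in> {0..1} \<Longrightarrow> u s t \<in> M) \<Longrightarrow>
    Ck_family m S k (\<lambda>s t. V (u s t))"
proof (induction k arbitrary: V)
  have ok: "endpoints_ok m (V x) (V y)" if "endpoints_ok m x y" for x y and V :: "'a \<Rightarrow> 'b"
    using that m by (cases m) auto
  have c: "continuous_on (S \<times> {0..1}) (\<lambda>(s, t). V (u s t))"
    if "Ck_on k M V" "Ck_family m S k u" "\<And>s t. s \<in> S \<Longrightarrow> t \<in> {0..1} \<Longrightarrow> u s t \<in> M"
    for k and V :: "'a \<Rightarrow> 'b"
    unfolding split_beta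
    by (rule continuous_on_compose2[OF Ck_on_continuous[OF that(1)] Ck_family_continuous[OF that(2), unfolded split_beta]])
       (use that(3) in auto)
  {
    case 0
    then show ?case using c[of 0 V] by (auto intro!: ok)
  next
    case (Suc k)
    obtain u' where u': "\<And>s t. s \<in> S \<Longrightarrow> t \<in> {0..1} \<Longrightarrow> (u s has_vector_derivative u' s t) (at t within {0..1})" "Ck_family m S k u'"
      using Ck_family_SucE[OF Suc.prems(2)] by blast
    \<comment> \<open>The chain rule in a basis: \<open>Ck_on\<close> controls the derivatives of
      \<open>V\<close> in fixed directions, and each of these is again composed with u, so the
      induction hypothesis applies to it.\<close>
    define h where "h = (\<lambda>s t. \<Sum>b\<in>Basis. (u' s t \<bullet> b) *\<^sub>R frechet_derivative V (at (u s t)) b)"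
    have h: "Ck_family m S k h"
      unfolding h_def
      by (intro Ck_family_sum Ck_family_bilinear[OF bounded_bilinear_scaleR disjI1[OF refl]]
          Ck_family_linear[OF bounded_linear_inner_left] u' Suc.IH Ck_family_mono[OF Suc.prems(2)])
         (use Suc.prems in auto)
    have "((\<lambda>t. V (u s t)) has_vector_derivative h s t) (at t within {0..1})" if st: "s \<in> S" "t \<in> {0..1}" for s t
    proof -
      note D = Ck_on_has_derivative[OF M Suc.prems(1) Suc.prems(3)[OF st]]
      have "((\<lambda>t. V (u s t)) has_vector_derivative frechet_derivative V (at (u s t)) (u' s t)) (at t within {0..1})"
        using vector_derivative_diff_chain_within[OF u'(1)[OF st] has_derivative_at_withinI[OF D]] by (simp add: o_def)
      also have "frechet_derivative V (at (u s t)) (u' s t) = h s t"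
      proof -
        interpret linear "frechet_derivative V (at (u s t))" by (rule has_derivative_linear[OF D])
        show ?thesis
          using sum[of "\<lambda>b. (u' s t \<bullet> b) *\<^sub>R b" Basis] by (simp add: h_def scale euclidean_representation)
      qed
      finally show ?thesis .
    qed
    then have "\<exists>g'. (\<forall>s\<in>S. \<forall>t\<in>{0..1}. ((\<lambda>t. V (u s t)) has_vector_derivative g' s t) (at t within {0..1})) \<and> Ck_family m S k g'"
      using h by blast
    then show ?case using c[OF Suc.prems] Ck_family_endpoints[OF Suc.prems(2)] by (auto intro!: ok)
  }
qed

lemma nderiv_Suc_shift: "nderiv (Suc j) u = nderiv j (nderiv 1 u)"
  by (induction j) auto

lemma Ck_family_nderiv_1:
  assumes g: "Ck_family m S (Suc k) g"
  shows "Ck_family m S k (\<lambda>s. nderiv 1 (g s))"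
    and "\<And>s t. s \<in> S \<Longrightarrow> t \<in> {0..1} \<Longrightarrow> (g s has_vector_derivative nderiv 1 (g s) t) (at t within {0..1})"
proof -
  obtain g' where g': "\<And>s t. s \<in> S \<Longrightarrow> t \<in> {0..1} \<Longrightarrow> (g s has_vector_derivative g' s t) (at t within {0..1})"
    "Ck_family m S k g'" using Ck_family_SucE[OF g] by blast
  have eq: "nderiv 1 (g s) t = g' s t" if "s \<in> S" "t \<in> {0..1}" for s t
    using vector_derivative_within_cbox[of 0 1 t "g s" "g' s t", unfolded cbox_interval] g'(1)[OF that] that by simp
  show "Ck_family m S k (\<lambda>s. nderiv 1 (g s))"
    using g'(2) Ck_family_cong[of S "\<lambda>s. nderiv 1 (g s)" g'] eq by blast
  show "(g s has_vector_derivative nderiv 1 (g s) t) (at t within {0..1})" if "s \<in> S" "t \<in> {0..1}" for s t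
    using g'(1)[OF that] eq[OF that] by simp
qed

lemma Ck_family_nderiv: "Ck_family m S (k + j) g \<Longrightarrow> Ck_family m S k (\<lambda>s. nderiv j (g s))"
proof (induction j arbitrary: g)
  case (Suc j)
  have "Ck_family m S (k + j) (\<lambda>s. nderiv 1 (g s))" using Ck_family_nderiv_1(1)[of m S "k + j" g] Suc.prems by simp
  from Suc.IH[OF this] show ?case unfolding nderiv_Suc_shift .
qed simp

lemma smooth_family_nderiv: "smooth_family m S g \<Longrightarrow> smooth_family m S (\<lambda>s. nderiv j (g s))"
  by (simp add: smooth_family_def Ck_family_nderiv)

lemma smooth_family_continuous: "smooth_family m S g \<Longrightarrow> continuous_on (S \<times> {0..1}) (\<lambda>(s, t). g s t)"
  unfolding smooth_family_def using Ck_family_continuous by blast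

lemma smooth_family_nderiv_continuous:
  "smooth_family m S g \<Longrightarrow> continuous_on (S \<times> {0..1}) (\<lambda>(s, t). nderiv j (g s) t)"
  using smooth_family_continuous[OF smooth_family_nderiv] by blast

lemma smooth_family_derivative:
  assumes "smooth_family m S g" "s \<in> S" "t \<in> {0..1}"
  shows "(nderiv j (g s) has_vector_derivative nderiv (Suc j) (g s) t) (at t within {0..1})"
proof -
  have "Ck_family m S (Suc 0) (\<lambda>s. nderiv j (g s))"
    using smooth_family_nderiv[OF assms(1)] unfolding smooth_family_def by blast
  from Ck_family_nderiv_1(2)[OF this assms(2,3)] show ?thesis by simp
qed

lemma smooth_family_member:
  assumes "smooth_family m S g" "s \<in> S"
  shows "smooth_ends m (g s)"
  unfolding smooth_ends_def smooth_curve_def differentiable_on_def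
  using smooth_family_derivative[OF assms] smooth_family_nderiv[OF assms(1)] assms(2)
  by (meson Ck_family_endpoints smooth_family_def differentiableI_vector)

lemma smooth_ends_family:
  assumes "smooth_ends m u"
  shows "smooth_family m S (\<lambda>_. u)"
proof -
  have "Ck_family m S k (\<lambda>_. nderiv j u)" for k j
  proof (induction k arbitrary: j)
    have c: "continuous_on (S \<times> {0..1}) (\<lambda>(s, t). nderiv j u t)" for j
      unfolding split_beta
      by (rule continuous_on_compose2[of "{0..1}" "nderiv j u" _ snd])
         (use assms in \<open>auto simp: smooth_ends_def smooth_curve_def intro!: continuous_on_snd differentiable_imp_continuous_on[of "nderiv j u"]\<close>)
    {
      case 0
      then show ?case using c assms by (auto simp: smooth_ends_def)
    next
      case (Suc k)
      then show ?case using c assms smooth_curve_has_deriv[of u _ j]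
        by (auto simp: smooth_ends_def simp del: nderiv.simps intro!: exI[of _ "\<lambda>_. nderiv (Suc j) u"])
    }
  qed
  from this[where j = 0] show ?thesis by (simp add: smooth_family_def)
qed

text \<open>A single curve is a family over a one-point parameter set, so the closure properties
  proved for families carry over to curves.\<close>

lemma smooth_ends_iff: "smooth_ends m u \<longleftrightarrow> smooth_family m {0} (\<lambda>_. u)"
  using smooth_ends_family smooth_family_member[of m "{0}" "\<lambda>_. u" 0] by auto


lemma smooth_ends_Flat_product:
  assumes "smooth_ends Flat f" "smooth_curve u"
  shows "smooth_ends Flat (\<lambda>t. f t *\<^sub>R u t)"
  using assms Ck_family_bilinear[OF bounded_bilinear_scaleR disjI2[OF refl], of "{0}" _ "\<lambda>_. f" Free "\<lambda>_. u"]
  unfolding smooth_ends_iff smooth_ends_simps(1)[symmetric] smooth_family_def by blast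

lemma nderiv_cong:
  assumes "smooth_curve u" "\<And>t. t \<in> {0..1} \<Longrightarrow> v t = u t" "t \<in> {0..1}"
  shows "nderiv k v t = nderiv k u t"
  using nderiv_eq_family[of v "\<lambda>k. nderiv k u", OF _ smooth_curve_has_deriv[OF assms(1)] assms(3)] assms(2) by simp

lemma nderiv_add_scaleR:
  assumes u: "smooth_curve u" and v: "smooth_curve v" and t: "t \<in> {0..1}"
  shows "nderiv k (\<lambda>t. u t + \<epsilon> *\<^sub>R v t) t = nderiv k u t + \<epsilon> *\<^sub>R nderiv k v t"
proof -
  have "((\<lambda>t. nderiv k u t + \<epsilon> *\<^sub>R nderiv k v t) has_vector_derivative
      nderiv (Suc k) u t + \<epsilon> *\<^sub>R nderiv (Suc k) v t) (at t within {0..1})" if "t \<in> {0..1}" for k t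
    by (intro has_vector_derivative_add bounded_linear.has_vector_derivative[OF bounded_linear_scaleR_right]
        smooth_curve_has_deriv u v that)
  from nderiv_eq_family[of "\<lambda>t. u t + \<epsilon> *\<^sub>R v t" "\<lambda>k t. nderiv k u t + \<epsilon> *\<^sub>R nderiv k v t" t k, OF _ this t]
  show ?thesis by simp
qed

lemma nderiv_bounded_linear:
  assumes L: "bounded_linear L" and u: "smooth_curve u" and t: "t \<in> {0..1}"
  shows "nderiv k (\<lambda>t. L (u t)) t = L (nderiv k u t)"
proof -
  have "((\<lambda>t. L (nderiv k u t)) has_vector_derivative L (nderiv (Suc k) u t)) (at t within {0..1})"
    if "t \<in> {0..1}" for k t
    by (intro bounded_linear.has_vector_derivative[OF L] smooth_curve_has_deriv u that)
  from nderiv_eq_family[of "\<lambda>t. L (u t)" "\<lambda>k t. L (nderiv k u t)" t k, OF _ this t]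
  show ?thesis by simp
qed

section \<open>Smooth dependence of solutions on a parameter\<close>

definition tube :: "'a::real_normed_vector set \<Rightarrow> real \<Rightarrow> 'a set" where
  "tube K \<rho> = {x + y |x y. x \<in> K \<and> y \<in> cball 0 \<rho>}"

lemma tube_compact: "compact K \<Longrightarrow> compact (tube K \<rho>)" for K :: "'a::euclidean_space set"
  unfolding tube_def by (intro compact_sums) auto

lemma cball_subset_tube: "x \<in> K \<Longrightarrow> cball x \<rho> \<subseteq> tube K \<rho>"
proof
  fix y assume "x \<in> K" "y \<in> cball x \<rho>"
  then have "y = x + (y - x) \<and> x \<in> K \<and> y - x \<in> cball 0 \<rho>" by (simp add: dist_norm norm_minus_commute)
  then show "y \<in> tube K \<rho>" unfolding tube_def by blast
qed

lemma tube_exists: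
  fixes K :: "'a::euclidean_space set"
  assumes "compact K" "open M" "K \<subseteq> M"
  obtains \<rho> where "\<rho> > 0" "tube K \<rho> \<subseteq> M"
proof -
  obtain \<epsilon> where \<epsilon>: "\<epsilon> > 0" "(\<Union>x\<in>K. ball x \<epsilon>) \<subseteq> M"
    by (rule compact_subset_open_imp_ball_epsilon_subset[OF assms])
  have "tube K (\<epsilon>/2) \<subseteq> (\<Union>x\<in>K. ball x \<epsilon>)"
    using \<epsilon>(1) by (force simp: tube_def dist_norm)
  then show ?thesis using that[of "\<epsilon>/2"] \<epsilon> by auto
qed

text \<open>Expansion over the basis reduces continuity and smoothness in operator norm to the
  values on finitely many vectors. The result reproduces \<open>L\<close> only when \<open>L\<close>
  is linear.\<close>

definition to_blinfun :: "('a::euclidean_space \<Rightarrow> 'b::real_normed_vector) \<Rightarrow> 'a \<Rightarrow>\<^sub>L 'b" where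
  "to_blinfun L = (\<Sum>b\<in>Basis. blinfun_scaleR_left (L b) o\<^sub>L blinfun_inner_left b)"

lemma bounded_linear_rank_one:
  "bounded_linear (\<lambda>x. blinfun_scaleR_left x o\<^sub>L blinfun_inner_left b)"
  by (intro bounded_linear_compose[OF bounded_bilinear.bounded_linear_left[OF bounded_bilinear_blinfun_compose]]
      bounded_linear_blinfun_scaleR_left)

lemma to_blinfun_apply: "linear L \<Longrightarrow> to_blinfun L v = L v"
proof -
  assume "linear L"
  then interpret linear L .
  show ?thesis
    using sum[of "\<lambda>b. (v \<bullet> b) *\<^sub>R b" Basis]
    by (simp add: to_blinfun_def blinfun.sum_left scale euclidean_representation)
qed

lemma to_blinfun_continuous:
  "(\<And>b. continuous_on S (\<lambda>s. L s b)) \<Longrightarrow> continuous_on S (\<lambda>s. to_blinfun (L s))"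
  unfolding to_blinfun_def
  by (intro continuous_on_sum bounded_linear.continuous_on[OF bounded_linear_rank_one])

definition deriv_blinfun :: "('a::euclidean_space \<Rightarrow> 'b::real_normed_vector) \<Rightarrow> 'a \<Rightarrow> 'a \<Rightarrow>\<^sub>L 'b" where
  "deriv_blinfun V x = to_blinfun (frechet_derivative V (at x))"

lemma deriv_blinfun_apply:
  fixes V :: "'a::euclidean_space \<Rightarrow> 'b::real_normed_vector"
  assumes "open M" "Ck_on (Suc k) M V" "x \<in> M"
  shows "(V has_derivative blinfun_apply (deriv_blinfun V x)) (at x)"
proof -
  note D = Ck_on_has_derivative[OF assms]
  have "blinfun_apply (deriv_blinfun V x) = frechet_derivative V (at x)"
    unfolding deriv_blinfun_def by (rule ext) (rule to_blinfun_apply[OF has_derivative_linear[OF D]])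
  then show ?thesis using D by simp
qed

lemma deriv_blinfun_continuous:
  assumes "Ck_on (Suc k) M V"
  shows "continuous_on M (deriv_blinfun V)"
  unfolding deriv_blinfun_def by (rule to_blinfun_continuous, rule Ck_on_continuous[of k]) (use assms in simp)

lemma deriv_blinfun_family:
  assumes "open M" "m \<in> {Free, Closed}" "Ck_on (Suc k) M V" "Ck_family m S k u"
    and "\<And>s t. s \<in> S \<Longrightarrow> t \<in> {0..1} \<Longrightarrow> u s t \<in> M"
  shows "Ck_family m S k (\<lambda>s t. deriv_blinfun V (u s t))"
  unfolding deriv_blinfun_def to_blinfun_def
proof (rule Ck_family_sum)
  fix b :: 'a
  have "Ck_on k M (\<lambda>x. frechet_derivative V (at x) b)" using assms(3) by simp
  from Ck_family_compose[OF assms(1,2) this assms(4,5)]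
  have "Ck_family m S k (\<lambda>s t. frechet_derivative V (at (u s t)) b)" .
  from Ck_family_linear[OF bounded_linear_rank_one[of b] this]
  show "Ck_family m S k (\<lambda>s t. blinfun_scaleR_left (frechet_derivative V (at (u s t)) b) o\<^sub>L blinfun_inner_left b)" .
qed

text \<open>The derivative is uniformly continuous on a compact tube around K, and the tube contains
  the segments from x to nearby points y. This gives the remainder bound with one \<delta> for all x
  in K.\<close>

lemma uniform_linearization:
  fixes V :: "'a::euclidean_space \<Rightarrow> 'b::real_normed_vector"
  assumes K: "compact K" and M: "open M" "K \<subseteq> M" and V: "Ck_on (Suc k) M V" and \<eta>: "\<eta> > 0"
  obtains \<delta> where "\<delta> > 0" "\<And>x y. x \<in> K \<Longrightarrow> norm (y - x) < \<delta> \<Longrightarrow>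
    norm (V y - V x - deriv_blinfun V x (y - x)) \<le> \<eta> * norm (y - x)"
proof -
  obtain \<rho> where \<rho>: "\<rho> > 0" "tube K \<rho> \<subseteq> M" using tube_exists[OF K M] by blast
  have "uniformly_continuous_on (tube K \<rho>) (deriv_blinfun V)"
    by (intro compact_uniformly_continuous continuous_on_subset[OF deriv_blinfun_continuous[OF V] \<rho>(2)] tube_compact K)
  then obtain d where d: "d > 0" "\<And>x y. x \<in> tube K \<rho> \<Longrightarrow> y \<in> tube K \<rho> \<Longrightarrow> dist y x < d \<Longrightarrow>
      dist (deriv_blinfun V y) (deriv_blinfun V x) < \<eta>"
    using \<eta> unfolding uniformly_continuous_on_def by meson
  show ?thesis
  proof (rule that[of "min \<rho> d"])
    fix x y assume x: "x \<in> K" and y: "norm (y - x) < min \<rho> d"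
    have sub: "ball x (min \<rho> d) \<subseteq> tube K \<rho>" using cball_subset_tube[OF x, of \<rho>] by auto
    have "norm (V y - V x - deriv_blinfun V x (y - x)) \<le> norm (y - x) * \<eta>"
    proof (rule differentiable_bound_linearization[where S = "ball x (min \<rho> d)" and f' = "\<lambda>z. blinfun_apply (deriv_blinfun V z)"])
      fix t :: real assume "t \<in> {0..1}"
      then have "norm (t *\<^sub>R (y - x)) \<le> norm (y - x)" by (simp add: mult_left_le_one_le)
      then show "x + t *\<^sub>R (y - x) \<in> ball x (min \<rho> d)" using y by (simp add: dist_norm)
    next
      fix z assume z: "z \<in> ball x (min \<rho> d)"
      show "(V has_derivative blinfun_apply (deriv_blinfun V z)) (at z within ball x (min \<rho> d))"
        by (rule has_derivative_at_withinI[OF deriv_blinfun_apply[OF M(1) V]]) (use z sub \<rho> in auto)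
      have "norm (deriv_blinfun V z - deriv_blinfun V x) \<le> \<eta>"
      proof -
        have "x \<in> ball x (min \<rho> d)" using \<rho> d by simp
        then have "x \<in> tube K \<rho>" "z \<in> tube K \<rho>" using sub z by blast+
        moreover have "dist z x < d" using z by (simp add: dist_commute)
        ultimately show ?thesis using d(2)[of x z] by (simp add: dist_norm)
      qed
      then show "onorm (blinfun_apply (deriv_blinfun V z) - blinfun_apply (deriv_blinfun V x)) \<le> \<eta>"
        by (simp add: norm_blinfun.rep_eq minus_blinfun.rep_eq fun_diff_def)
    qed (use \<rho> d in auto)
    then show "norm (V y - V x - deriv_blinfun V x (y - x)) \<le> \<eta> * norm (y - x)" by (simp add: mult.commute)
  qed (use \<rho> d in auto)
qed

lemma family_uniform_continuity:
  fixes g :: "real \<Rightarrow> real \<Rightarrow> 'a::real_normed_vector"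
  assumes g: "continuous_on ({0..e} \<times> {0..1}) (\<lambda>(s, t). g s t)" and t: "t \<in> {0..1}" and \<eta>: "\<eta> > 0"
  shows "\<forall>\<^sub>F t' in at t within {0..1}. \<forall>r\<in>{0..e}. norm (g r t' - g r t) \<le> \<eta>"
proof -
  have "uniformly_continuous_on ({0..e} \<times> {0..1}) (\<lambda>(s, t). g s t)"
    by (intro compact_uniformly_continuous g compact_Times) auto
  then obtain d where d: "d > 0" "\<And>x y. x \<in> {0..e} \<times> {0..1} \<Longrightarrow> y \<in> {0..e} \<times> {0..1} \<Longrightarrow> dist y x < d \<Longrightarrow>
      dist ((\<lambda>(s, t). g s t) y) ((\<lambda>(s, t). g s t) x) < \<eta>"
    using \<eta> unfolding uniformly_continuous_on_def by meson
  show ?thesis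
    unfolding eventually_at
  proof (intro exI[of _ d] conjI ballI impI)
    fix t' r assume "t' \<in> {0..1}" "t' \<noteq> t \<and> dist t' t < d" "r \<in> {0..e}"
    then show "norm (g r t' - g r t) \<le> \<eta>"
      using d(2)[of "(r, t)" "(r, t')"] t by (simp add: dist_Pair_Pair dist_norm)
  qed (rule d)
qed

text \<open>The mean value inequality on the segment from t to t'; uniform continuity of g' on the
  compact rectangle provides one neighbourhood of t for all r.\<close>

lemma family_uniform_linearization:
  fixes g :: "real \<Rightarrow> real \<Rightarrow> 'a::real_normed_vector"
  assumes d: "\<And>s t. s \<in> {0..e} \<Longrightarrow> t \<in> {0..1} \<Longrightarrow> (g s has_vector_derivative g' s t) (at t within {0..1})"
    and g': "continuous_on ({0..e} \<times> {0..1}) (\<lambda>(s, t). g' s t)" and t: "t \<in> {0..1}" and \<eta>: "\<eta> > 0"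
  shows "\<forall>\<^sub>F t' in at t within {0..1}. \<forall>r\<in>{0..e}. norm (g r t' - g r t - (t' - t) *\<^sub>R g' r t) \<le> \<eta> * \<bar>t' - t\<bar>"
proof -
  obtain \<delta> where \<delta>: "\<delta> > 0" "\<And>t' r. t' \<in> {0..1} \<Longrightarrow> dist t' t < \<delta> \<Longrightarrow> r \<in> {0..e} \<Longrightarrow> norm (g' r t' - g' r t) \<le> \<eta>"
    using family_uniform_continuity[OF g' t \<eta>] \<eta> unfolding eventually_at
    by (metis cancel_comm_monoid_add_class.diff_cancel less_eq_real_def norm_zero)
  show ?thesis
    unfolding eventually_at
  proof (intro exI[of _ \<delta>] conjI ballI impI)
    fix t' r assume t': "t' \<in> {0..1}" "t' \<noteq> t \<and> dist t' t < \<delta>" "r \<in> {0..e}"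
    have "norm (g r t' - g r t - (t' - t) *\<^sub>R g' r t) \<le> norm (t' - t) * \<eta>"
    proof (rule vector_differentiable_bound_linearization[where S = "closed_segment t t'" and f' = "g' r"])
      have sub: "closed_segment t t' \<subseteq> {0..1}" using t t' by (auto simp: closed_segment_eq_real_ivl split: if_splits)
      fix x assume x: "x \<in> closed_segment t t'"
      show "(g r has_vector_derivative g' r x) (at x within closed_segment t t')"
        using x sub t' by (intro has_vector_derivative_within_subset[OF d _]) auto
      show "norm (g' r x - g' r t) \<le> \<eta>"
        using x sub t' dist_in_closed_segment[OF x] by (intro \<delta>(2)) (auto simp: dist_commute)
    qed auto
    then show "norm (g r t' - g r t - (t' - t) *\<^sub>R g' r t) \<le> \<eta> * \<bar>t' - t\<bar>" by (simp add: mult.commute)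
  qed (rule \<delta>)
qed

lemma compact_family_bound:
  fixes g :: "real \<Rightarrow> real \<Rightarrow> 'a::real_normed_vector"
  assumes "continuous_on ({0..e} \<times> T) (\<lambda>(s, t). g s t)" "compact T"
  obtains B where "B \<ge> 0" "\<And>s t. s \<in> {0..e} \<Longrightarrow> t \<in> T \<Longrightarrow> norm (g s t) \<le> B"
proof -
  have "bounded ((\<lambda>(s, t). g s t) ` ({0..e} \<times> T))"
    by (intro compact_imp_bounded compact_continuous_image compact_Times assms) auto
  then obtain B where "\<And>x. x \<in> {0..e} \<times> T \<Longrightarrow> norm ((\<lambda>(s, t). g s t) x) \<le> B"
    unfolding bounded_iff by blast
  then have "norm (g s t) \<le> \<bar>B\<bar>" if "s \<in> {0..e}" "t \<in> T" for s t
    using that by (metis SigmaI abs_ge_self case_prod_conv order_trans)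
  then show ?thesis using that[of "\<bar>B\<bar>"] by auto
qed

lemma linear_ode_solution:
  fixes A :: "real \<Rightarrow> real \<Rightarrow> 'a::banach \<Rightarrow>\<^sub>L 'a"
  assumes T: "compact T" and A: "continuous_on ({0..e} \<times> T) (\<lambda>(s, t). A s t)"
    and H: "continuous_on ({0..e} \<times> T) (\<lambda>(s, t). H s t)" and z0: "continuous_on T z0"
  obtains z where "continuous_on ({0..e} \<times> T) (\<lambda>(s, t). z s t)"
    "\<And>s t. s \<in> {0..e} \<Longrightarrow> t \<in> T \<Longrightarrow> z s t = z0 t + integral {0..s} (\<lambda>r. A r t (z r t) + H r t)"
proof -
  obtain L where L: "L \<ge> 0" "\<And>s t. s \<in> {0..e} \<Longrightarrow> t \<in> T \<Longrightarrow> norm (A s t) \<le> L"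
    using compact_family_bound[OF A T] by blast
  show ?thesis
  proof (rule picard[of T z0 "\<lambda>_. UNIV" e "\<lambda>s t y. A s t y + H s t" L, OF T z0])
    fix u :: "real \<Rightarrow> real \<Rightarrow> 'a" assume "continuous_on ({0..e} \<times> T) (\<lambda>(s, t). u s t)"
    then show "continuous_on ({0..e} \<times> T) (\<lambda>(s, t). A s t (u s t) + H s t)"
      using A H unfolding split_beta by (intro continuous_intros)
  next
    fix s t :: real and y z :: 'a assume "s \<in> {0..e}" "t \<in> T"
    then show "norm (A s t y + H s t - (A s t z + H s t)) \<le> L * norm (y - z)"
      using norm_blinfun[of "A s t" "y - z"] mult_right_mono[OF L(2), of s t "norm (y - z)"]
      by (simp add: blinfun.diff_right)
  next
    fix u :: "real \<Rightarrow> real \<Rightarrow> 'a" assume "continuous_on ({0..e} \<times> T) (\<lambda>(s, t). u s t)"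
      "\<And>s t. s \<in> {0..e} \<Longrightarrow> t \<in> T \<Longrightarrow> u s t = z0 t + integral {0..s} (\<lambda>r. A r t (u r t) + H r t)"
    then show thesis by (rule that)
  qed (use L in auto)
qed

lemma linear_ode_unique:
  fixes A :: "real \<Rightarrow> 'a::banach \<Rightarrow>\<^sub>L 'a"
  assumes A: "continuous_on {0..e} A"
    and z: "\<And>s. s \<in> {0..e} \<Longrightarrow> (z has_vector_derivative A s (z s)) (at s within {0..e})"
    and 0: "z 0 = 0" and s: "s \<in> {0..e}"
  shows "z s = 0"
proof -
  have "bounded (A ` {0..e})" by (intro compact_imp_bounded compact_continuous_image A) auto
  then obtain L where L: "\<And>s. s \<in> {0..e} \<Longrightarrow> norm (A s) \<le> L" unfolding bounded_iff by blast
  show ?thesis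
  proof (rule linear_growth_zero[OF z _ _ 0 s])
    show "0 \<le> L" using L[OF s] norm_ge_zero order_trans by blast
    show "norm (A r (z r)) \<le> L * norm (z r)" if "r \<in> {0..e}" for r
      using norm_blinfun[of "A r" "z r"] mult_right_mono[OF L[OF that], of "norm (z r)"] by simp
  qed
qed


text \<open>The t-derivative of a solution solves the equation with the same \<open>A\<close> and
  inhomogeneity A' z + H', whose regularity is known from the induction hypothesis for z; this is
  why \<open>H\<close>, \<open>z0\<close> and \<open>z\<close> vary in the induction. Closedness
  comes from uniqueness: the difference of the end values solves the homogeneous equation starting
  at 0.\<close>

lemma linear_ode_family:
  fixes A :: "real \<Rightarrow> real \<Rightarrow> 'a::euclidean_space \<Rightarrow>\<^sub>L 'a"
  assumes e: "0 \<le> e" and m: "m \<in> {Free, Closed}"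
  shows "Ck_family m {0..e} k A \<Longrightarrow> Ck_family m {0..e} k H \<Longrightarrow> Ck_family m {0..e} k (\<lambda>_. z0) \<Longrightarrow>
    continuous_on ({0..e} \<times> {0..1}) (\<lambda>(s, t). z s t) \<Longrightarrow>
    (\<And>s t. s \<in> {0..e} \<Longrightarrow> t \<in> {0..1} \<Longrightarrow> z s t = z0 t + integral {0..s} (\<lambda>r. A r t (z r t) + H r t)) \<Longrightarrow>
    Ck_family m {0..e} k z"
proof (induction k arbitrary: H z0 z)
  case (0 H z0 z)
  have g: "continuous_on ({0..e} \<times> {0..1}) (\<lambda>(s, t). A s t (z s t) + H s t)"
    using Ck_family_continuous[OF 0(1)] Ck_family_continuous[OF 0(2)] 0(4) unfolding split_beta
    by (intro continuous_intros)
  have D: "((\<lambda>s. z s t) has_vector_derivative A s t (z s t) + H s t) (at s within {0..e})"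
    if "s \<in> {0..e}" "t \<in> {0..1}" for s t
    using picard_derivative[OF g 0(5) that] .
  have "endpoints_ok m (z s 0) (z s 1)" if s: "s \<in> {0..e}" for s
  proof (cases m)
    case Closed
    have eq: "A r 0 = A r 1" "H r 0 = H r 1" if "r \<in> {0..e}" for r
      using Ck_family_endpoints[OF 0(1) that] Ck_family_endpoints[OF 0(2) that] Closed by auto
    have "z s 0 - z s 1 = 0"
    proof (rule linear_ode_unique[where A = "\<lambda>r. A r 0" and z = "\<lambda>s. z s 0 - z s 1", OF _ _ _ s])
      show "continuous_on {0..e} (\<lambda>r. A r 0)"
        by (rule continuous_on_slice1[OF Ck_family_continuous[OF 0(1)]]) simp
      show "((\<lambda>s. z s 0 - z s 1) has_vector_derivative A r 0 (z r 0 - z r 1)) (at r within {0..e})"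
        if r: "r \<in> {0..e}" for r
        using has_vector_derivative_diff[OF D[OF r, of 0] D[OF r, of 1]] eq[OF r] by (simp add: blinfun.diff_right)
      show "z 0 0 - z 0 1 = 0"
        using 0(5)[of 0 0] 0(5)[of 0 1] Ck_family_endpoints[OF 0(3), of 0] Closed e by simp
    qed
    then show ?thesis using Closed by simp
  qed (use m in auto)
  then show ?case using 0(4) by simp
next
  case (Suc k H z0 z)
  note fA = Ck_family_mono[OF Suc.prems(1)] and fH = Ck_family_mono[OF Suc.prems(2)]
  have fz: "Ck_family m {0..e} k z"
    by (rule Suc.IH[OF fA fH Ck_family_mono[OF Suc.prems(3)] Suc.prems(4,5)])
  define A' where "A' = (\<lambda>s. nderiv 1 (A s))"
  define H' where "H' = (\<lambda>s. nderiv 1 (H s))"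
  note dA = Ck_family_nderiv_1[OF Suc.prems(1), folded A'_def]
  note dH = Ck_family_nderiv_1[OF Suc.prems(2), folded H'_def]
  note dz0 = Ck_family_nderiv_1[OF Suc.prems(3)]
  define K where "K = (\<lambda>s t. A' s t (z s t) + H' s t)"
  have A't: "A' s = nderiv 1 (A s)" "H' s = nderiv 1 (H s)" for s by (simp_all add: A'_def H'_def)
  have fK: "Ck_family m {0..e} k K"
    unfolding K_def
    by (intro Ck_family_add Ck_family_bilinear[OF bounded_bilinear_blinfun_apply disjI1[OF refl]] fz dA(1) dH(1))
  have e0: "(0::real) \<in> {0..e}" using e by simp
  have cz0: "continuous_on {0..1} (nderiv 1 z0)"
    by (rule continuous_on_slice2[OF Ck_family_continuous[OF dz0(1)] e0])
  obtain w where w: "continuous_on ({0..e} \<times> {0..1}) (\<lambda>(s, t). w s t)"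
    "\<And>s t. s \<in> {0..e} \<Longrightarrow> t \<in> {0..1} \<Longrightarrow> w s t = nderiv 1 z0 t + integral {0..s} (\<lambda>r. A r t (w r t) + K r t)"
    using linear_ode_solution[OF compact_Icc Ck_family_continuous[OF Suc.prems(1)] Ck_family_continuous[OF fK] cz0]
    by blast
  have fw: "Ck_family m {0..e} k w" by (rule Suc.IH[OF fA fK dz0(1) w])
  obtain L where L: "L \<ge> 0" "\<And>s t. s \<in> {0..e} \<Longrightarrow> t \<in> {0..1} \<Longrightarrow> norm (A s t) \<le> L"
    using compact_family_bound[OF Ck_family_continuous[OF Suc.prems(1)] compact_Icc] by blast
  obtain L' where L': "L' \<ge> 0" "\<And>s t. s \<in> {0..e} \<Longrightarrow> t \<in> {0..1} \<Longrightarrow> norm (A' s t) \<le> L'"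
    using compact_family_bound[OF Ck_family_continuous[OF dA(1)] compact_Icc] by (auto simp: A't)
  obtain Z where Z: "Z \<ge> 0" "\<And>s t. s \<in> {0..e} \<Longrightarrow> t \<in> {0..1} \<Longrightarrow> norm (z s t) \<le> Z"
    using compact_family_bound[OF Suc.prems(4) compact_Icc] by blast
  have dz: "(z s has_vector_derivative w s t) (at t within {0..1})" if s: "s \<in> {0..e}" and t: "t \<in> {0..1}" for s t
  proof (rule ode_parameter_derivative[where g = "\<lambda>s t. A s t (z s t) + H s t" and u = z and ?u0.0 = z0
        and A = "\<lambda>r. blinfun_apply (A r t)" and H = "\<lambda>r. K r t" and w = "\<lambda>s. w s t" and L = L, OF e t])
    show "continuous_on ({0..e} \<times> {0..1}) (\<lambda>(s, t). A s t (z s t) + H s t)"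
      using Ck_family_continuous[OF Suc.prems(1)] Ck_family_continuous[OF Suc.prems(2)] Suc.prems(4) unfolding split_beta
      by (intro continuous_intros)
    show "(z0 has_vector_derivative nderiv 1 z0 t) (at t within {0..1})" by (rule dz0(2)[OF e0 t])
    show "norm (A r t v) \<le> L * norm v" if "r \<in> {0..e}" for r v
      using norm_blinfun[of "A r t" v] mult_right_mono[OF L(2)[OF that t], of "norm v"] by simp
    show "linear (blinfun_apply (A r t))" for r by (simp add: blinfun.bounded_linear_right bounded_linear.linear)
    show "continuous_on {0..e} (\<lambda>s. w s t)" by (rule continuous_on_slice1[OF w(1) t])
    then show "continuous_on {0..e} (\<lambda>r. A r t (w r t) + K r t)"
      by (intro continuous_intros continuous_on_slice1[OF Ck_family_continuous[OF Suc.prems(1)] t]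
          continuous_on_slice1[OF Ck_family_continuous[OF fK] t])
    fix \<eta> :: real assume \<eta>: "\<eta> > 0"
    \<comment> \<open>Three errors share \<eta>: the expansion of \<open>A\<close> acting on z,
      weighted by Z; the increment of z under A', weighted by L'; and the expansion of
      \<open>H\<close>.\<close>
    define c where "c = \<eta> / (Z + L' + 1)"
    have c: "c > 0" "Z * c + L' * c + c = \<eta>"
      using \<eta> Z(1) L'(1) by (auto simp: c_def add_nonneg_pos) (simp add: field_simps add_nonneg_eq_0_iff)
    have 1: "\<forall>\<^sub>F t' in at t within {0..1}. \<forall>r\<in>{0..e}. norm (A r t' - A r t - (t' - t) *\<^sub>R A' r t) \<le> c * \<bar>t' - t\<bar>"
      using family_uniform_linearization[OF dA(2)[folded A't] Ck_family_continuous[OF dA(1)] t c(1)] by (simp add: A't)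
    have 2: "\<forall>\<^sub>F t' in at t within {0..1}. \<forall>r\<in>{0..e}. norm (H r t' - H r t - (t' - t) *\<^sub>R H' r t) \<le> c * \<bar>t' - t\<bar>"
      using family_uniform_linearization[OF dH(2)[folded A't] Ck_family_continuous[OF dH(1)] t c(1)] by (simp add: A't)
    have 3: "\<forall>\<^sub>F t' in at t within {0..1}. \<forall>r\<in>{0..e}. norm (z r t' - z r t) \<le> c"
      by (rule family_uniform_continuity[OF Suc.prems(4) t c(1)])
    have 4: "\<forall>\<^sub>F t' in at t within {0..1}. t' \<in> {0..1}" by (simp add: eventually_at_filter)
    from 1 2 3 4 show "\<forall>\<^sub>F t' in at t within {0..1}. \<forall>r\<in>{0..e}.
        norm (A r t' (z r t') + H r t' - (A r t (z r t) + H r t) - (t' - t) *\<^sub>R K r t - A r t (z r t' - z r t))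
        \<le> \<eta> * (\<bar>t' - t\<bar> + norm (z r t' - z r t))"
    proof eventually_elim
      case (elim t')
      show ?case
      proof
        fix r assume r: "r \<in> {0..e}"
        let ?h = "t' - t"
        have "A r t' (z r t') + H r t' - (A r t (z r t) + H r t) - ?h *\<^sub>R K r t - A r t (z r t' - z r t)
            = (A r t' - A r t - ?h *\<^sub>R A' r t) (z r t') + (?h *\<^sub>R A' r t (z r t' - z r t)
              + (H r t' - H r t - ?h *\<^sub>R H' r t))"
          by (simp add: K_def blinfun.diff_left blinfun.diff_right blinfun.scaleR_left blinfun.add_left algebra_simps)
        moreover have "norm ((A r t' - A r t - ?h *\<^sub>R A' r t) (z r t')) \<le> (c * \<bar>?h\<bar>) * Z"
          using elim r Z c(1) by (intro order_trans[OF norm_blinfun] mult_mono) auto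
        moreover have "norm (?h *\<^sub>R A' r t (z r t' - z r t)) \<le> \<bar>?h\<bar> * (L' * c)"
        proof -
          have "norm (A' r t (z r t' - z r t)) \<le> L' * c"
            using elim r L' t by (intro order_trans[OF norm_blinfun] mult_mono) auto
          then show ?thesis by (simp add: mult_left_mono)
        qed
        moreover have "norm (H r t' - H r t - ?h *\<^sub>R H' r t) \<le> c * \<bar>?h\<bar>" using elim r by blast
        ultimately have "norm (A r t' (z r t') + H r t' - (A r t (z r t) + H r t) - ?h *\<^sub>R K r t - A r t (z r t' - z r t))
            \<le> (c * \<bar>?h\<bar>) * Z + (\<bar>?h\<bar> * (L' * c) + c * \<bar>?h\<bar>)"
          by (metis norm_triangle_mono)
        also have "\<dots> = (Z * c + L' * c + c) * \<bar>?h\<bar>" by (simp add: algebra_simps)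
        also have "\<dots> \<le> \<eta> * (\<bar>?h\<bar> + norm (z r t' - z r t))" unfolding c(2) using \<eta> by (intro mult_left_mono) auto
        finally show "norm (A r t' (z r t') + H r t' - (A r t (z r t) + H r t) - ?h *\<^sub>R K r t - A r t (z r t' - z r t))
            \<le> \<eta> * (\<bar>?h\<bar> + norm (z r t' - z r t))" .
      qed
    qed
  qed (use Suc.prems(5) w(2) t s L(1) in auto)
  show ?case by (rule Ck_family_SucI[OF fz fw dz])
qed

text \<open>Differentiation under the integral sign: the t-derivatives of a solution satisfy the
  differentiated integral equation. Read as an equation in s, this says that d/ds commutes with
  every t-derivative, as jets of a flow require.\<close>

lemma family_integral:
  fixes g :: "real \<Rightarrow> real \<Rightarrow> 'a::banach"
  assumes g: "smooth_family m {0..e} g" and y0: "smooth_curve y0"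
    and u: "\<And>s t. s \<in> {0..e} \<Longrightarrow> t \<in> {0..1} \<Longrightarrow> u s t = y0 t + integral {0..s} (\<lambda>r. g r t)"
    and s: "s \<in> {0..e}" and t: "t \<in> {0..1}"
  shows "nderiv k (u s) t = nderiv k y0 t + integral {0..s} (\<lambda>r. nderiv k (g r) t)"
proof -
  have "((\<lambda>t. nderiv k y0 t + integral {0..s} (\<lambda>r. nderiv k (g r) t)) has_vector_derivative
      nderiv (Suc k) y0 t + integral {0..s} (\<lambda>r. nderiv (Suc k) (g r) t)) (at t within {0..1})"
    if t: "t \<in> {0..1}" for k t
  proof (intro has_vector_derivative_add smooth_curve_has_deriv y0 t)
    have sub: "{0..s} \<subseteq> {0..e}" using s by auto
    show "((\<lambda>t. integral {0..s} (\<lambda>r. nderiv k (g r) t)) has_vector_derivative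
      integral {0..s} (\<lambda>r. nderiv (Suc k) (g r) t)) (at t within {0..1})"
      unfolding cbox_interval[symmetric]
    proof (rule leibniz_rule_vector_derivative[of "cbox 0 1"])
      fix x r :: real assume "x \<in> cbox 0 1" "r \<in> cbox 0 s"
      then show "((\<lambda>x. nderiv k (g r) x) has_vector_derivative nderiv (Suc k) (g r) x) (at x within cbox 0 1)"
        using smooth_family_derivative[OF g, of r x k] sub by auto
    next
      fix x :: real assume "x \<in> cbox 0 1"
      then show "(\<lambda>r. nderiv k (g r) x) integrable_on cbox 0 s"
        unfolding cbox_interval
        by (intro integrable_continuous_real continuous_on_subset[OF continuous_on_slice1[OF smooth_family_nderiv_continuous[OF g]] sub]) auto
    next
      have "continuous_on ({0..1} \<times> {0..s}) (\<lambda>x. nderiv (Suc k) (g (snd x)) (fst x))"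
        by (rule continuous_on_compose2[OF smooth_family_nderiv_continuous[OF g, unfolded split_beta], where f = "\<lambda>x. (snd x, fst x)", simplified])
           (use sub in \<open>auto intro!: continuous_intros\<close>)
      then show "continuous_on (cbox 0 1 \<times> cbox 0 s) (\<lambda>(x, r). nderiv (Suc k) (g r) x)"
        by (simp add: split_beta)
    qed (use t in auto)
  qed
  from nderiv_eq_family[of "u s" "\<lambda>k t. nderiv k y0 t + integral {0..s} (\<lambda>r. nderiv k (g r) t)", OF _ this t]
  show ?thesis using u[OF s] by simp
qed

text \<open>Regularity is bootstrapped: if u is C^k in t, so is \<open>deriv_blinfun V\<close> along
  u, and then the linearized equation has a C^k solution, which is the t-derivative of u. The last
  conclusion supplies the velocity of every jet coordinate along the flow.\<close>

theorem smooth_flow: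
  fixes V :: "'a::euclidean_space \<Rightarrow> 'a"
  assumes M: "open M" and V: "smooth_on M V" and m: "m \<in> {Free, Closed}"
    and y0: "smooth_ends m y0" "\<And>t. t \<in> {0..1} \<Longrightarrow> y0 t \<in> M"
  obtains e u where "e > 0" "smooth_family m {0..e} u" "smooth_family m {0..e} (\<lambda>s t. V (u s t))"
    "\<And>s t. s \<in> {0..e} \<Longrightarrow> t \<in> {0..1} \<Longrightarrow> u s t \<in> M"
    "\<And>t. t \<in> {0..1} \<Longrightarrow> u 0 t = y0 t"
    "\<And>k s t. s \<in> {0..e} \<Longrightarrow> t \<in> {0..1} \<Longrightarrow>
      ((\<lambda>s. nderiv k (u s) t) has_vector_derivative nderiv k (\<lambda>t. V (u s t)) t) (at s within {0..e})"
proof -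
  have Vk: "Ck_on k M V" for k using V by (simp add: smooth_on_def)
  have smy: "smooth_curve y0" using y0(1) by (simp add: smooth_ends_def)
  have cy0: "continuous_on {0..1} y0" by (rule smooth_curve_continuous[OF smy])
  define C where "C = y0 ` {0..1}"
  have C: "compact C" "C \<subseteq> M" using y0(2) by (auto simp: C_def intro!: compact_continuous_image cy0)
  obtain \<rho> where \<rho>: "\<rho> > 0" "tube C \<rho> \<subseteq> M" using tube_exists[OF C(1) M C(2)] by blast
  define K where "K = tube C \<rho>"
  have K: "compact K" "K \<subseteq> M" using tube_compact[OF C(1)] \<rho> by (auto simp: K_def)
  have ball: "cball (y0 t) \<rho> \<subseteq> K" if "t \<in> {0..1}" for t
    using that unfolding K_def by (intro cball_subset_tube) (auto simp: C_def)
  obtain B where B: "B \<ge> 0" "\<And>x. x \<in> K \<Longrightarrow> norm (V x) \<le> B"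
  proof -
    have "bounded (V ` K)"
      by (intro compact_imp_bounded compact_continuous_image continuous_on_subset[OF Ck_on_continuous[OF Vk] K(2)] K)
    then obtain B where "\<And>x. x \<in> K \<Longrightarrow> norm (V x) \<le> B" unfolding bounded_iff by blast
    then show ?thesis using that[of "\<bar>B\<bar>"] by (meson abs_ge_self abs_ge_zero order_trans)
  qed
  obtain L where L: "L \<ge> 0" "\<And>x. x \<in> K \<Longrightarrow> norm (deriv_blinfun V x) \<le> L"
  proof -
    have "bounded (deriv_blinfun V ` K)"
      by (intro compact_imp_bounded compact_continuous_image continuous_on_subset[OF deriv_blinfun_continuous[OF Vk] K(2)] K)
    then obtain B where "\<And>x. x \<in> K \<Longrightarrow> norm (deriv_blinfun V x) \<le> B" unfolding bounded_iff by blast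
    then show ?thesis using that[of "\<bar>B\<bar>"] by (meson abs_ge_self abs_ge_zero order_trans)
  qed
  have lip: "norm (V y - V z) \<le> L * norm (y - z)"
    if t: "t \<in> {0..1}" and yz: "y \<in> cball (y0 t) \<rho>" "z \<in> cball (y0 t) \<rho>" for t y z
  proof (rule differentiable_bound[where S = "cball (y0 t) \<rho>" and f' = "\<lambda>x. blinfun_apply (deriv_blinfun V x)"])
    fix x assume "x \<in> cball (y0 t) \<rho>"
    then have x: "x \<in> K" using ball[OF t] by blast
    then show "(V has_derivative blinfun_apply (deriv_blinfun V x)) (at x within cball (y0 t) \<rho>)"
      using K(2) by (intro has_derivative_at_withinI[OF deriv_blinfun_apply[OF M Vk]]) auto
    show "onorm (blinfun_apply (deriv_blinfun V x)) \<le> L" using L(2)[OF x] by (simp add: norm_blinfun.rep_eq)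
  qed (use yz in auto)
  \<comment> \<open>The speed on K is at most B, so up to this time no curve leaves its ball of
    radius \<rho>, uniformly in t. The added 1 avoids division by 0.\<close>
  define e where "e = \<rho> / (B + 1)"
  have e: "e > 0" "B * e \<le> \<rho>" using \<rho> B(1) by (auto simp: e_def field_simps)
  have Vcont: "continuous_on ({0..e} \<times> {0..1}) (\<lambda>(s, t). V (u s t))"
    if "continuous_on ({0..e} \<times> {0..1}) (\<lambda>(s, t). u s t)"
      "\<And>s t. s \<in> {0..e} \<Longrightarrow> t \<in> {0..1} \<Longrightarrow> u s t \<in> cball (y0 t) \<rho>" for u
    unfolding split_beta
    by (rule continuous_on_compose2[OF continuous_on_subset[OF Ck_on_continuous[OF Vk] K(2)] that(1)[unfolded split_beta]])
       (auto intro!: subsetD[OF ball that(2)])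
  obtain u where u: "continuous_on ({0..e} \<times> {0..1}) (\<lambda>(s, t). u s t)"
    "\<And>s t. s \<in> {0..e} \<Longrightarrow> t \<in> {0..1} \<Longrightarrow> u s t \<in> cball (y0 t) \<rho>"
    "\<And>s t. s \<in> {0..e} \<Longrightarrow> t \<in> {0..1} \<Longrightarrow> u s t = y0 t + integral {0..s} (\<lambda>r. V (u r t))"
  proof (rule picard[of "{0..1}" y0 "\<lambda>t. cball (y0 t) \<rho>" e "\<lambda>s t y. V y" L, OF compact_Icc cy0])
    fix u :: "real \<Rightarrow> real \<Rightarrow> 'a" and s t :: real
    assume u: "continuous_on ({0..e} \<times> {0..1}) (\<lambda>(s, t). u s t)"
      "\<And>s t. s \<in> {0..e} \<Longrightarrow> t \<in> {0..1} \<Longrightarrow> u s t \<in> cball (y0 t) \<rho>" and s: "s \<in> {0..e}" and t: "t \<in> {0..1}"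
    have "continuous_on {0..s} (\<lambda>r. V (u r t))"
      by (rule continuous_on_subset[OF continuous_on_slice1[OF Vcont[OF u] t]]) (use s in auto)
    then have "norm (integral {0..s} (\<lambda>r. V (u r t))) \<le> B * (s - 0)"
      using s u(2) t ball[OF t] by (intro integral_bound B(2)) auto
    also have "\<dots> \<le> B * e" using s B(1) by (intro mult_left_mono) auto
    finally show "y0 t + integral {0..s} (\<lambda>r. V (u r t)) \<in> cball (y0 t) \<rho>" using e(2) by (simp add: dist_norm)
  qed (use Vcont lip L(1) \<rho>(1) that in auto)
  have uK: "u s t \<in> K" if "s \<in> {0..e}" "t \<in> {0..1}" for s t using u(2) ball that by blast
  have uM: "u s t \<in> M" if "s \<in> {0..e}" "t \<in> {0..1}" for s t using uK K(2) that by blast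
  note Vu = Vcont[OF u(1,2)]
  have fu: "Ck_family m {0..e} k u" for k
  proof (induction k)
    case 0
    have "endpoints_ok m (u s 0) (u s 1)" if s: "s \<in> {0..e}" for s
    proof (cases m)
      case Closed
      have y01: "y0 0 = y0 1" using y0(1) Closed by (auto simp: smooth_ends_def dest: spec[of _ 0])
      have "u s 0 - u s 1 = 0"
      proof (rule linear_growth_zero[where f' = "\<lambda>r. V (u r 0) - V (u r 1)" and f = "\<lambda>s. u s 0 - u s 1", OF _ L(1) _ _ s])
        fix r assume r: "r \<in> {0..e}"
        show "((\<lambda>s. u s 0 - u s 1) has_vector_derivative V (u r 0) - V (u r 1)) (at r within {0..e})"
          using picard_derivative[OF Vu u(3) r] by (intro has_vector_derivative_diff) auto
        show "norm (V (u r 0) - V (u r 1)) \<le> L * norm (u r 0 - u r 1)"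
          using u(2)[OF r, of 0] u(2)[OF r, of 1] y01 by (intro lip[of 0]) auto
      next
        show "u 0 0 - u 0 1 = 0" using u(3)[of 0 0] u(3)[of 0 1] y01 e by simp
      qed
      then show ?thesis using Closed by simp
    qed (use m in auto)
    then show ?case using u(1) by simp
  next
    case (Suc k)
    define A where "A = (\<lambda>s t. deriv_blinfun V (u s t))"
    have fA: "Ck_family m {0..e} k A"
      unfolding A_def by (rule deriv_blinfun_family[OF M m Vk Suc uM])
    have y0f: "Ck_family m {0..e} (Suc k) (\<lambda>_. y0)"
      using smooth_ends_family[OF y0(1)] by (simp add: smooth_family_def del: Ck_family.simps)
    note dy0 = Ck_family_nderiv_1[OF y0f]
    have e0: "0 \<in> {0..e}" "0 \<le> e" using e by auto
    have cy0': "continuous_on {0..1} (nderiv 1 y0)"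
      by (rule continuous_on_slice2[OF Ck_family_continuous[OF dy0(1)] e0(1)])
    have cz: "continuous_on ({0..e} \<times> {0..1}) (\<lambda>(s, t). 0 :: 'a)" by simp
    obtain w where w: "continuous_on ({0..e} \<times> {0..1}) (\<lambda>(s, t). w s t)"
      "\<And>s t. s \<in> {0..e} \<Longrightarrow> t \<in> {0..1} \<Longrightarrow> w s t = nderiv 1 y0 t + integral {0..s} (\<lambda>r. A r t (w r t) + 0)"
      using linear_ode_solution[OF compact_Icc Ck_family_continuous[OF fA] cz cy0'] by blast
    have fw: "Ck_family m {0..e} k w"
      by (rule linear_ode_family[OF e0(2) m fA Ck_family_zero dy0(1) w])
    have "compact ((\<lambda>(s, t). u s t) ` ({0..e} \<times> {0..1}))"
      by (intro compact_continuous_image u(1) compact_Times) auto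
    note lin = uniform_linearization[OF this M _ Vk]
    have "(u s has_vector_derivative w s t) (at t within {0..1})" if s: "s \<in> {0..e}" and t: "t \<in> {0..1}" for s t
    proof (rule ode_parameter_derivative[where g = "\<lambda>s t. V (u s t)" and u = u and ?u0.0 = y0
          and A = "\<lambda>r. blinfun_apply (A r t)" and H = "\<lambda>r. 0" and w = "\<lambda>s. w s t" and L = L, OF e0(2) t Vu])
      show "(y0 has_vector_derivative nderiv 1 y0 t) (at t within {0..1})" by (rule dy0(2)[OF e0(1) t])
      show "norm (A r t v) \<le> L * norm v" if "r \<in> {0..e}" for r v
        using norm_blinfun[of "A r t" v] mult_right_mono[OF L(2)[OF uK[OF that t]], of "norm v"] by (simp add: A_def)
      show "linear (blinfun_apply (A r t))" for r by (simp add: blinfun.bounded_linear_right bounded_linear.linear)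
      show "continuous_on {0..e} (\<lambda>s. w s t)" by (rule continuous_on_slice1[OF w(1) t])
      then show "continuous_on {0..e} (\<lambda>r. A r t (w r t) + 0)"
        by (intro continuous_intros continuous_on_slice1[OF Ck_family_continuous[OF fA] t])
      fix \<eta> :: real assume \<eta>: "\<eta> > 0"
      obtain \<delta> where \<delta>: "\<delta> > 0" "\<And>x y. x \<in> (\<lambda>(s, t). u s t) ` ({0..e} \<times> {0..1}) \<Longrightarrow> norm (y - x) < \<delta> \<Longrightarrow>
          norm (V y - V x - deriv_blinfun V x (y - x)) \<le> \<eta> * norm (y - x)"
        using lin[OF _ \<eta>] uM by (metis (no_types, lifting) SigmaE case_prod_conv image_subsetI)
      have "\<forall>\<^sub>F t' in at t within {0..1}. \<forall>r\<in>{0..e}. norm (u r t' - u r t) \<le> \<delta> / 2"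
        using family_uniform_continuity[OF u(1) t, of "\<delta>/2"] \<delta> by simp
      then show "\<forall>\<^sub>F t' in at t within {0..1}. \<forall>r\<in>{0..e}.
          norm (V (u r t') - V (u r t) - (t' - t) *\<^sub>R 0 - A r t (u r t' - u r t)) \<le> \<eta> * (\<bar>t' - t\<bar> + norm (u r t' - u r t))"
      proof eventually_elim
        case (elim t')
        show ?case
        proof
          fix r assume r: "r \<in> {0..e}"
          have "norm (u r t' - u r t) < \<delta>" using elim r \<delta>(1) by force
          then have "norm (V (u r t') - V (u r t) - A r t (u r t' - u r t)) \<le> \<eta> * norm (u r t' - u r t)"
            unfolding A_def using r t by (intro \<delta>(2)) auto
          also have "\<dots> \<le> \<eta> * (\<bar>t' - t\<bar> + norm (u r t' - u r t))" using \<eta> by (intro mult_left_mono) auto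
          finally show "norm (V (u r t') - V (u r t) - (t' - t) *\<^sub>R 0 - A r t (u r t' - u r t)) \<le> \<eta> * (\<bar>t' - t\<bar> + norm (u r t' - u r t))"
            by simp
        qed
      qed
    qed (use u(3) w(2) t s L(1) in auto)
    then show ?case by (rule Ck_family_SucI[OF Suc fw])
  qed
  have su: "smooth_family m {0..e} u" using fu by (simp add: smooth_family_def)
  have sV: "smooth_family m {0..e} (\<lambda>s t. V (u s t))"
    unfolding smooth_family_def using Ck_family_compose[OF M m Vk fu uM] by blast
  show ?thesis
  proof (rule that[OF e(1) su sV uM])
    show "u 0 t = y0 t" if "t \<in> {0..1}" for t using u(3)[of 0 t] that e by simp
    fix k and s t :: real assume "s \<in> {0..e}" "t \<in> {0..1}"
    then show "((\<lambda>s. nderiv k (u s) t) has_vector_derivative nderiv k (\<lambda>t. V (u s t)) t) (at s within {0..e})"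
      by (intro picard_derivative[OF smooth_family_nderiv_continuous[OF sV] family_integral[OF sV smy u(3)]])
  qed
qed

section \<open>Calculus of functions of jets\<close>

lemma tendsto_coordinatewise:
  fixes f :: "'a \<Rightarrow> 'b \<Rightarrow> 'c::topological_space"
  assumes "\<And>i. ((\<lambda>x. f x i) \<longlongrightarrow> l i) F"
  shows "(f \<longlongrightarrow> l) F"
  using assms limitin_componentwise[of "\<lambda>_. euclidean" UNIV f l F]
  by (simp add: euclidean_product_topology limitin_canonical_iff)

lemma continuous_on_coordinate: "continuous_on S (\<lambda>x. x c)"
  by (rule continuous_on_product_then_coordinatewise) (rule continuous_on_id)

text \<open>The jet domain constrains only \<open>Time\<close> and the zeroth positions, so nearness
  is asked of finitely many coordinates and all others of y are free. The division by
  \<open>CARD('n)\<close> comes from bounding the norm by the sum of the components.\<close>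

lemma jet_domain_update:
  fixes M :: "(real^'n) set"
  assumes "open M" "x \<in> jet_domain M"
  obtains \<delta> where "\<delta> > 0"
    "\<And>y. y Time \<in> {0..1} \<Longrightarrow> (\<And>s. \<bar>y (Pos 0 s) - x (Pos 0 s)\<bar> < \<delta>) \<Longrightarrow> y \<in> jet_domain M"
proof -
  let ?q = "\<lambda>x. (\<chi> s. x (Pos 0 s)) :: real^'n"
  have "?q x \<in> M" using assms by (simp add: jet_domain_def)
  then obtain \<epsilon> where \<epsilon>: "\<epsilon> > 0" "ball (?q x) \<epsilon> \<subseteq> M" using assms(1) open_contains_ball by blast
  define \<delta> where "\<delta> = \<epsilon> / CARD('n)"
  show ?thesis
  proof (rule that[of \<delta>])
    show "\<delta> > 0" using \<epsilon>(1) by (simp add: \<delta>_def)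
    fix y assume y: "y Time \<in> {0..1}" "\<And>s. \<bar>y (Pos 0 s) - x (Pos 0 s)\<bar> < \<delta>"
    have "norm (?q y - ?q x) \<le> (\<Sum>s\<in>UNIV. \<bar>y (Pos 0 s) - x (Pos 0 s)\<bar>)"
      using norm_le_l1_cart[of "?q y - ?q x"] by simp
    also have "\<dots> < (\<Sum>s\<in>(UNIV :: 'n set). \<delta>)" by (rule sum_strict_mono) (use y in auto)
    also have "\<dots> = \<epsilon>" by (simp add: \<delta>_def)
    finally have "?q y \<in> ball (?q x) \<epsilon>" by (simp add: dist_norm norm_minus_commute)
    then show "y \<in> jet_domain M" using \<epsilon>(2) y(1) by (auto simp: jet_domain_def)
  qed
qed

text \<open>The base point is not isolated in its slice, so partial derivatives are unique,
  including the one-sided ones in \<open>Time\<close> at 0 and 1. Thus any formula for the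
  derivative determines \<open>coord_deriv\<close>.\<close>

lemma coord_slice_nontrivial:
  fixes M :: "(real^'n) set"
  assumes M: "open M" and x: "x \<in> jet_domain M"
  shows "at (x c) within coord_slice (jet_domain M) c x \<noteq> bot"
proof (cases "c = Time")
  case True
  have slice: "coord_slice (jet_domain M) c x = {0..1}"
    using x by (auto simp: True coord_slice_def jet_domain_def)
  have ne: "{0..1} \<noteq> {y}" for y :: real
  proof
    assume "{0..1} = {y}"
    then have "0 \<in> {y}" "1 \<in> {y}" by (metis atLeastAtMost_iff order_refl zero_le_one)+
    then show False by simp
  qed
  have "x c islimpt {0..1}"
    by (rule connected_imp_perfect[OF connected_Icc _ ne]) (use x in \<open>simp add: True jet_domain_def\<close>)
  then show ?thesis unfolding slice by (simp add: trivial_limit_within)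
next
  case False
  obtain \<delta> where \<delta>: "\<delta> > 0" "\<And>y. y Time \<in> {0..1} \<Longrightarrow> (\<And>s. \<bar>y (Pos 0 s) - x (Pos 0 s)\<bar> < \<delta>) \<Longrightarrow> y \<in> jet_domain M"
    using jet_domain_update[OF M x] by blast
  have "ball (x c) \<delta> \<subseteq> coord_slice (jet_domain M) c x"
  proof
    fix r assume r: "r \<in> ball (x c) \<delta>"
    have "x(c := r) \<in> jet_domain M"
    proof (rule \<delta>(2))
      show "(x(c := r)) Time \<in> {0..1}" using x False by (simp add: jet_domain_def)
      show "\<bar>(x(c := r)) (Pos 0 s) - x (Pos 0 s)\<bar> < \<delta>" for s
        using r \<delta>(1) by (simp add: dist_real_def abs_minus_commute)
    qed
    then show "r \<in> coord_slice (jet_domain M) c x" by (simp add: coord_slice_def)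
  qed
  then have "x c \<in> interior (coord_slice (jet_domain M) c x)"
    using \<delta>(1) by (meson centre_in_ball interior_maximal open_ball subsetD)
  from at_within_interior[OF this] show ?thesis by simp
qed

context
  fixes M :: "(real^'n) set"
  assumes M: "open M"
begin

abbreviation "JD \<equiv> jet_domain M"

lemma coord_deriv_eqI:
  assumes "x \<in> JD" "((\<lambda>r. f (x(c := r))) has_vector_derivative d) (at (x c) within coord_slice JD c x)"
  shows "coord_deriv JD c f x = d"
  unfolding coord_deriv_def by (rule vector_derivative_within[OF coord_slice_nontrivial[OF M assms(1)] assms(2)])

lemma coord_slice_member: "x \<in> JD \<Longrightarrow> x c \<in> coord_slice JD c x"
  by (simp add: coord_slice_def)

lemma coord_slice_has_derivative_cong:
  fixes f g :: "'n jet \<Rightarrow> 'b::real_normed_vector"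
  assumes x: "x \<in> JD" and eq: "\<And>y. y \<in> JD \<Longrightarrow> f y = g y"
  shows "((\<lambda>r. f (x(c := r))) has_vector_derivative d) (at (x c) within coord_slice JD c x) \<longleftrightarrow>
         ((\<lambda>r. g (x(c := r))) has_vector_derivative d) (at (x c) within coord_slice JD c x)"
proof -
  have "((\<lambda>r. k (x(c := r))) has_vector_derivative d) (at (x c) within coord_slice JD c x)"
    if "((\<lambda>r. h (x(c := r))) has_vector_derivative d) (at (x c) within coord_slice JD c x)"
      "\<And>y. y \<in> JD \<Longrightarrow> k y = h y" for h k :: "'n jet \<Rightarrow> 'b"
    by (rule has_vector_derivative_transform[OF coord_slice_member[OF x] _ that(1)])
       (use that(2) in \<open>simp add: coord_slice_def\<close>)
  then show ?thesis using eq by metis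
qed

lemma coord_Ck_D:
  assumes "coord_Ck_on (Suc k) JD f" "x \<in> JD"
  shows "((\<lambda>r. f (x(c := r))) has_vector_derivative coord_deriv JD c f x) (at (x c) within coord_slice JD c x)"
  using assms unfolding coord_deriv_def coord_Ck_on.simps vector_derivative_works by blast

lemma coord_Ck_cont: "coord_Ck_on k JD f \<Longrightarrow> continuous_on JD f"
  by (cases k) auto

lemma coord_Ck_cong:
  assumes "\<And>y. y \<in> JD \<Longrightarrow> f y = g y"
  shows "coord_Ck_on k JD f \<Longrightarrow> coord_Ck_on k JD g"
  using assms
proof (induction k arbitrary: f g)
  case 0
  then show ?case by (simp cong: continuous_on_cong)
next
  case (Suc k)
  have d: "((\<lambda>r. g (x(c := r))) has_vector_derivative coord_deriv JD c f x) (at (x c) within coord_slice JD c x)"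
    if "x \<in> JD" for x c
    using coord_Ck_D[OF Suc.prems(1) that] coord_slice_has_derivative_cong[where f = f and g = g, OF that Suc.prems(2)] by blast
  have "coord_Ck_on k JD (coord_deriv JD c g)" for c
    by (rule Suc.IH[of "coord_deriv JD c f"]) (use Suc.prems(1) coord_deriv_eqI[OF _ d] in auto)
  moreover have "continuous_on JD g"
    using Suc.prems coord_Ck_cont[OF Suc.prems(1)] by (simp cong: continuous_on_cong)
  ultimately show ?case using d by (auto intro: differentiableI_vector)
qed

lemma coord_Ck_SucI:
  assumes "continuous_on JD f" "\<And>c. coord_Ck_on k JD (g c)"
    and d: "\<And>c x. x \<in> JD \<Longrightarrow> ((\<lambda>r. f (x(c := r))) has_vector_derivative g c x) (at (x c) within coord_slice JD c x)"
  shows "coord_Ck_on (Suc k) JD f"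
proof -
  have "coord_Ck_on k JD (coord_deriv JD c f)" for c
    by (rule coord_Ck_cong[OF _ assms(2)[of c]]) (simp add: coord_deriv_eqI[OF _ d])
  then show ?thesis using assms(1) d by (auto intro: differentiableI_vector)
qed

lemma coord_Ck_mono: "coord_Ck_on (Suc k) JD f \<Longrightarrow> coord_Ck_on k JD f"
  by (induction k arbitrary: f) auto

lemma coord_Ck_const: "coord_Ck_on k JD (\<lambda>x. a)"
proof (induction k arbitrary: a)
  case (Suc k)
  show ?case by (rule coord_Ck_SucI[where g = "\<lambda>c x. 0"]) (use Suc in auto)
qed simp

lemma coord_Ck_proj: "coord_Ck_on k JD (\<lambda>x. x c)"
proof (cases k)
  case 0
  then show ?thesis by (auto intro: continuous_on_coordinate)
next
  case (Suc k)
  show ?thesis unfolding Suc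
  proof (rule coord_Ck_SucI[where g = "\<lambda>c' x. if c' = c then 1 else 0"])
    show "continuous_on JD (\<lambda>x. x c)" by (auto intro: continuous_on_coordinate)
    show "coord_Ck_on k JD (\<lambda>x. if c' = c then 1 else 0)" for c' by (rule coord_Ck_const)
    show "((\<lambda>r. (x(c' := r)) c) has_vector_derivative (if c' = c then 1 else 0)) (at (x c') within coord_slice JD c' x)" for x c'
      by (auto intro!: derivative_eq_intros)
  qed
qed

lemma coord_Ck_add: "coord_Ck_on k JD f \<Longrightarrow> coord_Ck_on k JD g \<Longrightarrow> coord_Ck_on k JD (\<lambda>x. f x + g x)"
proof (induction k arbitrary: f g)
  case (Suc k)
  show ?case
  proof (rule coord_Ck_SucI[where g = "\<lambda>c x. coord_deriv JD c f x + coord_deriv JD c g x"])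
    show "coord_Ck_on k JD (\<lambda>x. coord_deriv JD c f x + coord_deriv JD c g x)" for c
      using Suc.prems by (intro Suc.IH) auto
    show "((\<lambda>r. f (x(c := r)) + g (x(c := r))) has_vector_derivative
        coord_deriv JD c f x + coord_deriv JD c g x) (at (x c) within coord_slice JD c x)" if "x \<in> JD" for c x
      by (rule has_vector_derivative_add[OF coord_Ck_D[OF Suc.prems(1) that] coord_Ck_D[OF Suc.prems(2) that]])
  qed (intro continuous_intros coord_Ck_cont[OF Suc.prems(1)] coord_Ck_cont[OF Suc.prems(2)])
qed (auto intro: continuous_intros)

lemma coord_Ck_mult: "coord_Ck_on k JD f \<Longrightarrow> coord_Ck_on k JD g \<Longrightarrow> coord_Ck_on k JD (\<lambda>x. f x * g x)"
proof (induction k arbitrary: f g)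
  case (Suc k)
  show ?case
  proof (rule coord_Ck_SucI[where g = "\<lambda>c x. f x * coord_deriv JD c g x + coord_deriv JD c f x * g x"])
    show "coord_Ck_on k JD (\<lambda>x. f x * coord_deriv JD c g x + coord_deriv JD c f x * g x)" for c
      using Suc.prems coord_Ck_mono[OF Suc.prems(1)] coord_Ck_mono[OF Suc.prems(2)]
      by (intro Suc.IH coord_Ck_add) auto
    show "((\<lambda>r. f (x(c := r)) * g (x(c := r))) has_vector_derivative
        f x * coord_deriv JD c g x + coord_deriv JD c f x * g x) (at (x c) within coord_slice JD c x)" if "x \<in> JD" for c x
      by (rule has_vector_derivative_mult[OF coord_Ck_D[OF Suc.prems(1) that] coord_Ck_D[OF Suc.prems(2) that], unfolded fun_upd_triv])
  qed (intro continuous_intros coord_Ck_cont[OF Suc.prems(1)] coord_Ck_cont[OF Suc.prems(2)])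
qed (auto intro: continuous_intros)

lemma coord_Ck_sum: "(\<And>i. i \<in> I \<Longrightarrow> coord_Ck_on k JD (f i)) \<Longrightarrow> coord_Ck_on k JD (\<lambda>x. \<Sum>i\<in>I. f i x)"
  by (induction I rule: infinite_finite_induct) (auto intro: coord_Ck_const coord_Ck_add)

lemma coord_Ck_diff: "coord_Ck_on k JD f \<Longrightarrow> coord_Ck_on k JD g \<Longrightarrow> coord_Ck_on k JD (\<lambda>x. f x - g x)"
  using coord_Ck_add[OF _ coord_Ck_mult[OF coord_Ck_const[of k "-1"]], of f g] by simp

lemma coord_smooth_deriv: "coord_smooth_on JD f \<Longrightarrow> coord_smooth_on JD (coord_deriv JD c f)"
  unfolding coord_smooth_on_def by (metis coord_Ck_on.simps(2))

lemma coord_smooth_has_derivative: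
  "coord_smooth_on JD f \<Longrightarrow> x \<in> JD \<Longrightarrow>
    ((\<lambda>r. f (x(c := r))) has_vector_derivative coord_deriv JD c f x) (at (x c) within coord_slice JD c x)"
  using coord_Ck_D[of 0] by (simp add: coord_smooth_on_def del: coord_Ck_on.simps)

lemma coord_smooth_continuous: "coord_smooth_on JD f \<Longrightarrow> continuous_on JD f"
  unfolding coord_smooth_on_def using coord_Ck_cont by blast

lemma coord_smooth_const: "coord_smooth_on JD (\<lambda>x. a)"
  and coord_smooth_proj: "coord_smooth_on JD (\<lambda>x. x c)"
  by (simp_all add: coord_smooth_on_def coord_Ck_const coord_Ck_proj)

lemma coord_smooth_mult: "coord_smooth_on JD f \<Longrightarrow> coord_smooth_on JD g \<Longrightarrow> coord_smooth_on JD (\<lambda>x. f x * g x)"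
  and coord_smooth_diff: "coord_smooth_on JD f \<Longrightarrow> coord_smooth_on JD g \<Longrightarrow> coord_smooth_on JD (\<lambda>x. f x - g x)"
  and coord_smooth_sum: "(\<And>i. i \<in> I \<Longrightarrow> coord_smooth_on JD (F i)) \<Longrightarrow> coord_smooth_on JD (\<lambda>x. \<Sum>i\<in>I. F i x)"
  by (simp_all add: coord_smooth_on_def coord_Ck_mult coord_Ck_diff coord_Ck_sum)

lemma coord_Ck_position:
  "Ck_on k M h \<Longrightarrow> coord_Ck_on k JD (\<lambda>x. h (\<chi> s. x (Pos 0 s)))"
proof (induction k arbitrary: h)
  have c: "continuous_on JD (\<lambda>x. h (\<chi> s. x (Pos 0 s)))" if "continuous_on M h" for h :: "real^'n \<Rightarrow> real"
    by (rule continuous_on_compose2[OF that])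
       (auto simp: jet_domain_def intro!: continuous_on_vec_lambda continuous_on_coordinate)
  {
    case 0
    then show ?case using c by simp
  next
    case (Suc k)
    define g where "g = (\<lambda>c x. case c of Pos 0 s \<Rightarrow> frechet_derivative h (at (\<chi> s. x (Pos 0 s))) (axis s 1) | _ \<Rightarrow> (0 :: real))"
    show ?case
    proof (rule coord_Ck_SucI[where g = g])
      show "continuous_on JD (\<lambda>x. h (\<chi> s. x (Pos 0 s)))" by (rule c[OF Ck_on_continuous[OF Suc.prems]])
      show "coord_Ck_on k JD (g c)" for c
      proof (cases "\<exists>s. c = Pos 0 s")
        case True
        then obtain s where s: "c = Pos 0 s" by blast
        have "Ck_on k M (\<lambda>x. frechet_derivative h (at x) (axis s 1))" using Suc.prems by simp
        from Suc.IH[OF this] show ?thesis by (simp add: g_def s)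
      next
        case False
        then have "g c = (\<lambda>x. 0)" by (auto simp: g_def split: jet_coord.split nat.split)
        then show ?thesis by (simp add: coord_Ck_const)
      qed
      fix c x assume x: "x \<in> JD"
      show "((\<lambda>r. h (\<chi> s. (x(c := r)) (Pos 0 s))) has_vector_derivative g c x) (at (x c) within coord_slice JD c x)"
      proof (cases "\<exists>s. c = Pos 0 s")
        case True
        then obtain s where s: "c = Pos 0 s" by blast
        define q where "q = (\<chi> s. x (Pos 0 s))"
        have eq: "(\<chi> s'. (x(c := r)) (Pos 0 s')) = q + (r - x c) *\<^sub>R axis s 1" for r
          by (auto simp: q_def s vec_eq_iff axis_def)
        have D: "(h has_derivative frechet_derivative h (at q)) (at (q + (x c - x c) *\<^sub>R axis s 1))"
          using Ck_on_has_derivative[OF M Suc.prems, of q] x by (simp add: q_def jet_domain_def)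
        have "((\<lambda>r. q + (r - x c) *\<^sub>R axis s 1) has_vector_derivative axis s 1) (at (x c) within coord_slice JD c x)"
          by (auto intro!: derivative_eq_intros)
        from vector_derivative_diff_chain_within[OF this has_derivative_at_withinI[OF D]]
        have "((\<lambda>r. h (q + (r - x c) *\<^sub>R axis s 1)) has_vector_derivative frechet_derivative h (at q) (axis s 1))
            (at (x c) within coord_slice JD c x)" by (simp add: o_def)
        then show ?thesis unfolding eq by (simp add: g_def s q_def)
      next
        case False
        then have "(\<chi> s. (x(c := r)) (Pos 0 s)) = (\<chi> s. x (Pos 0 s))" for r by (auto simp: vec_eq_iff)
        moreover have "g c x = 0" using False by (auto simp: g_def split: jet_coord.split nat.split)
        ultimately show ?thesis by simp
      qed
    qed
  }
qed

lemma coord_smooth_position: "smooth_on M h \<Longrightarrow> coord_smooth_on JD (\<lambda>x. h (\<chi> s. x (Pos 0 s)))"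
  by (simp add: smooth_on_def coord_smooth_on_def coord_Ck_position)

lemma coord_smooth_time:
  assumes "smooth_curve b"
  shows "coord_smooth_on JD (\<lambda>x. b (x Time))"
proof -
  have "coord_Ck_on k JD (\<lambda>x. nderiv j b (x Time))" for k j
  proof (induction k arbitrary: j)
    have c: "continuous_on JD (\<lambda>x. nderiv j b (x Time))" for j
      by (rule continuous_on_compose2[of "{0..1}" "nderiv j b"])
         (use assms in \<open>auto simp: smooth_curve_def jet_domain_def intro!: differentiable_imp_continuous_on[of "nderiv j b"]
           continuous_on_coordinate\<close>)
    {
      case 0
      then show ?case using c by simp
    next
      case (Suc k)
      show ?case
      proof (rule coord_Ck_SucI[where g = "\<lambda>c x. if c = Time then nderiv (Suc j) b (x Time) else 0"])
        show "coord_Ck_on k JD (\<lambda>x. if c = Time then nderiv (Suc j) b (x Time) else 0)" for c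
          using Suc coord_Ck_const by (cases "c = Time") (auto simp del: nderiv.simps)
        show "((\<lambda>r. nderiv j b ((x(c := r)) Time)) has_vector_derivative
            (if c = Time then nderiv (Suc j) b (x Time) else 0)) (at (x c) within coord_slice JD c x)" if x: "x \<in> JD" for c x
        proof (cases "c = Time")
          case True
          have "coord_slice JD c x = {0..1}" "x Time \<in> {0..1}"
            using x by (auto simp: True coord_slice_def jet_domain_def)
          then show ?thesis using smooth_curve_has_deriv[OF assms, of "x Time" j] True by simp
        qed simp
      qed (rule c)
    }
  qed
  from this[where j = 0] show ?thesis by (simp add: coord_smooth_on_def)
qed

lemma coord_mean_value:
  assumes f: "coord_smooth_on JD f" and y: "\<And>z. z \<in> closed_segment a b \<Longrightarrow> y(c := z) \<in> JD"
  obtains \<xi> where "\<xi> \<in> closed_segment a b" "f (y(c := b)) - f (y(c := a)) = coord_deriv JD c f (y(c := \<xi>)) * (b - a)"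
proof -
  have sub: "closed_segment a b \<subseteq> coord_slice JD c (y(c := z))" for z using y by (auto simp: coord_slice_def)
  have d: "((\<lambda>r. f (y(c := r))) has_derivative (\<lambda>h. coord_deriv JD c f (y(c := z)) * h)) (at z within closed_segment a b)"
    if "z \<in> closed_segment a b" for z
    using has_vector_derivative_within_subset[OF coord_smooth_has_derivative[OF f y[OF that], of c] sub]
    by (simp add: has_vector_derivative_def mult.commute)
  show ?thesis
  proof (cases "a \<le> b")
    case True
    have "\<exists>x\<in>{a..b}. f (y(c := b)) - f (y(c := a)) = coord_deriv JD c f (y(c := x)) * (b - a)"
      by (rule mvt_very_simple[where f = "\<lambda>r. f (y(c := r))" and f' = "\<lambda>x h. coord_deriv JD c f (y(c := x)) * h", OF True])
         (use d True in \<open>simp add: closed_segment_eq_real_ivl\<close>)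
    then show ?thesis using that True by (auto simp: closed_segment_eq_real_ivl)
  next
    case False
    then have "b \<le> a" by simp
    have "\<exists>x\<in>{b..a}. f (y(c := a)) - f (y(c := b)) = coord_deriv JD c f (y(c := x)) * (a - b)"
      by (rule mvt_very_simple[where f = "\<lambda>r. f (y(c := r))" and f' = "\<lambda>x h. coord_deriv JD c f (y(c := x)) * h", OF \<open>b \<le> a\<close>])
         (use d False in \<open>simp add: closed_segment_eq_real_ivl\<close>)
    then obtain x where x: "x \<in> {b..a}" "f (y(c := a)) - f (y(c := b)) = coord_deriv JD c f (y(c := x)) * (a - b)" by blast
    then have "f (y(c := b)) - f (y(c := a)) = coord_deriv JD c f (y(c := x)) * (b - a)" by (simp add: algebra_simps)
    then show ?thesis using that x(1) False by (auto simp: closed_segment_eq_real_ivl)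
  qed
qed

text \<open>The space of jets carries no norm, so the point is moved one coordinate at a time: only
  the finitely many coordinates in J matter, each move is controlled by the mean value theorem, and
  continuity of the partial derivatives in the product topology gives the limits.\<close>

theorem coord_chain_rule:
  assumes f: "coord_smooth_on JD f" and J: "finite J" "depends_only_on J JD f"
    and x: "\<And>r. r \<in> T \<Longrightarrow> x r \<in> JD" and r0: "r0 \<in> T"
    and d: "\<And>c. c \<in> J \<Longrightarrow> ((\<lambda>r. x r c) has_vector_derivative x' c) (at r0 within T)"
  shows "((\<lambda>r. f (x r)) has_vector_derivative (\<Sum>c\<in>J. coord_deriv JD c f (x r0) * x' c)) (at r0 within T)"
proof -
  obtain \<delta> where \<delta>: "\<delta> > 0" "\<And>y. y Time \<in> {0..1} \<Longrightarrow> (\<And>s. \<bar>y (Pos 0 s) - x r0 (Pos 0 s)\<bar> < \<delta>) \<Longrightarrow> y \<in> JD"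
    using jet_domain_update[OF M x[OF r0]] by blast
  have lim: "((\<lambda>r. x r c) \<longlongrightarrow> x r0 c) (at r0 within T)" if "c \<in> J" for c
    using has_vector_derivative_continuous[OF d[OF that]] by (simp add: continuous_within)
  have T: "\<forall>\<^sub>F r in at r0 within T. r \<in> T \<and> r \<noteq> r0" by (simp add: eventually_at_filter)
  have near: "\<forall>\<^sub>F r in at r0 within T. r \<in> T \<and> (\<forall>c\<in>J. \<bar>x r c - x r0 c\<bar> < \<delta>)"
    using T eventually_ball_finite[OF J(1), of "\<lambda>r c. \<bar>x r c - x r0 c\<bar> < \<delta>" "at r0 within T"]
      tendstoD[OF lim \<delta>(1)] by (auto simp: dist_real_def elim: eventually_elim2)
  \<comment> \<open>Hybrid points: the coordinates in K are taken at r, all others frozen at r0.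
    Near r0 the hybrids and the segments between them lie in the domain, because the positions stay
    within \<delta> and \<open>Time\<close> stays in the convex set [0,1].\<close>
  define Y where "Y = (\<lambda>K r c. if c \<in> K then x r c else x r0 c)"
  have seg: "(Y K r)(c := z) \<in> JD"
    if "K \<subseteq> J" "c \<in> J" "r \<in> T" "\<forall>c\<in>J. \<bar>x r c - x r0 c\<bar> < \<delta>" "z \<in> closed_segment (x r0 c) (x r c)" for K r c z
  proof (rule \<delta>(2))
    have z: "\<bar>z - x r0 c\<bar> \<le> \<bar>x r c - x r0 c\<bar>" using that(5) by (auto simp: closed_segment_eq_real_ivl split: if_splits)
    have "x r Time \<in> {0..1}" "x r0 Time \<in> {0..1}" using x[OF that(3)] x[OF r0] by (auto simp: jet_domain_def)
    then show "((Y K r)(c := z)) Time \<in> {0..1}"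
      using that(5) by (auto simp: Y_def closed_segment_eq_real_ivl split: if_splits)
    fix s show "\<bar>((Y K r)(c := z)) (Pos 0 s) - x r0 (Pos 0 s)\<bar> < \<delta>"
      using that z \<delta>(1) by (auto simp: Y_def)
  qed
  have main: "((\<lambda>r. f (Y K r)) has_real_derivative (\<Sum>c\<in>K. coord_deriv JD c f (x r0) * x' c)) (at r0 within T)"
    if "K \<subseteq> J" for K
    using finite_subset[OF that J(1)] that
  proof (induction K rule: finite_induct)
    case empty
    then show ?case by (simp add: Y_def)
  next
    case (insert c K)
    then have c: "c \<in> J" and K: "K \<subseteq> J" by auto
    have upd: "Y (insert c K) r = (Y K r)(c := x r c)" "Y K r = (Y K r)(c := x r0 c)" for r
      using insert(2) by (auto simp: Y_def)
    have "\<exists>\<xi>. \<forall>r. r \<in> T \<and> (\<forall>c\<in>J. \<bar>x r c - x r0 c\<bar> < \<delta>) \<longrightarrow> \<xi> r \<in> closed_segment (x r0 c) (x r c) \<and>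
        f (Y (insert c K) r) - f (Y K r) = coord_deriv JD c f ((Y K r)(c := \<xi> r)) * (x r c - x r0 c)"
      using coord_mean_value[OF f seg[OF K c]] upd by (intro choice) (metis (no_types, lifting))
    then obtain \<xi> where \<xi>: "\<And>r. r \<in> T \<Longrightarrow> (\<forall>c\<in>J. \<bar>x r c - x r0 c\<bar> < \<delta>) \<Longrightarrow> \<xi> r \<in> closed_segment (x r0 c) (x r c) \<and>
        f (Y (insert c K) r) - f (Y K r) = coord_deriv JD c f ((Y K r)(c := \<xi> r)) * (x r c - x r0 c)" by blast
    have "((\<lambda>r. \<bar>x r c - x r0 c\<bar>) \<longlongrightarrow> 0) (at r0 within T)"
      using lim[OF c] by (simp add: LIM_zero_iff tendsto_rabs_zero_iff)
    then have "((\<lambda>r. \<xi> r - x r0 c) \<longlongrightarrow> 0) (at r0 within T)"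
    proof (rule Lim_null_comparison[rotated])
      show "\<forall>\<^sub>F r in at r0 within T. norm (\<xi> r - x r0 c) \<le> \<bar>x r c - x r0 c\<bar>"
        using near
      proof eventually_elim
        case (elim r)
        then have "\<xi> r \<in> closed_segment (x r0 c) (x r c)" using \<xi> by blast
        then show ?case by (auto simp: closed_segment_eq_real_ivl split: if_splits)
      qed
    qed
    then have \<xi>lim: "(\<xi> \<longlongrightarrow> x r0 c) (at r0 within T)" by (simp add: LIM_zero_iff)
    have Ylim: "((\<lambda>r. (Y K r)(c := \<xi> r)) \<longlongrightarrow> x r0) (at r0 within T)"
    proof (rule tendsto_coordinatewise)
      fix c' show "((\<lambda>r. ((Y K r)(c := \<xi> r)) c') \<longlongrightarrow> x r0 c') (at r0 within T)"
        using \<xi>lim lim K by (cases "c' = c"; cases "c' \<in> K") (auto simp: Y_def)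
    qed
    have "continuous_on JD (coord_deriv JD c f)" by (intro coord_smooth_continuous coord_smooth_deriv f)
    then have Clim: "((\<lambda>r. coord_deriv JD c f ((Y K r)(c := \<xi> r))) \<longlongrightarrow> coord_deriv JD c f (x r0)) (at r0 within T)"
    proof (rule continuous_on_tendsto_compose[OF _ Ylim x[OF r0]])
      show "\<forall>\<^sub>F r in at r0 within T. (Y K r)(c := \<xi> r) \<in> JD"
        using near by eventually_elim (use \<xi> seg[OF K c] in blast)
    qed
    have "((\<lambda>r. (x r c - x r0 c) / (r - r0)) \<longlongrightarrow> x' c) (at r0 within T)"
      using d[OF c] by (simp add: has_real_derivative_iff_has_vector_derivative[symmetric] has_field_derivative_iff)
    from tendsto_mult[OF Clim this]
    have "((\<lambda>r. ((f (Y (insert c K) r) - f (Y K r)) - (f (Y (insert c K) r0) - f (Y K r0))) / (r - r0))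
        \<longlongrightarrow> coord_deriv JD c f (x r0) * x' c) (at r0 within T)"
    proof (rule Lim_transform_eventually)
      have Y0: "Y (insert c K) r0 = Y K r0" by (auto simp: Y_def)
      show "\<forall>\<^sub>F r in at r0 within T. coord_deriv JD c f ((Y K r)(c := \<xi> r)) * ((x r c - x r0 c) / (r - r0)) =
          ((f (Y (insert c K) r) - f (Y K r)) - (f (Y (insert c K) r0) - f (Y K r0))) / (r - r0)"
        using near by eventually_elim (use \<xi> Y0 in simp)
    qed
    then have "((\<lambda>r. f (Y (insert c K) r) - f (Y K r)) has_real_derivative coord_deriv JD c f (x r0) * x' c) (at r0 within T)"
      by (simp add: has_field_derivative_iff)
    from DERIV_add[OF this insert.IH[OF K]] show ?case using insert(1,2) by simp
  qed
  have J0: "Y J r0 = x r0" by (auto simp: Y_def)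
  \<comment> \<open>The coordinates outside J stay frozen in \<open>Y J r\<close>, but f depends
    only on those in J, so it takes the same value as at \<open>x r\<close>.\<close>
  have ev: "\<forall>\<^sub>F r in at r0 within T. f (Y J r) = f (x r)"
    using near
  proof eventually_elim
    case (elim r)
    have "Y J r \<in> JD"
    proof (rule \<delta>(2))
      have "x r Time \<in> {0..1}" "x r0 Time \<in> {0..1}"
        using x[of r] x[OF r0] elim by (simp_all add: jet_domain_def)
      then show "Y J r Time \<in> {0..1}" by (simp add: Y_def)
      show "\<bar>Y J r (Pos 0 s) - x r0 (Pos 0 s)\<bar> < \<delta>" for s using elim \<delta>(1) by (auto simp: Y_def)
    qed
    moreover have "x r \<in> JD" using x elim by blast
    moreover have "\<forall>c\<in>J. Y J r c = x r c" by (simp add: Y_def)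
    ultimately show ?case using J(2) unfolding depends_only_on_def by blast
  qed
  have "((\<lambda>r. (f (x r) - f (x r0)) / (r - r0)) \<longlongrightarrow> (\<Sum>c\<in>J. coord_deriv JD c f (x r0) * x' c)) (at r0 within T)"
  proof (rule Lim_transform_eventually)
    show "((\<lambda>r. (f (Y J r) - f (Y J r0)) / (r - r0)) \<longlongrightarrow> (\<Sum>c\<in>J. coord_deriv JD c f (x r0) * x' c)) (at r0 within T)"
      using main[OF order_refl] by (simp add: has_field_derivative_iff)
    show "\<forall>\<^sub>F r in at r0 within T. (f (Y J r) - f (Y J r0)) / (r - r0) = (f (x r) - f (x r0)) / (r - r0)"
      using ev by eventually_elim (simp add: J0)
  qed
  then show ?thesis by (simp add: has_real_derivative_iff_has_vector_derivative[symmetric] has_field_derivative_iff)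
qed

end

section \<open>Total derivatives, action integrals and Euler-Lagrange expressions\<close>

lemma finite_jet_coords: "finite (jet_coords k l :: 'n::finite jet_coord set)"
proof -
  have "jet_coords k l \<subseteq> {Time} \<union> (\<lambda>(i, s). Pos i s) ` ({..k} \<times> UNIV) \<union> (\<lambda>(j, s). Mom j s) ` ({..l} \<times> (UNIV :: 'n set))"
    by (auto simp: jet_coords_def)
  then show ?thesis by (rule finite_subset) auto
qed

lemma jet_coords_mono: "k \<le> k' \<Longrightarrow> l \<le> l' \<Longrightarrow> jet_coords k l \<subseteq> jet_coords k' l'"
  by (auto simp: jet_coords_def)

lemma depends_only_on_mono: "depends_only_on J S f \<Longrightarrow> J \<subseteq> J' \<Longrightarrow> depends_only_on J' S f"
  unfolding depends_only_on_def by blast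

lemma jet_at_domain:
  assumes "a \<in> cpaths M" "t \<in> {0..1}"
  shows "jet_at a t \<in> jet_domain M"
  using assms by (cases a) (auto simp: cpaths_def jet_domain_def)

text \<open>The coordinate whose value is the t-derivative of the given one along a path.
  \<open>Time\<close> receives a dummy value; its derivative 1 is supplied separately wherever a
  path is differentiated.\<close>

fun coord_succ :: "'n jet_coord \<Rightarrow> 'n jet_coord" where
  "coord_succ Time = Time"
| "coord_succ (Pos i s) = Pos (Suc i) s"
| "coord_succ (Mom i s) = Mom (Suc i) s"

lemma jet_at_has_derivative:
  assumes "a \<in> cpaths M" "t \<in> {0..1}"
  shows "((\<lambda>t. jet_at a t c) has_vector_derivative (if c = Time then 1 else jet_at a t (coord_succ c))) (at t within {0..1})"
proof -
  obtain q p where a: "a = (q, p)" by (cases a)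
  have "smooth_curve q" "smooth_curve p" using assms(1) by (auto simp: a cpaths_def)
  note d = this[THEN smooth_curve_has_deriv, OF assms(2)]
  show ?thesis
    by (cases c) (auto simp: a simp del: nderiv.simps intro!: bounded_linear.has_vector_derivative[OF bounded_linear_vec_nth] d)
qed

lemma jet_at_continuous:
  assumes "a \<in> cpaths M"
  shows "continuous_on {0..1} (jet_at a)"
proof (rule continuous_on_coordinatewise_then_product)
  show "continuous_on {0..1} (\<lambda>t. jet_at a t c)" for c
    unfolding continuous_on_eq_continuous_within
    using has_vector_derivative_continuous[OF jet_at_has_derivative[OF assms]] by blast
qed

context
  fixes M :: "(real^'n) set"
  assumes M: "open M"
begin

lemma coord_deriv_depends:
  assumes f: "depends_only_on (jet_coords N N) (jet_domain M) f"
  shows "depends_only_on (jet_coords N N) (jet_domain M) (coord_deriv (jet_domain M) c f)"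
  unfolding depends_only_on_def
proof (intro ballI impI)
  fix x y assume x: "x \<in> (jet_domain M)" and y: "y \<in> (jet_domain M)" and eq: "\<forall>c\<in>jet_coords N N. x c = y c"
  have T: "x Time = y Time" and P: "x (Pos 0 s) = y (Pos 0 s)" for s using eq by (auto simp: jet_coords_def)
  have slice: "coord_slice (jet_domain M) c x = coord_slice (jet_domain M) c y"
  proof -
    have "(\<chi> s. (x(c := r)) (Pos 0 s)) = (\<chi> s. (y(c := r)) (Pos 0 s))" for r
      by (simp add: vec_eq_iff P)
    moreover have "(x(c := r)) Time = (y(c := r)) Time" for r using T by simp
    ultimately show ?thesis unfolding coord_slice_def jet_domain_def by simp
  qed
  have feq: "f (x(c := r)) = f (y(c := r))" if "r \<in> coord_slice (jet_domain M) c y" for r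
  proof -
    have "r \<in> coord_slice (jet_domain M) c x" using that slice by simp
    then have "x(c := r) \<in> jet_domain M" "y(c := r) \<in> jet_domain M"
      using that by (simp_all add: coord_slice_def)
    moreover have "\<forall>c'\<in>jet_coords N N. (x(c := r)) c' = (y(c := r)) c'" using eq by simp
    ultimately show ?thesis using f unfolding depends_only_on_def by blast
  qed
  show "coord_deriv (jet_domain M) c f x = coord_deriv (jet_domain M) c f y"
  \<comment> \<open>The two derivatives are taken at the base points \<open>x c\<close> and
    \<open>y c\<close>. These can differ only for a coordinate beyond the jet order; f is constant
    in such a coordinate, so both derivatives are 0.\<close>
  proof (cases "x c = y c")
    case True
    have ev: "\<forall>\<^sub>F r in nhds (y c). r \<in> coord_slice (jet_domain M) c y \<longrightarrow> f (x(c := r)) = f (y(c := r))"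
      using feq by simp
    have "f (x(c := y c)) = f (y(c := y c))" by (rule feq) (use y in \<open>simp add: coord_slice_def\<close>)
    then have "((\<lambda>r. f (x(c := r))) has_vector_derivative d) (at (y c) within coord_slice (jet_domain M) c y) \<longleftrightarrow>
        ((\<lambda>r. f (y(c := r))) has_vector_derivative d) (at (y c) within coord_slice (jet_domain M) c y)" for d
      by (intro has_vector_derivative_cong_ev ev)
    then show ?thesis unfolding coord_deriv_def slice True vector_derivative_def by simp
  next
    case False
    then have c: "c \<notin> jet_coords N N" using eq by auto
    have "coord_deriv (jet_domain M) c f z = 0" if z: "z \<in> (jet_domain M)" for z
    proof (rule coord_deriv_eqI[OF M z])
      have "f (z(c := r)) = f z" if "r \<in> coord_slice (jet_domain M) c z" for r
        using f z that c unfolding depends_only_on_def coord_slice_def by (metis (mono_tags, lifting) fun_upd_other mem_Collect_eq)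
      from has_vector_derivative_transform[OF coord_slice_member[OF M z] this has_vector_derivative_const]
      show "((\<lambda>r. f (z(c := r))) has_vector_derivative 0) (at (z c) within coord_slice (jet_domain M) c z)" .
    qed
    then show ?thesis using x y by simp
  qed
qed

text \<open>The total time derivative of jet calculus: along a path it becomes d/dt. It raises the
  jet order by one, which accounts for the bound N + i in the iterates.\<close>

definition total_deriv :: "nat \<Rightarrow> ('n jet \<Rightarrow> real) \<Rightarrow> 'n jet \<Rightarrow> real" where
  "total_deriv N f x = (\<Sum>c\<in>jet_coords N N. coord_deriv (jet_domain M) c f x * (if c = Time then 1 else x (coord_succ c)))"

primrec total_derivs :: "nat \<Rightarrow> nat \<Rightarrow> ('n jet \<Rightarrow> real) \<Rightarrow> 'n jet \<Rightarrow> real" where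
  "total_derivs N 0 f = f"
| "total_derivs N (Suc i) f = total_deriv (N + i) (total_derivs N i f)"

lemma total_deriv_smooth:
  assumes "coord_smooth_on (jet_domain M) f"
  shows "coord_smooth_on (jet_domain M) (total_deriv N f)"
proof -
  have "coord_smooth_on (jet_domain M) (\<lambda>x. coord_deriv (jet_domain M) c f x * (if c = Time then 1 else x (coord_succ c)))" for c
    using assms by (cases "c = Time") (auto intro!: coord_smooth_mult[OF M] coord_smooth_deriv[OF M] coord_smooth_const[OF M] coord_smooth_proj[OF M])
  then show ?thesis unfolding total_deriv_def by (intro coord_smooth_sum[OF M])
qed

lemma total_deriv_depends:
  assumes "depends_only_on (jet_coords N N) (jet_domain M) f"
  shows "depends_only_on (jet_coords (Suc N) (Suc N)) (jet_domain M) (total_deriv N f)"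
  unfolding depends_only_on_def
proof (intro ballI impI)
  fix x y assume x: "x \<in> (jet_domain M)" "y \<in> (jet_domain M)" and eq: "\<forall>c\<in>jet_coords (Suc N) (Suc N). x c = y c"
  have "\<forall>c\<in>jet_coords N N. x c = y c" using eq jet_coords_mono[of N "Suc N" N "Suc N"] by auto
  then have "coord_deriv (jet_domain M) c f x = coord_deriv (jet_domain M) c f y" for c
    using coord_deriv_depends[OF assms, of c] x unfolding depends_only_on_def by blast
  moreover have "x (coord_succ c) = y (coord_succ c)" if "c \<in> jet_coords N N" for c
    using that eq by (cases c) (auto simp: jet_coords_def)
  ultimately show "total_deriv N f x = total_deriv N f y" unfolding total_deriv_def by (intro sum.cong) auto
qed

lemma total_derivs_smooth: "coord_smooth_on (jet_domain M) f \<Longrightarrow> coord_smooth_on (jet_domain M) (total_derivs N i f)"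
  by (induction i) (auto intro: total_deriv_smooth)

lemma total_derivs_depends:
  "depends_only_on (jet_coords N N) (jet_domain M) f \<Longrightarrow> depends_only_on (jet_coords (N + i) (N + i)) (jet_domain M) (total_derivs N i f)"
  by (induction i) (auto intro: total_deriv_depends)

lemma total_deriv_along:
  assumes f: "coord_smooth_on (jet_domain M) f" "depends_only_on (jet_coords N N) (jet_domain M) f"
    and a: "a \<in> cpaths M" and t: "t \<in> {0..1}"
  shows "((\<lambda>t. f (jet_at a t)) has_vector_derivative total_deriv N f (jet_at a t)) (at t within {0..1})"
  unfolding total_deriv_def
  by (rule coord_chain_rule[OF M f(1) finite_jet_coords f(2) jet_at_domain[OF a] t jet_at_has_derivative[OF a t]])

lemma nderiv_along:
  assumes f: "coord_smooth_on (jet_domain M) f" "depends_only_on (jet_coords N N) (jet_domain M) f" and a: "a \<in> cpaths M"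
  shows "smooth_curve (\<lambda>t. f (jet_at a t))"
    and "t \<in> {0..1} \<Longrightarrow> nderiv i (\<lambda>t. f (jet_at a t)) t = total_derivs N i f (jet_at a t)"
proof -
  have D: "((\<lambda>t. total_derivs N i f (jet_at a t)) has_vector_derivative total_derivs N (Suc i) f (jet_at a t)) (at t within {0..1})"
    if "t \<in> {0..1}" for i t
    using total_deriv_along[OF total_derivs_smooth[OF f(1)] total_derivs_depends[OF f(2)] a that] by simp
  show "smooth_curve (\<lambda>t. f (jet_at a t))"
    by (rule smooth_curve_family[where D = "\<lambda>i t. total_derivs N i f (jet_at a t)", OF _ D]) auto
  show "nderiv i (\<lambda>t. f (jet_at a t)) t = total_derivs N i f (jet_at a t)" if "t \<in> {0..1}"
    using nderiv_eq_family[where D = "\<lambda>i t. total_derivs N i f (jet_at a t)", OF _ D that] by auto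
qed

text \<open>The jet is an arbitrary differentiable family \<open>x s t\<close>, so that one formula
  differentiates the action along affine variations and along the gauge flow. \<open>s0\<close> may
  be an end of \<open>U\<close>, as for a flow that exists only for s \<ge> 0.\<close>

theorem action_has_derivative:
  fixes x :: "real \<Rightarrow> real \<Rightarrow> 'n jet"
  assumes f: "coord_smooth_on (jet_domain M) f" and J: "finite J" "depends_only_on J (jet_domain M) f"
    and U: "convex U" "s0 \<in> U"
    and x: "\<And>s t. s \<in> U \<Longrightarrow> t \<in> {0..1} \<Longrightarrow> x s t \<in> (jet_domain M)"
    and cx: "\<And>c. continuous_on (U \<times> {0..1}) (\<lambda>(s, t). x s t c)"
    and y: "\<And>c s t. s \<in> U \<Longrightarrow> t \<in> {0..1} \<Longrightarrow> ((\<lambda>s. x s t c) has_vector_derivative y c s t) (at s within U)"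
    and cy: "\<And>c. continuous_on (U \<times> {0..1}) (\<lambda>(s, t). y c s t)"
  shows "((\<lambda>s. integral {0..1} (\<lambda>t. f (x s t))) has_real_derivative
    integral {0..1} (\<lambda>t. \<Sum>c\<in>J. coord_deriv (jet_domain M) c f (x s0 t) * y c s0 t)) (at s0 within U)"
proof -
  have cX: "continuous_on (U \<times> {0..1}) (\<lambda>z. x (fst z) (snd z))"
    using cx unfolding split_beta by (rule continuous_on_coordinatewise_then_product)
  have cf: "continuous_on (U \<times> {0..1}) (\<lambda>z. g (x (fst z) (snd z)))" if "coord_smooth_on (jet_domain M) g" for g
    by (rule continuous_on_compose2[OF coord_smooth_continuous[OF M that] cX]) (use x in auto)
  have "((\<lambda>s. integral (cbox 0 1) (\<lambda>t. f (x s t))) has_field_derivative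
    integral (cbox 0 1) (\<lambda>t. \<Sum>c\<in>J. coord_deriv (jet_domain M) c f (x s0 t) * y c s0 t)) (at s0 within U)"
  proof (rule leibniz_rule_field_derivative[where f = "\<lambda>s t. f (x s t)" and U = U and a = 0 and b = 1
        and fx = "\<lambda>s t. \<Sum>c\<in>J. coord_deriv (jet_domain M) c f (x s t) * y c s t", OF _ _ _ U(2,1)])
    fix s t :: real assume "s \<in> U" "t \<in> cbox 0 1"
    then show "((\<lambda>s. f (x s t)) has_real_derivative (\<Sum>c\<in>J. coord_deriv (jet_domain M) c f (x s t) * y c s t)) (at s within U)"
      unfolding has_real_derivative_iff_has_vector_derivative
      by (intro coord_chain_rule[OF M f J] x y) auto
  next
    fix s assume "s \<in> U"
    then show "(\<lambda>t. f (x s t)) integrable_on cbox 0 1"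
      unfolding cbox_interval
      by (intro integrable_continuous_real continuous_on_slice2[of U _ "\<lambda>s t. f (x s t)", unfolded split_beta, OF cf[OF f]])
  next
    show "continuous_on (U \<times> cbox 0 1) (\<lambda>(s, t). \<Sum>c\<in>J. coord_deriv (jet_domain M) c f (x s t) * y c s t)"
      unfolding split_beta cbox_interval
      by (intro continuous_on_sum continuous_on_mult cf coord_smooth_deriv[OF M f] cy[unfolded split_beta])
  qed
  then show ?thesis by simp
qed

text \<open>The variational derivative with respect to one component of q or p: \<open>X i\<close>
  is the coordinate of the i-th derivative of that component, \<open>Pos i s\<close> or
  \<open>Mom i s\<close>.\<close>

definition euler_lagrange :: "nat \<Rightarrow> (nat \<Rightarrow> 'n jet_coord) \<Rightarrow> ('n jet \<Rightarrow> real) \<Rightarrow> 'n jet \<Rightarrow> real" where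
  "euler_lagrange N X f x = (\<Sum>i\<le>N. (- 1) ^ i * total_derivs N i (coord_deriv (jet_domain M) (X i) f) x)"

lemma euler_lagrange_smooth:
  "coord_smooth_on (jet_domain M) f \<Longrightarrow> coord_smooth_on (jet_domain M) (euler_lagrange N X f)"
  unfolding euler_lagrange_def[abs_def]
  by (intro coord_smooth_sum[OF M] coord_smooth_mult[OF M] coord_smooth_const[OF M] total_derivs_smooth coord_smooth_deriv[OF M])

lemma euler_lagrange_depends:
  assumes "depends_only_on (jet_coords N N) (jet_domain M) f"
  shows "depends_only_on (jet_coords (N + N) (N + N)) (jet_domain M) (euler_lagrange N X f)"
  unfolding depends_only_on_def
proof (intro ballI impI)
  fix x y assume x: "x \<in> (jet_domain M)" "y \<in> (jet_domain M)" and eq: "\<forall>c\<in>jet_coords (N + N) (N + N). x c = y c"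
  have "total_derivs N i (coord_deriv (jet_domain M) (X i) f) x = total_derivs N i (coord_deriv (jet_domain M) (X i) f) y" if "i \<le> N" for i
  proof -
    have "depends_only_on (jet_coords (N + N) (N + N)) (jet_domain M) (total_derivs N i (coord_deriv (jet_domain M) (X i) f))"
      by (rule depends_only_on_mono[OF total_derivs_depends[OF coord_deriv_depends[OF assms]]])
         (use that in \<open>intro jet_coords_mono; simp\<close>)
    then show ?thesis using x eq unfolding depends_only_on_def by blast
  qed
  then show "euler_lagrange N X f x = euler_lagrange N X f y" by (simp add: euler_lagrange_def)
qed

end

section \<open>Flat test functions\<close>

text \<open>The derivatives of \<open>exp (- 1 / t)\<close>, \<open>t > 0\<close>, are \<open>poly (flat_poly k) (1 / t) * exp (- 1 / t)\<close>.\<close>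

primrec flat_poly :: "nat \<Rightarrow> real poly" where
  "flat_poly 0 = 1"
| "flat_poly (Suc k) = [:0, 0, 1:] * (flat_poly k - pderiv (flat_poly k))"

lemma poly_exp_decay: "((\<lambda>y. poly P y * exp (- y)) \<longlongrightarrow> 0) at_top" for P :: "real poly"
proof (induction P)
  case (pCons a P)
  have *: "((\<lambda>y :: real. y ^ n * exp (- y)) \<longlongrightarrow> 0) at_top" for n :: nat
    using tendsto_power_div_exp_0[of n] by (simp add: exp_minus divide_inverse)
  have "((\<lambda>y. \<Sum>i\<le>degree (pCons a P). coeff (pCons a P) i * (y ^ i * exp (- y))) \<longlongrightarrow> (\<Sum>i\<le>degree (pCons a P). coeff (pCons a P) i * 0)) at_top"
    by (intro tendsto_intros *)
  moreover have "(\<Sum>i\<le>degree (pCons a P). coeff (pCons a P) i * (y ^ i * exp (- y))) = poly (pCons a P) y * exp (- y)" for y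
    by (simp only: poly_altdef sum_distrib_right mult.assoc)
  ultimately show ?case by simp
qed simp

definition flat_deriv :: "nat \<Rightarrow> real \<Rightarrow> real" where
  "flat_deriv k t = (if t \<le> 0 then 0 else poly (flat_poly k) (1 / t) * exp (- (1 / t)))"

lemma flat_deriv_has_derivative:
  assumes "t \<in> {0..1}"
  shows "(flat_deriv k has_vector_derivative flat_deriv (Suc k) t) (at t within {0..1})"
proof (cases "t = 0")
  case True
  have "((\<lambda>h. (flat_deriv k h - flat_deriv k 0) / (h - 0)) \<longlongrightarrow> 0) (at_right 0)"
  proof -
    \<comment> \<open>With y = 1 / h, the difference quotient at 0 is y times a polynomial in y
      times exp (- y); the polynomial \<open>[:0, 1:]\<close> is the factor y.\<close>
    have "((\<lambda>h. poly ([:0, 1:] * flat_poly k) (inverse h) * exp (- inverse h)) \<longlongrightarrow> 0) (at_right 0)"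
      by (rule filterlim_compose[OF poly_exp_decay filterlim_inverse_at_top_right])
    then show ?thesis
    proof (rule Lim_transform_eventually)
      show "\<forall>\<^sub>F h in at_right 0. poly ([:0, 1:] * flat_poly k) (inverse h) * exp (- inverse h) = (flat_deriv k h - flat_deriv k 0) / (h - 0)"
        using eventually_at_right_less[of "0::real"] by eventually_elim (simp add: flat_deriv_def field_simps)
    qed
  qed
  moreover have "at 0 within {0..1} = at_right (0::real)" by (rule at_within_Icc_at_right) simp
  ultimately show ?thesis
    by (simp add: True has_real_derivative_iff_has_vector_derivative[symmetric] has_field_derivative_iff flat_deriv_def)
next
  case False
  then have t: "t > 0" using assms by auto
  have "((\<lambda>t. poly (flat_poly k) (1 / t) * exp (- (1 / t))) has_real_derivative
      poly (pderiv (flat_poly k)) (1 / t) * (- (1 / t\<^sup>2)) * exp (- (1 / t)) + poly (flat_poly k) (1 / t) * (exp (- (1 / t)) * (1 / t\<^sup>2))) (at t)"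
  proof -
    have 1: "((\<lambda>t. 1 / t) has_real_derivative - (1 / t\<^sup>2)) (at t)"
      using t by (auto intro!: derivative_eq_intros simp: power2_eq_square)
    have "((\<lambda>t. - (1 / t)) has_real_derivative 1 / t\<^sup>2) (at t)" using DERIV_minus[OF 1] by simp
    from DERIV_mult[OF DERIV_chain2[OF poly_DERIV[of "flat_poly k"] 1] DERIV_chain2[OF DERIV_exp this]]
    show ?thesis by (simp add: mult_ac add_ac)
  qed
  also have "poly (pderiv (flat_poly k)) (1 / t) * (- (1 / t\<^sup>2)) * exp (- (1 / t)) + poly (flat_poly k) (1 / t) * (exp (- (1 / t)) * (1 / t\<^sup>2))
      = flat_deriv (Suc k) t"
    using t by (simp add: flat_deriv_def power2_eq_square field_simps)
  finally have "((\<lambda>t. poly (flat_poly k) (1 / t) * exp (- (1 / t))) has_real_derivative flat_deriv (Suc k) t) (at t)" .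
  then have "(flat_deriv k has_real_derivative flat_deriv (Suc k) t) (at t)"
    by (rule has_field_derivative_transform_within_open[of _ _ _ "{0<..}"]) (use t in \<open>auto simp: flat_deriv_def\<close>)
  then show ?thesis
    by (simp add: has_real_derivative_iff_has_vector_derivative has_vector_derivative_at_within)
qed

text \<open>The product of exp (- 1 / t) with its mirror image under t -> 1 - t: each factor is flat
  at one end. Positivity inside lets the bump serve as the weight of a norm in the fundamental
  lemma.\<close>

lemma bump_exists:
  obtains b :: "real \<Rightarrow> real" where "smooth_ends Flat b" "\<And>t. t \<in> {0<..<1} \<Longrightarrow> b t > 0"
proof -
  define u where "u = flat_deriv 0"
  define v where "v = (\<lambda>t. u (1 - t))"
  have du: "nderiv k u t = flat_deriv k t" "smooth_curve u" if "t \<in> {0..1}" for k t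
    using nderiv_eq_family[of u flat_deriv t k, OF _ flat_deriv_has_derivative that] smooth_curve_family[of u flat_deriv, OF _ flat_deriv_has_derivative]
    by (auto simp: u_def)
  have D: "((\<lambda>t. (- 1) ^ k * flat_deriv k (1 - t)) has_vector_derivative (- 1) ^ Suc k * flat_deriv (Suc k) (1 - t)) (at t within {0..1})"
    if "t \<in> {0..1}" for k t
  proof -
    have "((\<lambda>t. 1 - t) has_vector_derivative - 1) (at t within {0..1})" by (auto intro!: derivative_eq_intros)
    moreover have "(\<lambda>t. 1 - t) ` {0..1} = {0..1::real}" by (auto simp: image_iff intro!: bexI[of _ "1 - _"])
    then have "(flat_deriv k has_vector_derivative flat_deriv (Suc k) (1 - t)) (at (1 - t) within (\<lambda>t. 1 - t) ` {0..1})"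
      using flat_deriv_has_derivative[of "1 - t" k] that by simp
    ultimately have "(flat_deriv k \<circ> (\<lambda>t. 1 - t) has_vector_derivative - 1 *\<^sub>R flat_deriv (Suc k) (1 - t)) (at t within {0..1})"
      by (rule vector_diff_chain_within)
    from has_vector_derivative_mult_right[OF this, of "(- 1) ^ k"] show ?thesis by (simp add: o_def)
  qed
  have dv: "nderiv k v t = (- 1) ^ k * flat_deriv k (1 - t)" "smooth_curve v" if "t \<in> {0..1}" for k t
    using nderiv_eq_family[of v "\<lambda>k t. (- 1) ^ k * flat_deriv k (1 - t)" t k, OF _ D that]
      smooth_curve_family[of v "\<lambda>k t. (- 1) ^ k * flat_deriv k (1 - t)", OF _ D]
    by (auto simp: v_def u_def)
  have "smooth_ends Left_Flat u" "smooth_ends Right_Flat v"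
    using du[of 0] dv[of 1] by (simp_all add: smooth_ends_def flat_deriv_def del: nderiv.simps)
  then have "smooth_ends Flat (\<lambda>t. u t * v t)"
    unfolding smooth_ends_iff smooth_family_def
    using Ck_family_bilinear_endpoints[OF bounded_bilinear_mult, of Left_Flat Right_Flat Flat "{0}" _ "\<lambda>_. u" "\<lambda>_. v"] by simp
  moreover have "u t * v t > 0" if "t \<in> {0<..<1}" for t
    using that by (auto simp: u_def v_def flat_deriv_def)
  ultimately show ?thesis by (rule that)
qed

lemma integration_by_parts_inner:
  fixes f g :: "real \<Rightarrow> 'a::real_inner"
  assumes f: "\<And>t. t \<in> {0..1} \<Longrightarrow> (f has_vector_derivative f' t) (at t within {0..1})" "continuous_on {0..1} f'"
    and g: "\<And>t. t \<in> {0..1} \<Longrightarrow> (g has_vector_derivative g' t) (at t within {0..1})" "continuous_on {0..1} g'"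
    and ends: "f 1 \<bullet> g 1 = f 0 \<bullet> g 0"
  shows "integral {0..1} (\<lambda>t. f t \<bullet> g' t) = - integral {0..1} (\<lambda>t. f' t \<bullet> g t)"
proof -
  have cf: "continuous_on {0..1} f" and cg: "continuous_on {0..1} g"
    using f(1) g(1) by (meson continuous_on_eq_continuous_within has_vector_derivative_continuous)+
  have i: "(\<lambda>t. f t \<bullet> g' t) integrable_on {0..1}" "(\<lambda>t. f' t \<bullet> g t) integrable_on {0..1}"
    by (intro integrable_continuous_real continuous_intros cf cg f g)+
  have "((\<lambda>t. f t \<bullet> g' t + f' t \<bullet> g t) has_integral f 1 \<bullet> g 1 - f 0 \<bullet> g 0) {0..1}"
    by (rule fundamental_theorem_of_calculus)
       (auto intro!: bounded_bilinear.has_vector_derivative[OF bounded_bilinear_inner] f(1) g(1))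
  then have "integral {0..1} (\<lambda>t. f t \<bullet> g' t + f' t \<bullet> g t) = 0" using ends by (simp add: integral_unique)
  then show ?thesis by (simp add: integral_add[OF i])
qed

lemma smooth_curve_nderiv_continuous: "smooth_curve u \<Longrightarrow> continuous_on {0..1} (nderiv k u)"
  by (simp add: smooth_curve_def differentiable_imp_continuous_on)

text \<open>Flatness of \<phi> removes the boundary terms at every stage, whatever g does at the
  ends. This matters because the partial derivatives of a time-dependent integrand need not be
  periodic along a loop.\<close>

lemma integration_by_parts_flat:
  fixes \<phi> :: "real \<Rightarrow> real"
  assumes \<phi>: "smooth_ends Flat \<phi>"
  shows "smooth_curve g \<Longrightarrow> integral {0..1} (\<lambda>t. g t * nderiv i \<phi> t) = (- 1) ^ i * integral {0..1} (\<lambda>t. nderiv i g t * \<phi> t)"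
proof (induction i arbitrary: g)
  case (Suc i)
  have s\<phi>: "smooth_curve \<phi>" using \<phi> by (simp add: smooth_ends_def)
  have sg: "smooth_curve (nderiv 1 g)" using Suc.prems unfolding smooth_curve_def by (metis nderiv_Suc_shift)
  have "integral {0..1} (\<lambda>t. g t \<bullet> nderiv (Suc i) \<phi> t) = - integral {0..1} (\<lambda>t. nderiv 1 g t \<bullet> nderiv i \<phi> t)"
  proof (rule integration_by_parts_inner)
    show "(g has_vector_derivative nderiv 1 g t) (at t within {0..1})" if "t \<in> {0..1}" for t
      using smooth_curve_has_deriv[OF Suc.prems that, of 0] by simp
    show "(nderiv i \<phi> has_vector_derivative nderiv (Suc i) \<phi> t) (at t within {0..1})" if "t \<in> {0..1}" for t
      by (rule smooth_curve_has_deriv[OF s\<phi> that])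
    have "nderiv i \<phi> 0 = 0" "nderiv i \<phi> 1 = 0" using \<phi> by (auto simp: smooth_ends_def)
    then show "g 1 \<bullet> nderiv i \<phi> 1 = g 0 \<bullet> nderiv i \<phi> 0" by simp
  qed (intro smooth_curve_nderiv_continuous Suc.prems s\<phi>)+
  also have "integral {0..1} (\<lambda>t. nderiv 1 g t \<bullet> nderiv i \<phi> t) = (- 1) ^ i * integral {0..1} (\<lambda>t. nderiv i (nderiv 1 g) t * \<phi> t)"
    using Suc.IH[OF sg] by simp
  finally show ?case unfolding nderiv_Suc_shift[of i g] by simp
qed simp

lemma fundamental_lemma:
  fixes u :: "real \<Rightarrow> real"
  assumes u: "smooth_curve u"
    and orth: "\<And>\<phi>. smooth_ends Flat \<phi> \<Longrightarrow> integral {0..1} (\<lambda>t. u t * \<phi> t) = 0" and t: "t \<in> {0..1}"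
  shows "u t = 0"
proof -
  obtain b :: "real \<Rightarrow> real" where b: "smooth_ends Flat b" "\<And>t. t \<in> {0<..<1} \<Longrightarrow> b t > 0" using bump_exists by blast
  have cb: "continuous_on {0..1} b" using b(1) smooth_curve_continuous by (auto simp: smooth_ends_def)
  have cu: "continuous_on {0..1} u" by (rule smooth_curve_continuous[OF u])
  have b01: "b 0 = 0" "b 1 = 0" using b(1) by (auto simp: smooth_ends_def dest: spec[of _ 0])
  have b0: "b t \<ge> 0" if "t \<in> {0..1}" for t
    using b(2)[of t] b01 that by (cases "t = 0 \<or> t = 1") force+
  \<comment> \<open>The test function is the bump times u itself, so the integrand is b * u^2 and
    nonnegative. This forces u = 0 in the interior; the ends follow by continuity.\<close>
  have "integral {0..1} (\<lambda>t. u t * (b t * u t)) = 0"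
    using orth[OF smooth_ends_Flat_product[OF b(1) u]] by simp
  moreover have "continuous_on {0..1} (\<lambda>t. u t * (b t * u t))" by (intro continuous_intros cb cu)
  moreover have "0 \<le> u t * (b t * u t)" if "t \<in> {0..1}" for t
    using b0[OF that] by (metis mult.left_commute mult_nonneg_nonneg zero_le_square)
  ultimately have "\<forall>t\<in>{0..1}. u t * (b t * u t) = 0"
    using integral_eq_0_iff[of 0 1 "\<lambda>t. u t * (b t * u t)"] by auto
  then have "u t = 0" if "t \<in> {0<..<1}" for t using b(2)[OF that] that by fastforce
  moreover have "closure {0<..<1} = {0..1::real}" by simp
  ultimately show ?thesis
    using continuous_constant_on_closure[of "{0<..<1}" u 0 t] cu t by metis
qed

section \<open>First variations and gradients of local functions\<close>

text \<open>The velocity of the jet under an affine perturbation of the path. A variation moves q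
  and p but not t, whereas \<open>jet_at\<close> would put t itself into the \<open>Time\<close>
  coordinate; hence the reset to 0.\<close>

definition variation_jet :: "'n::finite cpath \<Rightarrow> real \<Rightarrow> 'n jet" where
  "variation_jet \<delta> t = (jet_at \<delta> t)(Time := 0)"

abbreviation first_variation ::
  "(real^'n) set \<Rightarrow> nat \<Rightarrow> ('n::finite jet \<Rightarrow> real) \<Rightarrow> 'n cpath \<Rightarrow> 'n cpath \<Rightarrow> real \<Rightarrow> real" where
  "first_variation M N f a \<delta> t \<equiv>
     (\<Sum>c\<in>jet_coords N N. coord_deriv (jet_domain M) c f (jet_at a t) * variation_jet \<delta> t c)"

lemma loops_cpaths: "a \<in> loops M \<Longrightarrow> a \<in> cpaths M"
  by (auto simp: loops_def)

text \<open>One order for positions and momenta that may be enlarged at will, so that two local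
  functions can be handled with a common N.\<close>

lemma local_on_loops_rep:
  assumes "local_on_loops M F"
  obtains N f where "coord_smooth_on (jet_domain M) f"
    "\<forall>N'\<ge>N. depends_only_on (jet_coords N' N') (jet_domain M) f"
    "\<forall>a\<in>loops M. F a = integral {0..1} (\<lambda>t. f (jet_at a t))"
proof -
  obtain F' k l f where f: "coord_smooth_on (jet_domain M) f" "depends_only_on (jet_coords k l) (jet_domain M) f"
    "\<And>a. a \<in> cpaths M \<Longrightarrow> F' a = integral {0..1} (\<lambda>t. f (jet_at a t))" "\<And>a. a \<in> loops M \<Longrightarrow> F a = F' a"
    using assms unfolding local_on_loops_def local_on_paths_def by blast
  show ?thesis
  proof (rule that[of f "max k l"])
    show "\<forall>N'\<ge>max k l. depends_only_on (jet_coords N' N') (jet_domain M) f"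
    proof (intro allI impI)
      fix N' assume "max k l \<le> N'"
      then show "depends_only_on (jet_coords N' N') (jet_domain M) f"
        by (intro depends_only_on_mono[OF f(2) jet_coords_mono]) auto
    qed
    show "\<forall>a\<in>loops M. F a = integral {0..1} (\<lambda>t. f (jet_at a t))"
      using f(3) f(4) loops_cpaths by metis
  qed (rule f(1))
qed

lemma jet_at_perturb:
  assumes "smooth_curve q" "smooth_curve p" "smooth_curve \<delta>q" "smooth_curve \<delta>p" "t \<in> {0..1}"
  shows "jet_at (\<lambda>t. q t + \<epsilon> *\<^sub>R \<delta>q t, \<lambda>t. p t + \<epsilon> *\<^sub>R \<delta>p t) t c
    = jet_at (q, p) t c + \<epsilon> * variation_jet (\<delta>q, \<delta>p) t c"
  by (cases c) (simp_all add: variation_jet_def nderiv_add_scaleR[OF assms(1,3,5)] nderiv_add_scaleR[OF assms(2,4,5)] del: nderiv.simps)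

lemma loops_perturb:
  assumes M: "open M" and a: "(q, p) \<in> loops M" and \<delta>: "smooth_closed \<delta>q" "smooth_closed \<delta>p"
  obtains e where "e > 0" "\<And>\<epsilon>. \<bar>\<epsilon>\<bar> \<le> e \<Longrightarrow> (\<lambda>t. q t + \<epsilon> *\<^sub>R \<delta>q t, \<lambda>t. p t + \<epsilon> *\<^sub>R \<delta>p t) \<in> loops M"
proof -
  have sm: "smooth_closed q" "smooth_closed p" "q ` {0..1} \<subseteq> M" using a by (auto simp: loops_def cpaths_def)
  have closed: "smooth_closed (\<lambda>t. u t + \<epsilon> *\<^sub>R v t)" if "smooth_closed u" "smooth_closed v" for u v :: "real \<Rightarrow> real^'a" and \<epsilon>
  proof -
    have "smooth_family Closed {0} (\<lambda>_ t. u t + \<epsilon> *\<^sub>R v t)"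
      using that unfolding smooth_ends_simps(2)[symmetric] smooth_ends_iff smooth_family_def
      by (auto intro!: Ck_family_add Ck_family_linear[OF bounded_linear_scaleR_right])
    then show ?thesis by (simp add: smooth_ends_simps(2)[symmetric] smooth_ends_iff)
  qed
  have cq: "continuous_on {0..1} q" and cd: "continuous_on {0..1} \<delta>q"
    using sm \<delta> by (auto simp: smooth_closed_def intro: smooth_curve_continuous)
  obtain \<rho> where \<rho>: "\<rho> > 0" "tube (q ` {0..1}) \<rho> \<subseteq> M"
    using tube_exists[OF compact_continuous_image[OF cq compact_Icc] M sm(3)] by blast
  have "bounded (\<delta>q ` {0..1})" by (intro compact_imp_bounded compact_continuous_image cd) auto
  then obtain B where B: "\<And>t. t \<in> {0..1} \<Longrightarrow> norm (\<delta>q t) \<le> B" unfolding bounded_iff by blast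
  have B0: "B \<ge> 0" using B[of 0] by (metis atLeastAtMost_iff norm_ge_zero order_refl order_trans zero_le_one)
  define e where "e = \<rho> / (B + 1)"
  have e: "e > 0" "e * B \<le> \<rho>" using \<rho> B0 by (auto simp: e_def field_simps)
  show ?thesis
  proof (rule that[OF e(1)])
    fix \<epsilon> :: real assume \<epsilon>: "\<bar>\<epsilon>\<bar> \<le> e"
    have "q t + \<epsilon> *\<^sub>R \<delta>q t \<in> M" if t: "t \<in> {0..1}" for t
    proof -
      have "norm (\<epsilon> *\<^sub>R \<delta>q t) \<le> e * B" using \<epsilon> B[OF t] e B0 by (auto intro!: mult_mono)
      then have "q t + \<epsilon> *\<^sub>R \<delta>q t \<in> cball (q t) \<rho>" using e(2) by (simp add: dist_norm)
      then show ?thesis using cball_subset_tube[of "q t" "q ` {0..1}" \<rho>] t \<rho>(2) by blast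
    qed
    then show "(\<lambda>t. q t + \<epsilon> *\<^sub>R \<delta>q t, \<lambda>t. p t + \<epsilon> *\<^sub>R \<delta>p t) \<in> loops M"
      using closed[OF sm(1) \<delta>(1), of \<epsilon>] closed[OF sm(2) \<delta>(2), of \<epsilon>]
      by (auto simp: loops_def cpaths_def smooth_closed_def)
  qed
qed

context
  fixes M :: "(real^'n) set" and F f and N :: nat
  assumes M: "open M"
    and f: "coord_smooth_on (jet_domain M) f" "depends_only_on (jet_coords N N) (jet_domain M) f"
    and rep: "\<And>a. a \<in> loops M \<Longrightarrow> F a = integral {0..1} (\<lambda>t. f (jet_at a t))"
begin

text \<open>The integral formula for \<open>F\<close> holds on loops only. Small affine
  perturbations of a loop are loops because M is open, and a two-sided range of \<epsilon> gives the
  two-sided derivative that \<open>has_gradient\<close> asks for.\<close>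

lemma action_directional_derivative:
  assumes a: "a \<in> loops M" and \<delta>: "smooth_closed \<delta>q" "smooth_closed \<delta>p"
  shows "((\<lambda>\<epsilon>. F (\<lambda>t. fst a t + \<epsilon> *\<^sub>R \<delta>q t, \<lambda>t. snd a t + \<epsilon> *\<^sub>R \<delta>p t)) has_real_derivative
    integral {0..1} (\<lambda>t. first_variation M N f a (\<delta>q, \<delta>p) t)) (at 0)"
proof -
  obtain q p where aqp: "a = (q, p)" by (cases a)
  have sm: "smooth_curve q" "smooth_curve p" "smooth_curve \<delta>q" "smooth_curve \<delta>p"
    using a \<delta> by (auto simp: aqp loops_def smooth_closed_def)
  obtain e where e: "e > 0" "\<And>\<epsilon>. \<bar>\<epsilon>\<bar> \<le> e \<Longrightarrow> (\<lambda>t. q t + \<epsilon> *\<^sub>R \<delta>q t, \<lambda>t. p t + \<epsilon> *\<^sub>R \<delta>p t) \<in> loops M"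
    using loops_perturb[OF M a[unfolded aqp] \<delta>] by blast
  define x where "x = (\<lambda>\<epsilon> t c. jet_at a t c + \<epsilon> * variation_jet (\<delta>q, \<delta>p) t c)"
  have x: "jet_at (\<lambda>t. q t + \<epsilon> *\<^sub>R \<delta>q t, \<lambda>t. p t + \<epsilon> *\<^sub>R \<delta>p t) t = x \<epsilon> t" if "t \<in> {0..1}" for \<epsilon> t
    using jet_at_perturb[OF sm that] by (auto simp: x_def aqp)
  have xd: "x \<epsilon> t \<in> jet_domain M" if "\<epsilon> \<in> {-e..e}" "t \<in> {0..1}" for \<epsilon> t
    using jet_at_domain[OF loops_cpaths[OF e(2)] that(2), of \<epsilon>] x[OF that(2)] that by auto
  have c1: "continuous_on {0..1} (\<lambda>t. jet_at a t c)" for c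
    by (rule continuous_on_product_then_coordinatewise[OF jet_at_continuous[OF loops_cpaths[OF a]]])
  have c2: "continuous_on {0..1} (\<lambda>t. variation_jet (\<delta>q, \<delta>p) t c)" for c
    by (cases c) (auto simp: variation_jet_def simp del: nderiv.simps intro!: continuous_intros smooth_curve_nderiv_continuous sm)
  have cc: "continuous_on ({-e..e} \<times> {0..1}) (\<lambda>z. g (snd z))" if "continuous_on {0..1} g" for g :: "real \<Rightarrow> real"
    by (rule continuous_on_compose2[OF that]) (auto intro!: continuous_intros)
  have "((\<lambda>\<epsilon>. integral {0..1} (\<lambda>t. f (x \<epsilon> t))) has_real_derivative
      integral {0..1} (\<lambda>t. \<Sum>c\<in>jet_coords N N. coord_deriv (jet_domain M) c f (x 0 t) * variation_jet (\<delta>q, \<delta>p) t c)) (at 0 within {-e..e})"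
  proof (rule action_has_derivative[OF M f(1) finite_jet_coords f(2), where y = "\<lambda>c s t. variation_jet (\<delta>q, \<delta>p) t c"])
    show "continuous_on ({-e..e} \<times> {0..1}) (\<lambda>(s, t). x s t c)" for c
      unfolding split_beta x_def by (intro continuous_intros cc c1 c2)
    show "continuous_on ({-e..e} \<times> {0..1}) (\<lambda>(s, t). variation_jet (\<delta>q, \<delta>p) t c)" for c
      unfolding split_beta by (intro cc c2)
    show "((\<lambda>s. x s t c) has_vector_derivative variation_jet (\<delta>q, \<delta>p) t c) (at s within {-e..e})" for c s t
      unfolding x_def by (auto intro!: derivative_eq_intros)
  qed (use xd e(1) in auto)
  moreover have "x 0 t = jet_at a t" for t by (simp add: x_def)
  moreover have "at 0 within {-e..e} = at 0" by (rule at_within_interior) (use e(1) in simp)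
  ultimately have D: "((\<lambda>\<epsilon>. integral {0..1} (\<lambda>t. f (x \<epsilon> t))) has_real_derivative
      integral {0..1} (\<lambda>t. first_variation M N f a (\<delta>q, \<delta>p) t)) (at 0)"
    by simp
  show ?thesis
  proof (rule has_field_derivative_transform_within_open[OF D, of "{-e<..<e}"])
    fix \<epsilon> assume "\<epsilon> \<in> {-e<..<e}"
    then have "F (\<lambda>t. q t + \<epsilon> *\<^sub>R \<delta>q t, \<lambda>t. p t + \<epsilon> *\<^sub>R \<delta>p t) = integral {0..1} (\<lambda>t. f (x \<epsilon> t))"
      by (subst rep[OF e(2)]) (auto intro!: integral_cong simp: x)
    then show "integral {0..1} (\<lambda>t. f (x \<epsilon> t)) = F (\<lambda>t. fst a t + \<epsilon> *\<^sub>R \<delta>q t, \<lambda>t. snd a t + \<epsilon> *\<^sub>R \<delta>p t)"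
      by (simp add: aqp)
  qed (use e(1) in auto)
qed

lemma gradient_pairing:
  assumes a: "a \<in> loops M" and AB: "has_gradient F a (A, B)" and \<delta>: "smooth_closed \<delta>q" "smooth_closed \<delta>p"
  shows "integral {0..1} (\<lambda>t. first_variation M N f a (\<delta>q, \<delta>p) t)
    = integral {0..1} (\<lambda>t. A t \<bullet> \<delta>q t) + integral {0..1} (\<lambda>t. B t \<bullet> \<delta>p t)"
  by (rule DERIV_unique[OF action_directional_derivative[OF a \<delta>]]) (use AB \<delta> in \<open>simp add: has_gradient_def\<close>)

text \<open>Shared by positions and momenta. The hypothesis \<open>eq\<close> is the gradient
  identity for a variation in a single component with flat profile \<phi>. Integration by parts puts
  all derivatives on the partial derivatives of f, and the fundamental lemma then compares the
  densities.\<close>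

lemma euler_lagrange_component:
  assumes a: "a \<in> loops M" and X: "inj X" "\<And>i. i \<le> N \<longleftrightarrow> X i \<in> jet_coords N N" and u: "smooth_curve u"
    and eq: "\<And>\<phi>. smooth_ends Flat \<phi> \<Longrightarrow>
      \<exists>v. (\<forall>t\<in>{0..1}. \<forall>c. v t c = (if c \<in> range X then nderiv (inv X c) \<phi> t else 0)) \<and>
      integral {0..1} (\<lambda>t. \<Sum>c\<in>jet_coords N N. coord_deriv (jet_domain M) c f (jet_at a t) * v t c) = integral {0..1} (\<lambda>t. u t * \<phi> t)"
    and t: "t \<in> {0..1}"
  shows "u t = euler_lagrange M N X f (jet_at a t)"
proof -
  let ?J = "jet_coords N N"
  define E where "E = (\<lambda>t. euler_lagrange M N X f (jet_at a t))"
  define g where "g = (\<lambda>i t. coord_deriv (jet_domain M) (X i) f (jet_at a t))"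
  have sd: "coord_smooth_on (jet_domain M) (coord_deriv (jet_domain M) c f)"
    "depends_only_on (jet_coords N N) (jet_domain M) (coord_deriv (jet_domain M) c f)" for c
    by (rule coord_smooth_deriv[OF M f(1)], rule coord_deriv_depends[OF M f(2)])
  note along = nderiv_along[OF M sd loops_cpaths[OF a]]
  have sg: "smooth_curve (g i)" for i unfolding g_def by (rule along(1))
  have ng: "nderiv i (g j) t = total_derivs M N i (coord_deriv (jet_domain M) (X j) f) (jet_at a t)" if "t \<in> {0..1}" for i j t
    unfolding g_def by (rule along(2)[OF that])
  have sE: "smooth_curve E"
    unfolding E_def
    by (rule nderiv_along(1)[OF M euler_lagrange_smooth[OF M f(1)] euler_lagrange_depends[OF M f(2)] loops_cpaths[OF a]])
  have "(\<lambda>t. u t - E t) t = 0"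
  proof (rule fundamental_lemma[OF smooth_curve_diff(1)[OF u sE] _ t])
    fix \<phi> :: "real \<Rightarrow> real" assume \<phi>: "smooth_ends Flat \<phi>"
    then have s\<phi>: "smooth_curve \<phi>" by (simp add: smooth_ends_def)
    note c = smooth_curve_continuous[OF u] smooth_curve_continuous[OF sE] smooth_curve_continuous[OF s\<phi>]
      smooth_curve_nderiv_continuous[OF s\<phi>] smooth_curve_continuous[OF sg] smooth_curve_nderiv_continuous[OF sg]
    obtain v where v: "\<And>t c. t \<in> {0..1} \<Longrightarrow> v t c = (if c \<in> range X then nderiv (inv X c) \<phi> t else 0)"
      "integral {0..1} (\<lambda>t. \<Sum>c\<in>?J. coord_deriv (jet_domain M) c f (jet_at a t) * v t c) = integral {0..1} (\<lambda>t. u t * \<phi> t)"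
      using eq[OF \<phi>] by blast
    have "(\<Sum>c\<in>?J. coord_deriv (jet_domain M) c f (jet_at a t) * v t c) = (\<Sum>i\<le>N. g i t * nderiv i \<phi> t)" if t: "t \<in> {0..1}" for t
    proof -
      have sub: "X ` {..N} \<subseteq> ?J" using X(2) by auto
      have "(\<Sum>c\<in>?J. coord_deriv (jet_domain M) c f (jet_at a t) * v t c) = (\<Sum>c\<in>X ` {..N}. coord_deriv (jet_domain M) c f (jet_at a t) * v t c)"
      proof (rule sum.mono_neutral_right[OF finite_jet_coords sub], rule ballI)
        fix c assume "c \<in> ?J - X ` {..N}"
        then have "c \<notin> range X" using X(2) by auto
        then show "coord_deriv (jet_domain M) c f (jet_at a t) * v t c = 0" by (simp add: v(1)[OF t])
      qed
      also have "\<dots> = (\<Sum>i\<le>N. g i t * nderiv i \<phi> t)"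
        by (subst sum.reindex) (use X(1) in \<open>auto simp: g_def v(1)[OF t] inj_on_def inj_def intro!: sum.cong\<close>)
      finally show ?thesis .
    qed
    then have "integral {0..1} (\<lambda>t. \<Sum>c\<in>?J. coord_deriv (jet_domain M) c f (jet_at a t) * v t c)
        = integral {0..1} (\<lambda>t. \<Sum>i\<le>N. g i t * nderiv i \<phi> t)" by (intro integral_cong) auto
    also have "\<dots> = (\<Sum>i\<le>N. integral {0..1} (\<lambda>t. g i t * nderiv i \<phi> t))"
      by (intro integral_sum integrable_continuous_real continuous_intros c) auto
    also have "\<dots> = (\<Sum>i\<le>N. integral {0..1} (\<lambda>t. (- 1) ^ i * (nderiv i (g i) t * \<phi> t)))"
      using integration_by_parts_flat[OF \<phi> sg] by simp
    also have "\<dots> = integral {0..1} (\<lambda>t. \<Sum>i\<le>N. (- 1) ^ i * (nderiv i (g i) t * \<phi> t))"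
      by (intro integral_sum[symmetric] integrable_continuous_real continuous_intros c) auto
    also have "\<dots> = integral {0..1} (\<lambda>t. E t * \<phi> t)"
      by (intro integral_cong) (simp add: E_def euler_lagrange_def[OF M] ng sum_distrib_right mult.assoc)
    finally have "integral {0..1} (\<lambda>t. u t * \<phi> t) = integral {0..1} (\<lambda>t. E t * \<phi> t)" using v(2) by simp
    then show "integral {0..1} (\<lambda>t. (u t - E t) * \<phi> t) = 0"
      by (simp add: left_diff_distrib integral_diff integrable_continuous_real continuous_on_mult c)
  qed
  then show ?thesis by (simp add: E_def)
qed

text \<open>Flat variations already determine the gradient, and on them no boundary terms occur. So
  the formula holds at every loop where a gradient exists, even for an integrand that depends on t
  non-periodically.\<close>

lemma gradient_euler_lagrange:
  assumes a: "a \<in> loops M" and AB: "has_gradient F a (A, B)" and t: "t \<in> {0..1}"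
  shows "A t $ s = euler_lagrange M N (\<lambda>i. Pos i s) f (jet_at a t)"
    and "B t $ s = euler_lagrange M N (\<lambda>i. Mom i s) f (jet_at a t)"
proof -
  have cl: "smooth_closed A" "smooth_closed B" using AB by (auto simp: has_gradient_def)
  have comp: "smooth_curve (\<lambda>t. U t $ s)" if "smooth_closed U" for U :: "real \<Rightarrow> real^'n"
    using that Ck_family_linear[OF bounded_linear_vec_nth]
    unfolding smooth_closed_def smooth_ends_simps(1)[symmetric] smooth_ends_iff smooth_family_def by blast
  have flat: "smooth_curve \<phi>" "smooth_closed (\<lambda>t. \<phi> t *\<^sub>R axis s (1::real))"
      "\<And>k t. t \<in> {0..1} \<Longrightarrow> nderiv k (\<lambda>t. \<phi> t *\<^sub>R axis s (1::real)) t = nderiv k \<phi> t *\<^sub>R (axis s 1 :: real^'n)"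
    if \<phi>: "smooth_ends Flat \<phi>" for \<phi> :: "real \<Rightarrow> real"
  proof -
    show s\<phi>: "smooth_curve \<phi>" using \<phi> by (simp add: smooth_ends_def)
    have bl: "bounded_linear (\<lambda>x. x *\<^sub>R (axis s (1::real) :: real^'n))" by (rule bounded_linear_scaleR_left)
    show "smooth_closed (\<lambda>t. \<phi> t *\<^sub>R (axis s (1::real) :: real^'n))"
      using \<phi> Ck_family_Flat_Closed[OF Ck_family_linear[OF bl]]
      unfolding smooth_ends_simps(2)[symmetric] smooth_ends_iff smooth_family_def by blast
    show "nderiv k (\<lambda>t. \<phi> t *\<^sub>R axis s (1::real)) t = nderiv k \<phi> t *\<^sub>R (axis s 1 :: real^'n)" if "t \<in> {0..1}" for k t
      by (rule nderiv_bounded_linear[OF bl s\<phi> that])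
  qed
  have z: "nderiv k (\<lambda>t. 0 :: real^'n) t = 0" if "t \<in> {0..1}" for k t
    using nderiv_eq_family[of "\<lambda>t. 0 :: real^'n" "\<lambda>k t. 0" t k] that by simp
  show "A t $ s = euler_lagrange M N (\<lambda>i. Pos i s) f (jet_at a t)"
  proof (rule euler_lagrange_component[OF a _ _ comp[OF cl(1)] _ t])
    show X: "inj (\<lambda>i. Pos i s :: 'n jet_coord)" by (auto simp: inj_def)
    show "i \<le> N \<longleftrightarrow> Pos i s \<in> jet_coords N N" for i by (auto simp: jet_coords_def)
    fix \<phi> :: "real \<Rightarrow> real" assume \<phi>: "smooth_ends Flat \<phi>"
    let ?v = "variation_jet (\<lambda>t. \<phi> t *\<^sub>R axis s 1, \<lambda>t. 0)"
    have "?v t c = (if c \<in> range (\<lambda>i. Pos i s) then nderiv (inv (\<lambda>i. Pos i s) c) \<phi> t else 0)" if "t \<in> {0..1}" for t c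
      using inv_f_f[OF X] flat(3)[OF \<phi> that] z[OF that]
      by (cases c) (auto simp: variation_jet_def axis_def simp del: nderiv.simps)
    moreover have "integral {0..1} (\<lambda>t. \<Sum>c\<in>jet_coords N N. coord_deriv (jet_domain M) c f (jet_at a t) * ?v t c) = integral {0..1} (\<lambda>t. A t $ s * \<phi> t)"
      using gradient_pairing[OF a AB flat(2)[OF \<phi>] smooth_closed_zero] by (simp add: inner_axis mult.commute)
    ultimately show "\<exists>v. (\<forall>t\<in>{0..1}. \<forall>c. v t c = (if c \<in> range (\<lambda>i. Pos i s) then nderiv (inv (\<lambda>i. Pos i s) c) \<phi> t else 0)) \<and>
      integral {0..1} (\<lambda>t. \<Sum>c\<in>jet_coords N N. coord_deriv (jet_domain M) c f (jet_at a t) * v t c) = integral {0..1} (\<lambda>t. A t $ s * \<phi> t)"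
      by (intro exI[of _ ?v]) blast
  qed
  show "B t $ s = euler_lagrange M N (\<lambda>i. Mom i s) f (jet_at a t)"
  proof (rule euler_lagrange_component[OF a _ _ comp[OF cl(2)] _ t])
    show X: "inj (\<lambda>i. Mom i s :: 'n jet_coord)" by (auto simp: inj_def)
    show "i \<le> N \<longleftrightarrow> Mom i s \<in> jet_coords N N" for i by (auto simp: jet_coords_def)
    fix \<phi> :: "real \<Rightarrow> real" assume \<phi>: "smooth_ends Flat \<phi>"
    let ?v = "variation_jet (\<lambda>t. 0, \<lambda>t. \<phi> t *\<^sub>R axis s 1)"
    have "?v t c = (if c \<in> range (\<lambda>i. Mom i s) then nderiv (inv (\<lambda>i. Mom i s) c) \<phi> t else 0)" if "t \<in> {0..1}" for t c
      using inv_f_f[OF X] flat(3)[OF \<phi> that] z[OF that]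
      by (cases c) (auto simp: variation_jet_def axis_def simp del: nderiv.simps)
    moreover have "integral {0..1} (\<lambda>t. \<Sum>c\<in>jet_coords N N. coord_deriv (jet_domain M) c f (jet_at a t) * ?v t c) = integral {0..1} (\<lambda>t. B t $ s * \<phi> t)"
      using gradient_pairing[OF a AB smooth_closed_zero flat(2)[OF \<phi>]] by (simp add: inner_axis mult.commute)
    ultimately show "\<exists>v. (\<forall>t\<in>{0..1}. \<forall>c. v t c = (if c \<in> range (\<lambda>i. Mom i s) then nderiv (inv (\<lambda>i. Mom i s) c) \<phi> t else 0)) \<and>
      integral {0..1} (\<lambda>t. \<Sum>c\<in>jet_coords N N. coord_deriv (jet_domain M) c f (jet_at a t) * v t c) = integral {0..1} (\<lambda>t. B t $ s * \<phi> t)"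
      by (intro exI[of _ ?v]) blast
  qed
qed

end

lemma gradient_works: "has_gradients M F \<Longrightarrow> a \<in> loops M \<Longrightarrow> has_gradient F a (gradient F a)"
  unfolding has_gradients_def gradient_def by (blast intro: someI_ex)

text \<open>Gradients are chosen by \<open>SOME\<close>, but every choice equals the Euler-Lagrange
  expressions on [0,1], which are smooth functions of jets of order N + N. The bracket is therefore
  the integral of a single jet function.\<close>

theorem loop_bracket_local:
  fixes M :: "(real^'n) set"
  assumes M: "open M" and F: "local_on_loops M F" "has_gradients M F" and G: "local_on_loops M G" "has_gradients M G"
  shows "local_on_loops M (loop_bracket F G)"
proof -
  obtain N1 f where f: "coord_smooth_on (jet_domain M) f"
    "\<forall>N'\<ge>N1. depends_only_on (jet_coords N' N') (jet_domain M) f"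
    "\<forall>a\<in>loops M. F a = integral {0..1} (\<lambda>t. f (jet_at a t))" using local_on_loops_rep[OF F(1)] by metis
  obtain N2 g where g: "coord_smooth_on (jet_domain M) g"
    "\<forall>N'\<ge>N2. depends_only_on (jet_coords N' N') (jet_domain M) g"
    "\<forall>a\<in>loops M. G a = integral {0..1} (\<lambda>t. g (jet_at a t))" using local_on_loops_rep[OF G(1)] by metis
  define N where "N = max N1 N2"
  have N: "depends_only_on (jet_coords N N) (jet_domain M) f" "depends_only_on (jet_coords N N) (jet_domain M) g"
    using f(2) g(2) by (auto simp: N_def)
  let ?q = "\<lambda>f s. euler_lagrange M N (\<lambda>i. Pos i s) f" and ?p = "\<lambda>f s. euler_lagrange M N (\<lambda>i. Mom i s) f"
  define h where "h = (\<lambda>x. \<Sum>s\<in>UNIV. ?q f s x * ?p g s x - ?q g s x * ?p f s x)"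
  have hs: "coord_smooth_on (jet_domain M) h"
    unfolding h_def
    by (intro coord_smooth_sum[OF M] coord_smooth_diff[OF M] coord_smooth_mult[OF M] euler_lagrange_smooth[OF M] f g)
  have hd: "depends_only_on (jet_coords (N + N) (N + N)) (jet_domain M) h"
    unfolding depends_only_on_def
  proof (intro ballI impI)
    fix x y assume xy: "x \<in> jet_domain M" "y \<in> jet_domain M" "\<forall>c\<in>jet_coords (N + N) (N + N). x c = y c"
    have "euler_lagrange M N X k x = euler_lagrange M N X k y"
      if "depends_only_on (jet_coords N N) (jet_domain M) k" for X k
      using euler_lagrange_depends[OF M that, of X] xy unfolding depends_only_on_def by blast
    then show "h x = h y" using N by (simp add: h_def)
  qed
  have "loop_bracket F G a = integral {0..1} (\<lambda>t. h (jet_at a t))" if a: "a \<in> loops M" for a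
  proof -
    obtain A B A' B' where AB: "gradient F a = (A, B)" "gradient G a = (A', B')" by (meson surj_pair)
    have "has_gradient F a (A, B)" "has_gradient G a (A', B')"
      using gradient_works[OF F(2) a] gradient_works[OF G(2) a] by (simp_all add: AB)
    note eF = gradient_euler_lagrange[OF M f(1) N(1) f(3)[rule_format] a this(1)] and eG = gradient_euler_lagrange[OF M g(1) N(2) g(3)[rule_format] a this(2)]
    have "A t \<bullet> B' t - A' t \<bullet> B t = h (jet_at a t)" if t: "t \<in> {0..1}" for t
      by (simp add: inner_vec_def h_def eF[OF _ t] eG[OF _ t] sum_subtractf)
    then have "integral {0..1} (\<lambda>t. A t \<bullet> B' t - A' t \<bullet> B t) = integral {0..1} (\<lambda>t. h (jet_at a t))"
      by (rule integral_cong)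
    then show ?thesis by (simp add: loop_bracket_def AB)
  qed
  then show ?thesis
    unfolding local_on_loops_def local_on_paths_def
    by (intro exI[of _ "\<lambda>a. integral {0..1} (\<lambda>t. h (jet_at a t))"]) (use hs hd in blast)
qed

section \<open>Closure properties of smooth functions\<close>

lemma Ck_on_cong:
  assumes M: "open M" and eq: "\<And>x. x \<in> M \<Longrightarrow> f x = g x"
  shows "Ck_on k M f \<Longrightarrow> Ck_on k M g"
  using eq
proof (induction k arbitrary: f g)
  case 0
  then show ?case by (simp cong: continuous_on_cong)
next
  case (Suc k)
  have d: "(g has_derivative frechet_derivative f (at x)) (at x)" if "x \<in> M" for x
    by (rule has_derivative_transform_within_open[OF Ck_on_has_derivative[OF M Suc.prems(1) that] M that])
       (use Suc.prems in auto)
  then have "frechet_derivative g (at x) = frechet_derivative f (at x)" if "x \<in> M" for x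
    using frechet_derivative_at[OF d[OF that]] by simp
  then have "Ck_on k M (\<lambda>x. frechet_derivative g (at x) v)" for v
    using Suc.IH[of "\<lambda>x. frechet_derivative f (at x) v"] Suc.prems(1) by simp
  then show ?case using d unfolding Ck_on.simps differentiable_on_eq_differentiable_at[OF M] differentiable_def by blast
qed

lemma Ck_on_SucI:
  assumes M: "open M" and d: "\<And>x. x \<in> M \<Longrightarrow> (f has_derivative f' x) (at x)"
    and k: "\<And>v. Ck_on k M (\<lambda>x. f' x v)"
  shows "Ck_on (Suc k) M f"
proof -
  have "Ck_on k M (\<lambda>x. frechet_derivative f (at x) v)" for v
    by (rule Ck_on_cong[OF M _ k[of v]]) (use frechet_derivative_at[OF d] in metis)
  then show ?thesis using d unfolding Ck_on.simps differentiable_on_eq_differentiable_at[OF M] differentiable_def by blast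
qed

lemma Ck_on_const: "open M \<Longrightarrow> Ck_on k M (\<lambda>x. c)"
proof (induction k arbitrary: c)
  case (Suc k)
  show ?case by (rule Ck_on_SucI[where f' = "\<lambda>x v. 0"]) (use Suc in auto)
qed simp

lemma Ck_on_linear:
  assumes "open M" "bounded_linear L"
  shows "Ck_on k M L"
proof (cases k)
  case 0
  then show ?thesis using assms by (simp add: linear_continuous_on)
next
  case (Suc j)
  show ?thesis unfolding Suc
    by (rule Ck_on_SucI[where f' = "\<lambda>x. L"]) (use assms in \<open>auto intro: Ck_on_const bounded_linear_imp_has_derivative\<close>)
qed

lemma Ck_on_compose_linear:
  assumes M: "open M" and M': "open M'" "L ` M' \<subseteq> M" and L: "bounded_linear L"
  shows "Ck_on k M f \<Longrightarrow> Ck_on k M' (\<lambda>x. f (L x))"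
proof (induction k arbitrary: f)
  case 0
  then show ?case
    using continuous_on_compose2[OF _ linear_continuous_on[OF L] M'(2)] by auto
next
  case (Suc k)
  show ?case
  proof (rule Ck_on_SucI[OF M'(1), where f' = "\<lambda>x v. frechet_derivative f (at (L x)) (L v)"])
    fix x assume "x \<in> M'"
    then have "(f has_derivative frechet_derivative f (at (L x))) (at (L x))"
      using M'(2) by (intro Ck_on_has_derivative[OF M Suc.prems]) auto
    from has_derivative_compose[OF bounded_linear_imp_has_derivative[OF L] this]
    show "((\<lambda>x. f (L x)) has_derivative (\<lambda>v. frechet_derivative f (at (L x)) (L v))) (at x)" .
  next
    show "Ck_on k M' (\<lambda>x. frechet_derivative f (at (L x)) (L v))" for v
      using Suc.IH[of "\<lambda>x. frechet_derivative f (at x) (L v)"] Suc.prems by simp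
  qed
qed

lemma Ck_on_add:
  assumes M: "open M"
  shows "Ck_on k M f \<Longrightarrow> Ck_on k M g \<Longrightarrow> Ck_on k M (\<lambda>x. f x + g x)"
proof (induction k arbitrary: f g)
  case (Suc k)
  show ?case
  proof (rule Ck_on_SucI[OF M, where f' = "\<lambda>x v. frechet_derivative f (at x) v + frechet_derivative g (at x) v"])
    show "Ck_on k M (\<lambda>x. frechet_derivative f (at x) v + frechet_derivative g (at x) v)" for v
      using Suc by auto
    show "((\<lambda>x. f x + g x) has_derivative (\<lambda>v. frechet_derivative f (at x) v + frechet_derivative g (at x) v)) (at x)" if "x \<in> M" for x
      by (intro has_derivative_add Ck_on_has_derivative[OF M Suc.prems(1) that] Ck_on_has_derivative[OF M Suc.prems(2) that])
  qed
qed (auto intro: continuous_intros)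

lemma Ck_on_bilinear:
  assumes M: "open M" and B: "bounded_bilinear pr"
  shows "Ck_on k M f \<Longrightarrow> Ck_on k M g \<Longrightarrow> Ck_on k M (\<lambda>x. pr (f x) (g x))"
proof (induction k arbitrary: f g)
  case 0
  then show ?case using bounded_bilinear.continuous_on[OF B] by auto
next
  case (Suc k)
  show ?case
  proof (rule Ck_on_SucI[OF M, where f' = "\<lambda>x v. pr (f x) (frechet_derivative g (at x) v) + pr (frechet_derivative f (at x) v) (g x)"])
    show "Ck_on k M (\<lambda>x. pr (f x) (frechet_derivative g (at x) v) + pr (frechet_derivative f (at x) v) (g x))" for v
      using Suc.prems Ck_on_mono[OF Suc.prems(1)] Ck_on_mono[OF Suc.prems(2)] by (intro Ck_on_add[OF M] Suc.IH) auto
    show "((\<lambda>x. pr (f x) (g x)) has_derivative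
        (\<lambda>v. pr (f x) (frechet_derivative g (at x) v) + pr (frechet_derivative f (at x) v) (g x))) (at x)" if "x \<in> M" for x
      by (intro bounded_bilinear.FDERIV[OF B] Ck_on_has_derivative[OF M Suc.prems(1) that] Ck_on_has_derivative[OF M Suc.prems(2) that])
  qed
qed

lemma Ck_on_linear_image:
  assumes M: "open M" and L: "bounded_linear L"
  shows "Ck_on k M f \<Longrightarrow> Ck_on k M (\<lambda>x. L (f x))"
proof (induction k arbitrary: f)
  case 0
  then show ?case using bounded_linear.continuous_on[OF L] by auto
next
  case (Suc k)
  show ?case
  proof (rule Ck_on_SucI[OF M, where f' = "\<lambda>x v. L (frechet_derivative f (at x) v)"])
    show "Ck_on k M (\<lambda>x. L (frechet_derivative f (at x) v))" for v using Suc by auto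
    show "((\<lambda>x. L (f x)) has_derivative (\<lambda>v. L (frechet_derivative f (at x) v))) (at x)" if "x \<in> M" for x
      by (intro bounded_linear.has_derivative[OF L] Ck_on_has_derivative[OF M Suc.prems that])
  qed
qed

lemma Ck_on_sum:
  "open M \<Longrightarrow> (\<And>i. i \<in> I \<Longrightarrow> Ck_on k M (f i)) \<Longrightarrow> Ck_on k M (\<lambda>x. \<Sum>i\<in>I. f i x)"
  by (induction I rule: infinite_finite_induct) (auto intro: Ck_on_const Ck_on_add)

lemma smooth_on_const: "open M \<Longrightarrow> smooth_on M (\<lambda>x. c)"
  and smooth_on_linear: "open M \<Longrightarrow> bounded_linear L \<Longrightarrow> smooth_on M L"
  and smooth_on_compose_linear: "open M \<Longrightarrow> open M' \<Longrightarrow> K ` M' \<subseteq> M \<Longrightarrow> bounded_linear K \<Longrightarrow> smooth_on M f \<Longrightarrow> smooth_on M' (\<lambda>x. f (K x))"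
  and smooth_on_add: "open M \<Longrightarrow> smooth_on M f \<Longrightarrow> smooth_on M g \<Longrightarrow> smooth_on M (\<lambda>x. f x + g x)"
  and smooth_on_bilinear: "open M \<Longrightarrow> bounded_bilinear pr \<Longrightarrow> smooth_on M h \<Longrightarrow> smooth_on M k \<Longrightarrow> smooth_on M (\<lambda>x. pr (h x) (k x))"
  and smooth_on_linear_image: "open M \<Longrightarrow> bounded_linear L' \<Longrightarrow> smooth_on M f' \<Longrightarrow> smooth_on M (\<lambda>x. L' (f' x))"
  and smooth_on_sum: "open M \<Longrightarrow> (\<And>i. i \<in> I \<Longrightarrow> smooth_on M (F i)) \<Longrightarrow> smooth_on M (\<lambda>x. \<Sum>i\<in>I. F i x)"
  by (simp_all add: smooth_on_def Ck_on_const Ck_on_linear Ck_on_compose_linear Ck_on_add Ck_on_bilinear Ck_on_linear_image Ck_on_sum)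

lemma smooth_on_frechet: "smooth_on M f \<Longrightarrow> smooth_on M (\<lambda>x. frechet_derivative f (at x) v)"
  unfolding smooth_on_def by (metis Ck_on.simps(2))

lemma smooth_on_has_derivative:
  "open M \<Longrightarrow> smooth_on M f \<Longrightarrow> x \<in> M \<Longrightarrow> (f has_derivative frechet_derivative f (at x)) (at x)"
  unfolding smooth_on_def using Ck_on_has_derivative by blast

lemma smooth_family_compose:
  "open M \<Longrightarrow> m \<in> {Free, Closed} \<Longrightarrow> smooth_on M V \<Longrightarrow> smooth_family m S u \<Longrightarrow> (\<And>s t. s \<in> S \<Longrightarrow> t \<in> {0..1} \<Longrightarrow> u s t \<in> M) \<Longrightarrow>
    smooth_family m S (\<lambda>s t. V (u s t))"
  unfolding smooth_family_def smooth_on_def using Ck_family_compose by blast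

lemma smooth_family_linear: "bounded_linear L \<Longrightarrow> smooth_family m S f \<Longrightarrow> smooth_family m S (\<lambda>s t. L (f s t))"
  and smooth_family_add: "smooth_family m S h \<Longrightarrow> smooth_family m S g \<Longrightarrow> smooth_family m S (\<lambda>s t. h s t + g s t)"
  and smooth_family_bilinear: "bounded_bilinear pr \<Longrightarrow> smooth_family m S h' \<Longrightarrow> smooth_family m S g' \<Longrightarrow> smooth_family m S (\<lambda>s t. pr (h' s t) (g' s t))"
  and smooth_family_sum: "(\<And>i. i \<in> I \<Longrightarrow> smooth_family m S (F i)) \<Longrightarrow> smooth_family m S (\<lambda>s t. \<Sum>i\<in>I. F i s t)"
  by (simp_all add: smooth_family_def Ck_family_linear Ck_family_add Ck_family_bilinear[OF _ disjI1[OF refl]] Ck_family_sum)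

section \<open>Algebra of bivector fields\<close>

locale bivector =
  fixes M :: "(real^'n) set" and \<pi> :: "real^'n \<Rightarrow> real^'n^'n"
  assumes M: "open M" and bivector: "bivector_field M \<pi>"
begin

lemma entry_smooth: "smooth_on M (\<lambda>x. \<pi> x $ i $ j)"
  and skew: "x \<in> M \<Longrightarrow> \<pi> x $ i $ j = - \<pi> x $ j $ i"
  using bivector unfolding bivector_field_def by blast+

definition partial :: "'n \<Rightarrow> 'n \<Rightarrow> 'n \<Rightarrow> real^'n \<Rightarrow> real" where
  "partial s i j x = frechet_derivative (\<lambda>x. \<pi> x $ i $ j) (at x) (axis s 1)"

lemma partial_smooth: "smooth_on M (partial s i j)"
  using smooth_on_frechet[OF entry_smooth] by (simp add: partial_def[abs_def])

definition D\<pi> :: "real^'n \<Rightarrow> real^'n \<Rightarrow> real^'n^'n" where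
  "D\<pi> x v = (\<chi> i j. \<Sum>s\<in>UNIV. v $ s * partial s i j x)"

text \<open>The adjoint of \<open>v \<mapsto> D\<pi> x v *v p\<close>.\<close>

definition D\<pi>_adj :: "real^'n \<Rightarrow> real^'n \<Rightarrow> real^'n \<Rightarrow> real^'n" where
  "D\<pi>_adj x p b = (\<chi> s. \<Sum>i\<in>UNIV. \<Sum>j\<in>UNIV. b $ i * partial s i j x * p $ j)"

text \<open>Minus the Jacobi sum of the coordinate functions x_i, x_j, x_m; the sign comes from
  putting the differentiation index first in the undifferentiated entry. Up to normalization these
  are the components of the Schouten bracket of \<pi> with itself.\<close>

definition jacobiator :: "'n \<Rightarrow> 'n \<Rightarrow> 'n \<Rightarrow> real^'n \<Rightarrow> real" where
  "jacobiator i j m x = (\<Sum>s\<in>UNIV. \<pi> x $ s $ m * partial s i j x + \<pi> x $ s $ j * partial s m i x + \<pi> x $ s $ i * partial s j m x)"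

lemma partial_skew:
  assumes "x \<in> M" shows "partial s i j x = - partial s j i x"
proof -
  have "((\<lambda>x. \<pi> x $ i $ j) has_derivative (\<lambda>v. - frechet_derivative (\<lambda>x. \<pi> x $ j $ i) (at x) v)) (at x)"
    by (rule has_derivative_transform_within_open[OF has_derivative_minus[OF smooth_on_has_derivative[OF M entry_smooth[of j i] assms]] M assms])
       (rule skew[symmetric])
  then have "frechet_derivative (\<lambda>x. \<pi> x $ i $ j) (at x) = (\<lambda>v. - frechet_derivative (\<lambda>x. \<pi> x $ j $ i) (at x) v)"
    by (rule frechet_derivative_at[symmetric])
  then show ?thesis by (simp add: partial_def)
qed

lemma entry_has_derivative:
  assumes "x \<in> M"
  shows "((\<lambda>x. \<pi> x $ i $ j) has_derivative (\<lambda>v. \<Sum>s\<in>UNIV. v $ s * partial s i j x)) (at x)"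
proof -
  note D = smooth_on_has_derivative[OF M entry_smooth[of i j] assms]
  interpret linear "frechet_derivative (\<lambda>x. \<pi> x $ i $ j) (at x)" by (rule has_derivative_linear[OF D])
  have "frechet_derivative (\<lambda>x. \<pi> x $ i $ j) (at x) v = (\<Sum>s\<in>UNIV. v $ s * partial s i j x)" for v
  proof -
    have "v = (\<Sum>s\<in>UNIV. v $ s *\<^sub>R axis s 1)" using basis_expansion[of v] by (simp add: scalar_mult_eq_scaleR)
    then have "frechet_derivative (\<lambda>x. \<pi> x $ i $ j) (at x) v = frechet_derivative (\<lambda>x. \<pi> x $ i $ j) (at x) (\<Sum>s\<in>UNIV. v $ s *\<^sub>R axis s 1)"
      by simp
    also have "\<dots> = (\<Sum>s\<in>UNIV. v $ s * partial s i j x)" by (simp only: sum scale partial_def real_scaleR_def)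
    finally show ?thesis .
  qed
  then have "frechet_derivative (\<lambda>x. \<pi> x $ i $ j) (at x) = (\<lambda>v. \<Sum>s\<in>UNIV. v $ s * partial s i j x)" by (rule ext)
  then show ?thesis using D by simp
qed

lemma anchor_has_vector_derivative:
  assumes q: "(q has_vector_derivative q') (at t within T)" and qM: "q t \<in> M"
    and b: "(b has_vector_derivative b') (at t within T)"
  shows "((\<lambda>t. \<pi> (q t) *v b t) has_vector_derivative D\<pi> (q t) q' *v b t + \<pi> (q t) *v b') (at t within T)"
proof -
  have e: "((\<lambda>t. \<pi> (q t) $ i $ j) has_vector_derivative D\<pi> (q t) q' $ i $ j) (at t within T)" for i j
    using vector_derivative_diff_chain_within[OF q has_derivative_at_withinI[OF entry_has_derivative[OF qM, of i j]]]
    by (simp add: o_def D\<pi>_def)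
  have bj: "((\<lambda>t. b t $ j) has_vector_derivative b' $ j) (at t within T)" for j
    by (rule bounded_linear.has_vector_derivative[OF bounded_linear_vec_nth b])
  have "((\<lambda>t. \<Sum>i\<in>UNIV. (\<Sum>j\<in>UNIV. \<pi> (q t) $ i $ j * b t $ j) *\<^sub>R axis i (1::real)) has_vector_derivative
      (\<Sum>i\<in>UNIV. (\<Sum>j\<in>UNIV. \<pi> (q t) $ i $ j * b' $ j + D\<pi> (q t) q' $ i $ j * b t $ j) *\<^sub>R axis i 1)) (at t within T)"
    by (intro has_vector_derivative_sum bounded_linear.has_vector_derivative[OF bounded_linear_scaleR_left]
        has_vector_derivative_mult e bj)
  moreover have "(\<Sum>i\<in>UNIV. v $ i *\<^sub>R axis i (1::real)) = v" for v :: "real^'n"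
    using basis_expansion[of v] by (simp add: scalar_mult_eq_scaleR)
  from this[symmetric] have exp: "\<pi> x *v c = (\<Sum>i\<in>UNIV. (\<Sum>j\<in>UNIV. \<pi> x $ i $ j * c $ j) *\<^sub>R axis i 1)"
    "D\<pi> (q t) q' *v b t + \<pi> (q t) *v b' = (\<Sum>i\<in>UNIV. (\<Sum>j\<in>UNIV. \<pi> (q t) $ i $ j * b' $ j + D\<pi> (q t) q' $ i $ j * b t $ j) *\<^sub>R axis i 1)" for x c
    by (simp_all add: vec_eq_iff matrix_vector_mult_def axis_def if_distrib[of "\<lambda>z. _ * z"] sum.distrib cong: if_cong)
  ultimately show ?thesis by (simp only: exp)
qed

lemma D\<pi>_adj_inner: "D\<pi>_adj x p b \<bullet> v = b \<bullet> (D\<pi> x v *v p)"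
proof -
  have "D\<pi>_adj x p b \<bullet> v = (\<Sum>s\<in>UNIV. \<Sum>i\<in>UNIV. \<Sum>j\<in>UNIV. b $ i * partial s i j x * p $ j * v $ s)"
    by (simp add: D\<pi>_adj_def inner_vec_def sum_distrib_right)
  also have "\<dots> = (\<Sum>i\<in>UNIV. \<Sum>s\<in>UNIV. \<Sum>j\<in>UNIV. b $ i * partial s i j x * p $ j * v $ s)" by (rule sum.swap)
  also have "\<dots> = (\<Sum>i\<in>UNIV. \<Sum>j\<in>UNIV. \<Sum>s\<in>UNIV. b $ i * partial s i j x * p $ j * v $ s)"
    by (intro sum.cong refl sum.swap)
  also have "\<dots> = b \<bullet> (D\<pi> x v *v p)"
    by (simp add: D\<pi>_def inner_vec_def matrix_vector_mult_def sum_distrib_left sum_distrib_right mult_ac)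
  finally show ?thesis .
qed

lemma skew_inner: "x \<in> M \<Longrightarrow> (\<pi> x *v u) \<bullet> w = - (u \<bullet> (\<pi> x *v w))"
proof -
  assume x: "x \<in> M"
  have "(\<pi> x *v u) \<bullet> w = (\<Sum>i\<in>UNIV. \<Sum>j\<in>UNIV. \<pi> x $ i $ j * u $ j * w $ i)"
    by (simp add: inner_vec_def matrix_vector_mult_def sum_distrib_right)
  also have "\<dots> = (\<Sum>j\<in>UNIV. \<Sum>i\<in>UNIV. \<pi> x $ i $ j * u $ j * w $ i)" by (rule sum.swap)
  also have "\<dots> = (\<Sum>j\<in>UNIV. \<Sum>i\<in>UNIV. - (u $ j * (\<pi> x $ j $ i * w $ i)))"
    by (intro sum.cong refl, subst skew[OF x]) simp
  also have "\<dots> = - (u \<bullet> (\<pi> x *v w))"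
    by (simp add: inner_vec_def matrix_vector_mult_def sum_distrib_left sum_negf)
  finally show ?thesis .
qed

lemma D\<pi>_diff: "D\<pi> x (u - v) = D\<pi> x u - D\<pi> x v"
  by (simp add: D\<pi>_def vec_eq_iff sum_subtractf algebra_simps)

text \<open>The curvature of the gauge action: it vanishes exactly for Poisson bivectors.\<close>

lemma jacobiator_identity:
  assumes x: "x \<in> M"
  shows "(D\<pi> x (\<pi> x *v p) *v b - D\<pi> x (\<pi> x *v b) *v p - \<pi> x *v D\<pi>_adj x p b) $ i
    = (\<Sum>m\<in>UNIV. \<Sum>j\<in>UNIV. p $ m * b $ j * jacobiator i j m x)"
proof -
  \<comment> \<open>Each of the three terms is brought to the summation order m, j, s and, by
    skewness of \<pi> or of its derivatives, to the index pattern of one summand of the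
    jacobiator.\<close>
  have 1: "(D\<pi> x (\<pi> x *v p) *v b) $ i = (\<Sum>m\<in>UNIV. \<Sum>j\<in>UNIV. \<Sum>s\<in>UNIV. p $ m * b $ j * (\<pi> x $ s $ m * partial s i j x))"
  proof -
    have "(D\<pi> x (\<pi> x *v p) *v b) $ i = (\<Sum>j\<in>UNIV. \<Sum>s\<in>UNIV. \<Sum>m\<in>UNIV. p $ m * b $ j * (\<pi> x $ s $ m * partial s i j x))"
      by (simp add: D\<pi>_def matrix_vector_mult_def sum_distrib_left sum_distrib_right mult_ac)
    also have "\<dots> = (\<Sum>j\<in>UNIV. \<Sum>m\<in>UNIV. \<Sum>s\<in>UNIV. p $ m * b $ j * (\<pi> x $ s $ m * partial s i j x))"
      by (intro sum.cong refl sum.swap)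
    also have "\<dots> = (\<Sum>m\<in>UNIV. \<Sum>j\<in>UNIV. \<Sum>s\<in>UNIV. p $ m * b $ j * (\<pi> x $ s $ m * partial s i j x))" by (rule sum.swap)
    finally show ?thesis .
  qed
  have 2: "(D\<pi> x (\<pi> x *v b) *v p) $ i = (\<Sum>m\<in>UNIV. \<Sum>j\<in>UNIV. \<Sum>s\<in>UNIV. - (p $ m * b $ j * (\<pi> x $ s $ j * partial s m i x)))"
  proof -
    have "(D\<pi> x (\<pi> x *v b) *v p) $ i = (\<Sum>m\<in>UNIV. \<Sum>s\<in>UNIV. \<Sum>j\<in>UNIV. p $ m * b $ j * (\<pi> x $ s $ j * partial s i m x))"
      by (simp add: D\<pi>_def matrix_vector_mult_def sum_distrib_left sum_distrib_right mult_ac)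
    also have "\<dots> = (\<Sum>m\<in>UNIV. \<Sum>j\<in>UNIV. \<Sum>s\<in>UNIV. p $ m * b $ j * (\<pi> x $ s $ j * partial s i m x))"
      by (intro sum.cong refl sum.swap)
    also have "\<dots> = (\<Sum>m\<in>UNIV. \<Sum>j\<in>UNIV. \<Sum>s\<in>UNIV. - (p $ m * b $ j * (\<pi> x $ s $ j * partial s m i x)))"
      using partial_skew[OF x, of _ i] by (intro sum.cong refl) simp
    finally show ?thesis .
  qed
  have 3: "(\<pi> x *v D\<pi>_adj x p b) $ i = (\<Sum>m\<in>UNIV. \<Sum>j\<in>UNIV. \<Sum>s\<in>UNIV. - (p $ m * b $ j * (\<pi> x $ s $ i * partial s j m x)))"
  proof -
    have "(\<pi> x *v D\<pi>_adj x p b) $ i = (\<Sum>s\<in>UNIV. \<Sum>j\<in>UNIV. \<Sum>m\<in>UNIV. p $ m * b $ j * (\<pi> x $ i $ s * partial s j m x))"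
      by (simp add: D\<pi>_adj_def matrix_vector_mult_def sum_distrib_left sum_distrib_right mult_ac)
    also have "\<dots> = (\<Sum>s\<in>UNIV. \<Sum>m\<in>UNIV. \<Sum>j\<in>UNIV. p $ m * b $ j * (\<pi> x $ i $ s * partial s j m x))"
      by (intro sum.cong refl sum.swap)
    also have "\<dots> = (\<Sum>m\<in>UNIV. \<Sum>s\<in>UNIV. \<Sum>j\<in>UNIV. p $ m * b $ j * (\<pi> x $ i $ s * partial s j m x))" by (rule sum.swap)
    also have "\<dots> = (\<Sum>m\<in>UNIV. \<Sum>j\<in>UNIV. \<Sum>s\<in>UNIV. p $ m * b $ j * (\<pi> x $ i $ s * partial s j m x))"
      by (intro sum.cong refl sum.swap)
    also have "\<dots> = (\<Sum>m\<in>UNIV. \<Sum>j\<in>UNIV. \<Sum>s\<in>UNIV. - (p $ m * b $ j * (\<pi> x $ s $ i * partial s j m x)))"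
      using skew[OF x, of i] by (intro sum.cong refl) simp
    finally show ?thesis .
  qed
  have "(\<Sum>m\<in>UNIV. \<Sum>j\<in>UNIV. p $ m * b $ j * jacobiator i j m x)
    = (\<Sum>m\<in>UNIV. \<Sum>j\<in>UNIV. \<Sum>s\<in>UNIV. p $ m * b $ j * (\<pi> x $ s $ m * partial s i j x))
     - (\<Sum>m\<in>UNIV. \<Sum>j\<in>UNIV. \<Sum>s\<in>UNIV. - (p $ m * b $ j * (\<pi> x $ s $ j * partial s m i x)))
     - (\<Sum>m\<in>UNIV. \<Sum>j\<in>UNIV. \<Sum>s\<in>UNIV. - (p $ m * b $ j * (\<pi> x $ s $ i * partial s j m x)))"
    by (simp only: jacobiator_def sum_subtractf[symmetric] sum_distrib_left) (intro sum.cong refl, simp add: algebra_simps)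
  then show ?thesis by (simp only: vector_minus_component 1 2 3)
qed

lemma biderivation_coord: "biderivation \<pi> (\<lambda>x. x $ i) (\<lambda>x. x $ j) = (\<lambda>x. \<pi> x $ i $ j)"
proof
  fix x
  have "frechet_derivative (\<lambda>x. x $ i) (at x) v = v $ i" for i and x v :: "real^'n"
    using frechet_derivative_at[OF bounded_linear_imp_has_derivative[OF bounded_linear_vec_nth[of i]], of x] by metis
  then show "biderivation \<pi> (\<lambda>x. x $ i) (\<lambda>x. x $ j) x = \<pi> x $ i $ j"
    by (simp add: biderivation_def axis_def if_distrib[of "\<lambda>z. _ * z"] if_distrib[of "\<lambda>z. z * _"] cong: if_cong)
qed

text \<open>Coordinate functions suffice: their brackets are the entries of \<pi>, so the Jacobi
  identity becomes a relation between the entries and their first derivatives.\<close>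

lemma poisson_jacobiator:
  assumes P: "poisson_bivector M \<pi>" and x: "x \<in> M"
  shows "jacobiator i j m x = 0"
proof -
  have sm: "smooth_on M (\<lambda>x. x $ i)" for i by (intro smooth_on_linear M bounded_linear_vec_nth)
  have fr: "frechet_derivative (\<lambda>x. x $ i) (at x) v = v $ i" for i and x v :: "real^'n"
    using frechet_derivative_at[OF bounded_linear_imp_has_derivative[OF bounded_linear_vec_nth[of i]], of x] by metis
  have B: "biderivation \<pi> (\<lambda>x. x $ k) (\<lambda>x. \<pi> x $ i $ j) x = - (\<Sum>s\<in>UNIV. \<pi> x $ s $ k * partial s i j x)" for i j k
  proof -
    have "biderivation \<pi> (\<lambda>x. x $ k) (\<lambda>x. \<pi> x $ i $ j) x = (\<Sum>s\<in>UNIV. \<pi> x $ k $ s * partial s i j x)"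
      by (simp add: biderivation_def fr partial_def axis_def if_distrib[of "\<lambda>z. _ * z"] if_distrib[of "\<lambda>z. z * _"] sum.delta cong: if_cong)
         (subst sum.swap, simp)
    also have "\<dots> = - (\<Sum>s\<in>UNIV. \<pi> x $ s $ k * partial s i j x)"
      unfolding sum_negf[symmetric] using skew[OF x, of k] by (intro sum.cong refl) simp
    finally show ?thesis .
  qed
  have "biderivation \<pi> (\<lambda>x. x $ m) (biderivation \<pi> (\<lambda>x. x $ i) (\<lambda>x. x $ j)) x
      + biderivation \<pi> (\<lambda>x. x $ i) (biderivation \<pi> (\<lambda>x. x $ j) (\<lambda>x. x $ m)) x
      + biderivation \<pi> (\<lambda>x. x $ j) (biderivation \<pi> (\<lambda>x. x $ m) (\<lambda>x. x $ i)) x = 0"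
    using P sm x unfolding poisson_bivector_def by blast
  then show ?thesis by (simp add: biderivation_coord B jacobiator_def sum.distrib algebra_simps)
qed

end

section \<open>Linear differential equations on an interval\<close>

lemma vector_derivative_unique_interval:
  assumes "(f has_vector_derivative x) (at t within {a..b})" "(f has_vector_derivative y) (at t within {a..b})"
    and "a < b" "t \<in> {a..b}"
  shows "x = y"
  using vector_derivative_within_cbox[of a b t f x, unfolded cbox_interval, OF assms(3,4,1)]
    vector_derivative_within_cbox[of a b t f y, unfolded cbox_interval, OF assms(3,4,2)] by simp

lemma linear_ode_interval:
  fixes L :: "real \<Rightarrow> 'a::euclidean_space \<Rightarrow> 'a"
  assumes L: "\<And>t. t \<in> {0..1} \<Longrightarrow> linear (L t)" "\<And>v. continuous_on {0..1} (\<lambda>t. L t v)" and h: "continuous_on {0..1} h"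
  obtains z where "z 0 = z0" "\<And>t. t \<in> {0..1} \<Longrightarrow> (z has_vector_derivative L t (z t) + h t) (at t within {0..1})"
proof -
  \<comment> \<open>The existence result with parameters is applied to a single dummy parameter
    value.\<close>
  let ?T = "{0::real}"
  have c: "continuous_on ({0..1} \<times> ?T) (\<lambda>(s, t). g s)" if "continuous_on {0..1} g" for g :: "real \<Rightarrow> 'c::topological_space"
    unfolding split_beta by (rule continuous_on_compose2[OF that]) (auto intro!: continuous_intros)
  obtain z where z: "continuous_on ({0..1} \<times> ?T) (\<lambda>(s, t). z s t)"
    "\<And>s t. s \<in> {0..1} \<Longrightarrow> t \<in> ?T \<Longrightarrow> z s t = z0 + integral {0..s} (\<lambda>r. to_blinfun (L r) (z r t) + h r)"
    using linear_ode_solution[of ?T 1 "\<lambda>s t. to_blinfun (L s)" "\<lambda>s t. h s" "\<lambda>_. z0",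
        OF _ c[OF to_blinfun_continuous[OF L(2)]] c[OF h]] by auto
  have g: "continuous_on ({0..1} \<times> ?T) (\<lambda>(s, t). to_blinfun (L s) (z s t) + h s)"
    using c[OF to_blinfun_continuous[OF L(2)]] c[OF h] z(1) unfolding split_beta
    by (intro continuous_intros)
  show ?thesis
  proof (rule that[of "\<lambda>s. z s 0"])
    show "z 0 0 = z0" using z(2)[of 0 0] by simp
    show "((\<lambda>s. z s 0) has_vector_derivative L t (z t 0) + h t) (at t within {0..1})" if "t \<in> {0..1}" for t
      using picard_derivative[OF g z(2) that, of 0] to_blinfun_apply[OF L(1)[OF that]] by simp
  qed
qed

lemma linear_ode_zero:
  fixes L :: "real \<Rightarrow> 'a::euclidean_space \<Rightarrow> 'a"
  assumes L: "\<And>t. t \<in> {0..e} \<Longrightarrow> linear (L t)" "\<And>v. continuous_on {0..e} (\<lambda>t. L t v)"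
    and z: "\<And>t. t \<in> {0..e} \<Longrightarrow> (z has_vector_derivative L t (z t)) (at t within {0..e})" "z 0 = 0" and t: "t \<in> {0..e}"
  shows "z t = 0"
proof -
  have "continuous_on {0..e} (\<lambda>s. to_blinfun (L s))" by (rule to_blinfun_continuous[OF L(2)])
  moreover have "(z has_vector_derivative to_blinfun (L s) (z s)) (at s within {0..e})" if "s \<in> {0..e}" for s
    using z(1)[OF that] to_blinfun_apply[OF L(1)[OF that]] by simp
  ultimately show ?thesis using z(2) t by (rule linear_ode_unique)
qed

section \<open>Smoothness of the anchor and its derivatives along curves\<close>

lemma smooth_family_Pair:
  assumes "smooth_family m S f" "smooth_family m S g"
  shows "smooth_family m S (\<lambda>s t. (f s t, g s t))"
proof -
  have 1: "bounded_linear (\<lambda>x. (x, 0 :: 'b))" and 2: "bounded_linear (\<lambda>x. (0 :: 'a, x))"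
    by (intro bounded_linear_Pair bounded_linear_ident bounded_linear_zero)+
  show ?thesis
    using smooth_family_add[OF smooth_family_linear[OF 1 assms(1)] smooth_family_linear[OF 2 assms(2)]] by simp
qed

lemma smooth_on_Pair:
  assumes "open M" "smooth_on M f" "smooth_on M g"
  shows "smooth_on M (\<lambda>x. (f x, g x))"
proof -
  have 1: "bounded_linear (\<lambda>x. (x, 0 :: 'c))" and 2: "bounded_linear (\<lambda>x. (0 :: 'b, x))"
    by (intro bounded_linear_Pair bounded_linear_ident bounded_linear_zero)+
  show ?thesis
    using smooth_on_add[OF assms(1) smooth_on_linear_image[OF assms(1) 1 assms(2)] smooth_on_linear_image[OF assms(1) 2 assms(3)]] by simp
qed

lemma vec_expand: "(\<chi> i. f i) = (\<Sum>i\<in>UNIV. f i *\<^sub>R axis i 1)" for f :: "'n::finite \<Rightarrow> real"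
  using basis_expansion[of "\<chi> i. f i"] by (simp add: scalar_mult_eq_scaleR)

lemma smooth_family_vec: "(\<And>i. smooth_family m S (\<lambda>s t. f s t i)) \<Longrightarrow> smooth_family m S (\<lambda>s t. (\<chi> i. f s t i) :: real^'n)"
  unfolding vec_expand by (intro smooth_family_sum smooth_family_linear[OF bounded_linear_scaleR_left])

lemma smooth_on_vec: "open M \<Longrightarrow> (\<And>i. smooth_on M (\<lambda>x. f x i)) \<Longrightarrow> smooth_on M (\<lambda>x. (\<chi> i. f x i) :: real^'n)"
  unfolding vec_expand by (intro smooth_on_sum smooth_on_linear_image[OF _ bounded_linear_scaleR_left])

context bivector
begin

lemma D\<pi>_mult: "D\<pi> x v *v b = (\<chi> i. \<Sum>j\<in>UNIV. (\<Sum>s\<in>UNIV. v $ s * partial s i j x) * b $ j)"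
  by (simp add: D\<pi>_def matrix_vector_mult_def)

lemma D\<pi>_linear: "linear (\<lambda>v. D\<pi> x v *v b)"
  by (rule linearI) (simp_all add: D\<pi>_mult vec_eq_iff sum.distrib sum_distrib_left sum_distrib_right algebra_simps)

lemma D\<pi>_adj_linear: "linear (\<lambda>b. D\<pi>_adj x p b)"
  by (rule linearI) (simp_all add: D\<pi>_adj_def vec_eq_iff sum.distrib sum_distrib_left algebra_simps)

lemma anchor_family:
  assumes m: "m \<in> {Free, Closed}" and q: "smooth_family m S q" "\<And>s t. s \<in> S \<Longrightarrow> t \<in> {0..1} \<Longrightarrow> q s t \<in> M"
    and b: "smooth_family m S b" and p: "smooth_family m S p"
  shows "smooth_family m S (\<lambda>s t. \<pi> (q s t) *v b s t)"
    and "smooth_family m S (\<lambda>s t. D\<pi> (q s t) (b s t) *v p s t)"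
    and "smooth_family m S (\<lambda>s t. D\<pi>_adj (q s t) (p s t) (b s t))"
proof -
  note e = smooth_family_compose[OF M m entry_smooth q] smooth_family_compose[OF M m partial_smooth q]
  note n = smooth_family_linear[OF bounded_linear_vec_nth b] smooth_family_linear[OF bounded_linear_vec_nth p]
  note mult = smooth_family_bilinear[OF bounded_bilinear_mult]
  show "smooth_family m S (\<lambda>s t. \<pi> (q s t) *v b s t)"
    unfolding matrix_vector_mult_def by (intro smooth_family_vec smooth_family_sum mult e n)
  show "smooth_family m S (\<lambda>s t. D\<pi> (q s t) (b s t) *v p s t)"
    unfolding D\<pi>_mult by (intro smooth_family_vec smooth_family_sum mult e n)
  show "smooth_family m S (\<lambda>s t. D\<pi>_adj (q s t) (p s t) (b s t))"
    unfolding D\<pi>_adj_def by (intro smooth_family_vec smooth_family_sum mult e n)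
qed

lemma anchor_continuous:
  assumes q: "continuous_on T q" "\<And>t. t \<in> T \<Longrightarrow> q t \<in> M" and b: "continuous_on T b" and p: "continuous_on T p"
  shows "continuous_on T (\<lambda>t. \<pi> (q t) *v b t)"
    and "continuous_on T (\<lambda>t. D\<pi> (q t) (b t) *v p t)"
    and "continuous_on T (\<lambda>t. D\<pi>_adj (q t) (p t) (b t))"
proof -
  have c: "continuous_on T (\<lambda>t. h (q t))" if "smooth_on M h" for h :: "real^'n \<Rightarrow> real"
    by (rule continuous_on_compose2[OF Ck_on_continuous[of 0] q(1)]) (use that q(2) in \<open>auto simp: smooth_on_def dest: spec[of _ 0]\<close>)
  note e = c[OF entry_smooth] c[OF partial_smooth]
  note n = bounded_linear.continuous_on[OF bounded_linear_vec_nth b] bounded_linear.continuous_on[OF bounded_linear_vec_nth p]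
  show "continuous_on T (\<lambda>t. \<pi> (q t) *v b t)"
    unfolding matrix_vector_mult_def by (intro continuous_on_vec_lambda continuous_on_sum continuous_on_mult e n)
  show "continuous_on T (\<lambda>t. D\<pi> (q t) (b t) *v p t)"
    unfolding D\<pi>_mult by (intro continuous_on_vec_lambda continuous_on_sum continuous_on_mult e n)
  show "continuous_on T (\<lambda>t. D\<pi>_adj (q t) (p t) (b t))"
    unfolding D\<pi>_adj_def by (intro continuous_on_vec_lambda continuous_on_sum continuous_on_mult e n)
qed

text \<open>Base point, covector and momentum enter as linear projections of one vector x. This
  yields smooth vector fields on a product space that has \<open>M\<close> as a factor, as the gauge
  flow requires.\<close>

lemma anchor_smooth:
  assumes W: "open W" "bounded_linear q" "q ` W \<subseteq> M" "bounded_linear b" "bounded_linear p"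
  shows "smooth_on W (\<lambda>x. \<pi> (q x) *v b x)"
    and "smooth_on W (\<lambda>x. D\<pi>_adj (q x) (p x) (b x))"
proof -
  note e = smooth_on_compose_linear[OF M W(1,3,2) entry_smooth] smooth_on_compose_linear[OF M W(1,3,2) partial_smooth]
  note n = smooth_on_linear[OF W(1) bounded_linear_compose[OF bounded_linear_vec_nth W(4)]]
    smooth_on_linear[OF W(1) bounded_linear_compose[OF bounded_linear_vec_nth W(5)]]
  note mult = smooth_on_bilinear[OF W(1) bounded_bilinear_mult]
  show "smooth_on W (\<lambda>x. \<pi> (q x) *v b x)"
    unfolding matrix_vector_mult_def by (intro smooth_on_vec smooth_on_sum W(1) mult e n)
  show "smooth_on W (\<lambda>x. D\<pi>_adj (q x) (p x) (b x))"
    unfolding D\<pi>_adj_def by (intro smooth_on_vec smooth_on_sum W(1) mult e n)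
qed

lemma cotangent_loopsD:
  assumes "(q, p) \<in> cotangent_loops M \<pi>"
  shows "(q, p) \<in> loops M" "smooth_closed q" "smooth_closed p" "smooth_curve q" "smooth_curve p"
    "\<And>t. t \<in> {0..1} \<Longrightarrow> q t \<in> M"
    "\<And>t. t \<in> {0..1} \<Longrightarrow> (q has_vector_derivative \<pi> (q t) *v p t) (at t within {0..1})"
  using assms by (auto simp: cotangent_loops_def loops_def cpaths_def smooth_closed_def)

section \<open>Gauge invariance of cotangent loops\<close>

text \<open>Each \<open>\<beta>\<close> generates a flow that acts pointwise in \<open>t\<close>. Along it the defect \<open>q' - \<pi> p\<close> of the
  cotangent equation solves a homogeneous linear equation because of the Jacobi identity.\<close>

lemma gauge_flow:
  assumes P: "poisson_bivector M \<pi>" and a: "(q, p) \<in> cotangent_loops M \<pi>" and \<beta>: "smooth_closed \<beta>"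
  obtains e Q R dQ dR where "e > 0" "smooth_family Closed {0..e} Q" "smooth_family Closed {0..e} R"
    "smooth_family Closed {0..e} dQ" "smooth_family Closed {0..e} dR"
    "\<And>k s t. s \<in> {0..e} \<Longrightarrow> t \<in> {0..1} \<Longrightarrow> ((\<lambda>s. nderiv k (Q s) t) has_vector_derivative nderiv k (dQ s) t) (at s within {0..e})"
    "\<And>k s t. s \<in> {0..e} \<Longrightarrow> t \<in> {0..1} \<Longrightarrow> ((\<lambda>s. nderiv k (R s) t) has_vector_derivative nderiv k (dR s) t) (at s within {0..e})"
    "\<And>t. t \<in> {0..1} \<Longrightarrow> Q 0 t = q t" "\<And>t. t \<in> {0..1} \<Longrightarrow> R 0 t = p t"
    "\<And>t. t \<in> {0..1} \<Longrightarrow> dQ 0 t = \<pi> (q t) *v \<beta> t"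
    "\<And>t. t \<in> {0..1} \<Longrightarrow> dR 0 t = nderiv 1 \<beta> t + D\<pi>_adj (q t) (p t) (\<beta> t)"
    "\<And>s. s \<in> {0..e} \<Longrightarrow> (Q s, R s) \<in> cotangent_loops M \<pi>"
proof -
  note aD = cotangent_loopsD[OF a]
  \<comment> \<open>The phase space of an autonomous field: besides q and p it carries \<beta> and
    \<beta>' as coordinates of velocity 0. Different values of t are then linked only through the
    initial data, although the gauge direction contains a t-derivative.\<close>
  define W where "W = M \<times> (UNIV :: ((real^'n) \<times> (real^'n) \<times> (real^'n)) set)"
  have W: "open W" using M by (simp add: W_def open_Times)
  define V where "V = (\<lambda>y :: (real^'n) \<times> (real^'n) \<times> (real^'n) \<times> (real^'n).
    (\<pi> (fst y) *v fst (snd (snd y)), snd (snd (snd y)) + D\<pi>_adj (fst y) (fst (snd y)) (fst (snd (snd y))), 0 :: real^'n, 0 :: real^'n))"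
  have bl: "bounded_linear (\<lambda>y :: (real^'n) \<times> (real^'n) \<times> (real^'n) \<times> (real^'n). fst (snd y))"
    "bounded_linear (\<lambda>y :: (real^'n) \<times> (real^'n) \<times> (real^'n) \<times> (real^'n). fst (snd (snd y)))"
    "bounded_linear (\<lambda>y :: (real^'n) \<times> (real^'n) \<times> (real^'n) \<times> (real^'n). snd (snd (snd y)))"
    by (intro bounded_linear_fst_comp bounded_linear_snd_comp bounded_linear_fst bounded_linear_snd)+
  have WM: "fst ` W \<subseteq> M" by (auto simp: W_def)
  have V: "smooth_on W V"
    unfolding V_def
    by (intro smooth_on_Pair smooth_on_add smooth_on_const W smooth_on_linear bl
        anchor_smooth[OF W bounded_linear_fst WM bl(2,1)])
  have fam: "smooth_family Closed {0} (\<lambda>_. u)" if "smooth_closed u" for u :: "real \<Rightarrow> real^'n"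
    using that by (simp add: smooth_ends_simps(2)[symmetric] smooth_ends_iff)
  define y0 where "y0 = (\<lambda>t. (q t, p t, \<beta> t, nderiv 1 \<beta> t))"
  have y0: "smooth_ends Closed y0"
    unfolding smooth_ends_iff y0_def
    by (intro smooth_family_Pair fam aD \<beta> smooth_family_nderiv[OF fam[OF \<beta>]])
  have y0W: "y0 t \<in> W" if "t \<in> {0..1}" for t using aD(6)[OF that] by (simp add: y0_def W_def)
  obtain e u where e: "e > 0" and u: "smooth_family Closed {0..e} u" "smooth_family Closed {0..e} (\<lambda>s t. V (u s t))"
    "\<And>s t. s \<in> {0..e} \<Longrightarrow> t \<in> {0..1} \<Longrightarrow> u s t \<in> W" "\<And>t. t \<in> {0..1} \<Longrightarrow> u 0 t = y0 t"
    and du: "\<And>k s t. s \<in> {0..e} \<Longrightarrow> t \<in> {0..1} \<Longrightarrow>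
      ((\<lambda>s. nderiv k (u s) t) has_vector_derivative nderiv k (\<lambda>t. V (u s t)) t) (at s within {0..e})"
    using smooth_flow[OF W V _ y0 y0W] by blast
  define Q where "Q = (\<lambda>s t. fst (u s t))"
  define R where "R = (\<lambda>s t. fst (snd (u s t)))"
  define dQ where "dQ = (\<lambda>s t. fst (V (u s t)))"
  define dR where "dR = (\<lambda>s t. fst (snd (V (u s t))))"
  have sQ: "smooth_family Closed {0..e} Q" and sdQ: "smooth_family Closed {0..e} dQ"
    unfolding Q_def dQ_def by (intro smooth_family_linear[OF bounded_linear_fst] u)+
  have sR: "smooth_family Closed {0..e} R" and sdR: "smooth_family Closed {0..e} dR"
    unfolding R_def dR_def by (intro smooth_family_linear[OF bl(1)] u)+
  have sm: "smooth_curve (u s)" "smooth_curve (\<lambda>t. V (u s t))" if "s \<in> {0..e}" for s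
    using smooth_family_member[OF u(1) that] smooth_family_member[OF u(2) that] by (auto simp: smooth_ends_def)
  have comp: "((\<lambda>s. nderiv k (\<lambda>t. L (u s t)) t) has_vector_derivative nderiv k (\<lambda>t. L (V (u s t))) t) (at s within {0..e})"
    if L: "bounded_linear L" and st: "s \<in> {0..e}" "t \<in> {0..1}" for k s t and L :: "_ \<Rightarrow> real^'n"
  proof -
    have "((\<lambda>s. L (nderiv k (u s) t)) has_vector_derivative L (nderiv k (\<lambda>t. V (u s t)) t)) (at s within {0..e})"
      by (rule bounded_linear.has_vector_derivative[OF L du[OF st]])
    from has_vector_derivative_transform[OF st(1) _ this, of "\<lambda>s. nderiv k (\<lambda>t. L (u s t)) t"]
    show ?thesis using nderiv_bounded_linear[OF L sm(1) st(2)] nderiv_bounded_linear[OF L sm(2)[OF st(1)] st(2)] by simp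
  qed
  have DQ: "((\<lambda>s. nderiv k (Q s) t) has_vector_derivative nderiv k (dQ s) t) (at s within {0..e})"
    and DR: "((\<lambda>s. nderiv k (R s) t) has_vector_derivative nderiv k (dR s) t) (at s within {0..e})"
    if "s \<in> {0..e}" "t \<in> {0..1}" for k s t
    using comp[OF bounded_linear_fst that, of k] comp[OF bl(1) that, of k] by (simp_all add: Q_def dQ_def R_def dR_def)
  have const: "fst (snd (snd (u s t))) = \<beta> t \<and> snd (snd (snd (u s t))) = nderiv 1 \<beta> t" if s: "s \<in> {0..e}" and t: "t \<in> {0..1}" for s t
  proof -
    have "((\<lambda>s. fst (snd (snd (u s t)))) has_vector_derivative 0) (at s within {0..e})"
      "((\<lambda>s. snd (snd (snd (u s t)))) has_vector_derivative 0) (at s within {0..e})" if "s \<in> {0..e}" for s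
      using comp[OF bl(2) that t, of 0] comp[OF bl(3) that t, of 0] by (simp_all add: V_def)
    then obtain c d where "\<And>s. s \<in> {0..e} \<Longrightarrow> fst (snd (snd (u s t))) = c" "\<And>s. s \<in> {0..e} \<Longrightarrow> snd (snd (snd (u s t))) = d"
      using has_vector_derivative_zero_constant[OF convex_closed_interval] by (metis (no_types, lifting) convex_real_interval(5))
    then show ?thesis using u(4)[OF t] s e by (metis (no_types, lifting) y0_def atLeastAtMost_iff fst_conv snd_conv less_imp_le order_refl)
  qed
  have dQeq: "dQ s t = \<pi> (Q s t) *v \<beta> t" and dReq: "dR s t = nderiv 1 \<beta> t + D\<pi>_adj (Q s t) (R s t) (\<beta> t)"
    if "s \<in> {0..e}" "t \<in> {0..1}" for s t
    using const[OF that] by (simp_all add: dQ_def dR_def V_def Q_def R_def)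
  have QM: "Q s t \<in> M" if "s \<in> {0..e}" "t \<in> {0..1}" for s t using u(3)[OF that] by (auto simp: Q_def W_def)
  have Q0: "Q 0 t = q t" and R0: "R 0 t = p t" if "t \<in> {0..1}" for t using u(4)[OF that] by (simp_all add: Q_def R_def y0_def)
  have e0: "0 \<in> {0..e}" using e by simp
  have eq: "nderiv 1 (Q s) t = \<pi> (Q s t) *v R s t" if s: "s \<in> {0..e}" and t: "t \<in> {0..1}" for s t
  proof -
    define c where "c = (\<lambda>s. nderiv 1 (Q s) t - \<pi> (Q s t) *v R s t)"
    have "c s = 0"
    proof (rule linear_ode_zero[where L = "\<lambda>s v. D\<pi> (Q s t) v *v \<beta> t" and z = c, OF D\<pi>_linear _ _ _ s])
      have cQ: "continuous_on {0..e} (\<lambda>s. Q s t)" by (rule continuous_on_slice1[OF smooth_family_continuous[OF sQ] t])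
      show "continuous_on {0..e} (\<lambda>s. D\<pi> (Q s t) v *v \<beta> t)" for v
        by (rule anchor_continuous(2)[OF cQ QM[OF _ t]]) (auto intro: continuous_on_const)
      show "c 0 = 0"
      proof -
        have "(Q 0 has_vector_derivative nderiv 1 (Q 0) t) (at t within {0..1})"
          using smooth_family_derivative[OF sQ e0 t, of 0] by simp
        moreover have "(Q 0 has_vector_derivative \<pi> (q t) *v p t) (at t within {0..1})"
          by (rule has_vector_derivative_transform[OF t Q0 aD(7)[OF t]])
        ultimately show ?thesis
          using vector_derivative_unique_interval[of "Q 0" _ t 0 1] t by (simp add: c_def Q0 R0)
      qed
      fix r assume r: "r \<in> {0..e}"
      let ?x = "Q r t"
      have x: "?x \<in> M" by (rule QM[OF r t])
      have "(dQ r has_vector_derivative nderiv 1 (dQ r) t) (at t within {0..1})"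
        using smooth_family_derivative[OF sdQ r t, of 0] by simp
      moreover have "(dQ r has_vector_derivative D\<pi> ?x (nderiv 1 (Q r) t) *v \<beta> t + \<pi> ?x *v nderiv 1 \<beta> t) (at t within {0..1})"
      proof (rule has_vector_derivative_transform[OF t dQeq[OF r]])
        have "(Q r has_vector_derivative nderiv 1 (Q r) t) (at t within {0..1})"
          using smooth_family_derivative[OF sQ r t, of 0] by simp
        moreover have "(\<beta> has_vector_derivative nderiv 1 \<beta> t) (at t within {0..1})"
          using smooth_curve_has_deriv[of \<beta> t 0] \<beta> t by (simp add: smooth_closed_def)
        ultimately show "((\<lambda>t. \<pi> (Q r t) *v \<beta> t) has_vector_derivative
            D\<pi> ?x (nderiv 1 (Q r) t) *v \<beta> t + \<pi> ?x *v nderiv 1 \<beta> t) (at t within {0..1})"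
          by (rule anchor_has_vector_derivative[where q = "Q r", OF _ x])
      qed
      ultimately have n1: "nderiv 1 (dQ r) t = D\<pi> ?x (nderiv 1 (Q r) t) *v \<beta> t + \<pi> ?x *v nderiv 1 \<beta> t"
        using vector_derivative_unique_interval[of "dQ r" _ t 0 1] t by simp
      have "((\<lambda>s. \<pi> (Q s t) *v R s t) has_vector_derivative D\<pi> ?x (dQ r t) *v R r t + \<pi> ?x *v dR r t) (at r within {0..e})"
        using DQ[OF r t, of 0] DR[OF r t, of 0] by (intro anchor_has_vector_derivative x) simp_all
      from has_vector_derivative_diff[OF DQ[OF r t, of 1] this]
      have "(c has_vector_derivative nderiv 1 (dQ r) t - (D\<pi> ?x (dQ r t) *v R r t + \<pi> ?x *v dR r t)) (at r within {0..e})"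
        unfolding c_def .
      \<comment> \<open>The contributions of \<beta>' from \<open>dQ\<close> and \<open>dR\<close>
        cancel. Writing the t-derivative of \<open>Q r\<close> as c + \<pi> p, the jacobiator
        identity removes every remaining term without c.\<close>
      also have "nderiv 1 (dQ r) t - (D\<pi> ?x (dQ r t) *v R r t + \<pi> ?x *v dR r t) = D\<pi> ?x (c r) *v \<beta> t"
      proof -
        have "D\<pi> ?x (\<pi> ?x *v R r t) *v \<beta> t - D\<pi> ?x (\<pi> ?x *v \<beta> t) *v R r t - \<pi> ?x *v D\<pi>_adj ?x (R r t) (\<beta> t) = 0"
          using jacobiator_identity[OF x] poisson_jacobiator[OF P x] by (simp add: vec_eq_iff)
        then show ?thesis
          unfolding n1 dQeq[OF r t] dReq[OF r t] c_def
          by (simp add: D\<pi>_diff matrix_vector_mult_diff_rdistrib matrix_vector_right_distrib algebra_simps)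
      qed
      finally show "(c has_vector_derivative D\<pi> ?x (c r) *v \<beta> t) (at r within {0..e})" .
    qed
    then show ?thesis by (simp add: c_def)
  qed
  show ?thesis
  proof (rule that[OF e sQ sR sdQ sdR DQ DR Q0 R0])
    show "dQ 0 t = \<pi> (q t) *v \<beta> t" if "t \<in> {0..1}" for t using dQeq[OF e0 that] Q0[OF that] by simp
    show "dR 0 t = nderiv 1 \<beta> t + D\<pi>_adj (q t) (p t) (\<beta> t)" if "t \<in> {0..1}" for t
      using dReq[OF e0 that] Q0[OF that] R0[OF that] by simp
    fix s assume s: "s \<in> {0..e}"
    have "smooth_closed (Q s)" "smooth_closed (R s)"
      using smooth_family_member[OF sQ s] smooth_family_member[OF sR s] by (simp_all add: smooth_ends_simps)
    moreover have "(Q s has_vector_derivative \<pi> (Q s t) *v R s t) (at t within {0..1})" if "t \<in> {0..1}" for t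
      using smooth_family_derivative[OF sQ s that, of 0] eq[OF s that] by simp
    ultimately show "(Q s, R s) \<in> cotangent_loops M \<pi>"
      using QM[OF s] by (auto simp: cotangent_loops_def loops_def cpaths_def smooth_closed_def)
  qed assumption+
qed


section \<open>Gradients of local functions that vanish on cotangent loops\<close>

context
  fixes F f and N :: nat and q p A B
  assumes P: "poisson_bivector M \<pi>" and a: "(q, p) \<in> cotangent_loops M \<pi>"
    and f: "coord_smooth_on (jet_domain M) f" "depends_only_on (jet_coords N N) (jet_domain M) f"
    and rep: "\<And>a. a \<in> loops M \<Longrightarrow> F a = integral {0..1} (\<lambda>t. f (jet_at a t))"
    and vanish: "\<And>a. a \<in> cotangent_loops M \<pi> \<Longrightarrow> F a = 0"
    and AB: "has_gradient F (q, p) (A, B)"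
begin

lemma matrix_vector_mult_minus: "X *v (- v) = - (X *v v)" for X :: "real^'k^'l"
  using matrix_vector_mult_scaleR[of X "- 1" v] by simp

text \<open>The flow is not an affine perturbation, so \<open>has_gradient\<close> does not apply to
  it directly. Its derivative and that of the affine perturbation both equal the first variation in
  the tangent vector \<open>(dQ 0, dR 0)\<close>, and the former is 0 because F vanishes along the
  flow. The right derivative at s = 0 is enough for this.\<close>

lemma gauge_variation:
  assumes \<beta>: "smooth_closed \<beta>"
  shows "integral {0..1} (\<lambda>t. A t \<bullet> (\<pi> (q t) *v \<beta> t))
    + integral {0..1} (\<lambda>t. B t \<bullet> (nderiv 1 \<beta> t + D\<pi>_adj (q t) (p t) (\<beta> t))) = 0"
proof -
  note aD = cotangent_loopsD[OF a]
  obtain e Q R dQ dR where e: "e > 0" and fam: "smooth_family Closed {0..e} Q" "smooth_family Closed {0..e} R"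
    "smooth_family Closed {0..e} dQ" "smooth_family Closed {0..e} dR"
    and DQ: "\<And>k s t. s \<in> {0..e} \<Longrightarrow> t \<in> {0..1} \<Longrightarrow> ((\<lambda>s. nderiv k (Q s) t) has_vector_derivative nderiv k (dQ s) t) (at s within {0..e})"
    and DR: "\<And>k s t. s \<in> {0..e} \<Longrightarrow> t \<in> {0..1} \<Longrightarrow> ((\<lambda>s. nderiv k (R s) t) has_vector_derivative nderiv k (dR s) t) (at s within {0..e})"
    and Q0: "\<And>t. t \<in> {0..1} \<Longrightarrow> Q 0 t = q t" and R0: "\<And>t. t \<in> {0..1} \<Longrightarrow> R 0 t = p t"
    and dQ0: "\<And>t. t \<in> {0..1} \<Longrightarrow> dQ 0 t = \<pi> (q t) *v \<beta> t"
    and dR0: "\<And>t. t \<in> {0..1} \<Longrightarrow> dR 0 t = nderiv 1 \<beta> t + D\<pi>_adj (q t) (p t) (\<beta> t)"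
    and C: "\<And>s. s \<in> {0..e} \<Longrightarrow> (Q s, R s) \<in> cotangent_loops M \<pi>"
    using gauge_flow[OF P a \<beta>] by blast
  have e0: "0 \<in> {0..e}" using e by simp
  have cl: "smooth_closed (dQ 0)" "smooth_closed (dR 0)"
    using smooth_family_member[OF fam(3) e0] smooth_family_member[OF fam(4) e0] by (simp_all add: smooth_ends_simps)
  let ?x = "\<lambda>s t. jet_at (Q s, R s) t" and ?y = "\<lambda>c s t. variation_jet (dQ s, dR s) t c"
  have nth: "continuous_on ({0..e} \<times> {0..1}) (\<lambda>(s, t). nderiv k (X s) t $ i)"
    if "smooth_family Closed {0..e} X" for X :: "real \<Rightarrow> real \<Rightarrow> real^'n" and k i
    using bounded_linear.continuous_on[OF bounded_linear_vec_nth smooth_family_nderiv_continuous[OF that, of k]]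
    by (simp add: split_beta)
  have "((\<lambda>s. integral {0..1} (\<lambda>t. f (?x s t))) has_real_derivative
      integral {0..1} (\<lambda>t. \<Sum>c\<in>jet_coords N N. coord_deriv (jet_domain M) c f (?x 0 t) * ?y c 0 t)) (at 0 within {0..e})"
  proof (rule action_has_derivative[OF M f(1) finite_jet_coords f(2) _ e0])
    show "convex {0..e}" by simp
    show "jet_at (Q s, R s) t \<in> jet_domain M" if "s \<in> {0..e}" "t \<in> {0..1}" for s t
      using cotangent_loopsD(1)[OF C[OF that(1)]] that(2) by (intro jet_at_domain loops_cpaths)
    show "continuous_on ({0..e} \<times> {0..1}) (\<lambda>(s, t). jet_at (Q s, R s) t c)" for c
      using nth[OF fam(1)] nth[OF fam(2)]
      by (cases c) (auto simp: split_beta simp del: nderiv.simps intro!: continuous_intros)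
    show "continuous_on ({0..e} \<times> {0..1}) (\<lambda>(s, t). variation_jet (dQ s, dR s) t c)" for c
      using nth[OF fam(3)] nth[OF fam(4)]
      by (cases c) (auto simp: variation_jet_def split_beta simp del: nderiv.simps intro!: continuous_intros)
    show "((\<lambda>s. jet_at (Q s, R s) t c) has_vector_derivative variation_jet (dQ s, dR s) t c) (at s within {0..e})"
      if "s \<in> {0..e}" "t \<in> {0..1}" for c s t
      using bounded_linear.has_vector_derivative[OF bounded_linear_vec_nth DQ[OF that]]
        bounded_linear.has_vector_derivative[OF bounded_linear_vec_nth DR[OF that]]
      by (cases c) (auto simp: variation_jet_def simp del: nderiv.simps)
  qed
  then have D: "((\<lambda>s. integral {0..1} (\<lambda>t. f (?x s t))) has_vector_derivative
      integral {0..1} (\<lambda>t. \<Sum>c\<in>jet_coords N N. coord_deriv (jet_domain M) c f (?x 0 t) * ?y c 0 t)) (at 0 within {0..e})"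
    by (simp add: has_real_derivative_iff_has_vector_derivative)
  have zero: "integral {0..1} (\<lambda>t. f (?x s t)) = 0" if "s \<in> {0..e}" for s
    using rep[OF cotangent_loopsD(1)[OF C[OF that]]] vanish[OF C[OF that]] by simp
  have "((\<lambda>s. integral {0..1} (\<lambda>t. f (?x s t))) has_vector_derivative 0) (at 0 within {0..e})"
    by (rule has_vector_derivative_transform[OF e0 zero has_vector_derivative_const])
  then have zero_deriv: "integral {0..1} (\<lambda>t. \<Sum>c\<in>jet_coords N N. coord_deriv (jet_domain M) c f (?x 0 t) * ?y c 0 t) = 0"
    by (rule vector_derivative_unique_interval[OF D _ e e0])
  \<comment> \<open>\<open>Q 0\<close> and \<open>R 0\<close> agree with q and p on [0,1] only; the
    derivatives in the jets are taken within that interval, so the jets agree there.\<close>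
  have jet0: "?x 0 t = jet_at (q, p) t" if t: "t \<in> {0..1}" for t
  proof
    fix c
    have "nderiv k (Q 0) t = nderiv k q t" "nderiv k (R 0) t = nderiv k p t" for k
      by (rule nderiv_cong[OF aD(4) Q0 t], assumption, rule nderiv_cong[OF aD(5) R0 t], assumption)
    then show "?x 0 t c = jet_at (q, p) t c"
      by (cases c) (simp_all only: jet_at.simps)
  qed
  have "integral {0..1} (\<lambda>t. \<Sum>c\<in>jet_coords N N. coord_deriv (jet_domain M) c f (jet_at (q, p) t) * ?y c 0 t)
      = integral {0..1} (\<lambda>t. \<Sum>c\<in>jet_coords N N. coord_deriv (jet_domain M) c f (?x 0 t) * ?y c 0 t)"
    by (rule integral_cong) (simp only: jet0)
  then have "integral {0..1} (\<lambda>t. A t \<bullet> dQ 0 t) + integral {0..1} (\<lambda>t. B t \<bullet> dR 0 t) = 0"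
    using gradient_pairing[OF M f rep aD(1) AB cl] zero_deriv by simp
  moreover have "integral {0..1} (\<lambda>t. A t \<bullet> dQ 0 t) = integral {0..1} (\<lambda>t. A t \<bullet> (\<pi> (q t) *v \<beta> t))"
    by (rule integral_cong) (simp add: dQ0)
  moreover have "integral {0..1} (\<lambda>t. B t \<bullet> dR 0 t) = integral {0..1} (\<lambda>t. B t \<bullet> (nderiv 1 \<beta> t + D\<pi>_adj (q t) (p t) (\<beta> t)))"
    by (rule integral_cong) (simp only: dR0)
  ultimately show ?thesis by simp
qed

lemma gradient_closed: "smooth_closed A" "smooth_closed B" "smooth_curve A" "smooth_curve B"
  "continuous_on {0..1} A" "continuous_on {0..1} B"
  using AB by (auto simp: has_gradient_def smooth_closed_def intro: smooth_curve_continuous)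

text \<open>Testing gauge invariance against the residual of this equation shows that the residual vanishes.\<close>

lemma gradient_tangent:
  assumes t: "t \<in> {0..1}"
  shows "(B has_vector_derivative D\<pi> (q t) (B t) *v p t - \<pi> (q t) *v A t) (at t within {0..1})"
proof -
  note aD = cotangent_loopsD[OF a]
  have dB: "(B has_vector_derivative nderiv 1 B t) (at t within {0..1})" if "t \<in> {0..1}" for t
    using smooth_curve_has_deriv[OF gradient_closed(4) that, of 0] by simp
  \<comment> \<open>The residual of the claimed equation. It is built from closed curves, hence is
    itself an admissible \<beta>.\<close>
  define W where "W = (\<lambda>t. D\<pi> (q t) (B t) *v p t + ((- 1) *\<^sub>R (\<pi> (q t) *v A t) + (- 1) *\<^sub>R nderiv 1 B t))"
  have fam: "smooth_family Closed {0} (\<lambda>_. u)" if "smooth_closed u" for u :: "real \<Rightarrow> real^'n"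
    using that by (simp add: smooth_ends_simps(2)[symmetric] smooth_ends_iff)
  have "smooth_family Closed {0} (\<lambda>_. W)"
    unfolding W_def
    by (intro smooth_family_add smooth_family_linear[OF bounded_linear_scaleR_right] smooth_family_nderiv[OF fam]
        anchor_family(1)[OF _ fam[OF aD(2)] aD(6) fam[OF gradient_closed(1)] fam[OF gradient_closed(1)]]
        anchor_family(2)[OF _ fam[OF aD(2)] aD(6) fam[OF gradient_closed(2)] fam[OF aD(3)]] gradient_closed) auto
  then have clW: "smooth_closed W" by (simp add: smooth_ends_simps(2)[symmetric] smooth_ends_iff)
  then have smW: "smooth_curve W" and W01: "W 0 = W 1" by (auto simp: smooth_closed_def dest: spec[of _ 0])
  have dW: "(W has_vector_derivative nderiv 1 W t) (at t within {0..1})" if "t \<in> {0..1}" for t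
    using smooth_curve_has_deriv[OF smW that, of 0] by simp
  have B01: "B 0 = B 1" using gradient_closed(2) by (auto simp: smooth_closed_def dest: spec[of _ 0])
  note cont = smooth_curve_continuous[OF aD(4)] smooth_curve_continuous[OF aD(5)] smooth_curve_continuous[OF smW]
    smooth_curve_nderiv_continuous[OF smW] smooth_curve_nderiv_continuous[OF gradient_closed(4)] gradient_closed(5,6)
  note bc = anchor_continuous[OF cont(1) aD(6)]
  have parts: "integral {0..1} (\<lambda>t. B t \<bullet> nderiv 1 W t) = - integral {0..1} (\<lambda>t. nderiv 1 B t \<bullet> W t)"
    by (rule integration_by_parts_inner[OF dB cont(5) dW cont(4)]) (simp_all add: B01 W01)
  have "integral {0..1} (\<lambda>t. A t \<bullet> (\<pi> (q t) *v W t)) = integral {0..1} (\<lambda>t. - (\<pi> (q t) *v A t) \<bullet> W t)"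
    by (rule integral_cong) (use skew_inner[OF aD(6)] in simp)
  moreover have "integral {0..1} (\<lambda>t. B t \<bullet> (nderiv 1 W t + D\<pi>_adj (q t) (p t) (W t)))
      = integral {0..1} (\<lambda>t. B t \<bullet> nderiv 1 W t) + integral {0..1} (\<lambda>t. B t \<bullet> D\<pi>_adj (q t) (p t) (W t))"
    unfolding inner_add_right
    by (intro integral_add integrable_continuous_real continuous_on_inner cont bc(3))
  moreover have "integral {0..1} (\<lambda>t. B t \<bullet> D\<pi>_adj (q t) (p t) (W t)) = integral {0..1} (\<lambda>t. (D\<pi> (q t) (B t) *v p t) \<bullet> W t)"
    by (rule integral_cong) (metis D\<pi>_adj_inner inner_commute)
  ultimately have "integral {0..1} (\<lambda>t. - (\<pi> (q t) *v A t) \<bullet> W t) + (- integral {0..1} (\<lambda>t. nderiv 1 B t \<bullet> W t)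
      + integral {0..1} (\<lambda>t. (D\<pi> (q t) (B t) *v p t) \<bullet> W t)) = 0"
    using gauge_variation[OF clW] parts by simp
  \<comment> \<open>Moving \<pi> and D\<pi> off W by skewness and adjointness, and integrating the
    derivative of W by parts, turns gauge invariance for \<beta> = W into the vanishing of the
    integral of the squared residual.\<close>
  moreover have "integral {0..1} (\<lambda>t. W t \<bullet> W t) = integral {0..1} (\<lambda>t. - (\<pi> (q t) *v A t) \<bullet> W t) + (- integral {0..1} (\<lambda>t. nderiv 1 B t \<bullet> W t)
      + integral {0..1} (\<lambda>t. (D\<pi> (q t) (B t) *v p t) \<bullet> W t))"
  proof -
    have i: "(\<lambda>t. - (\<pi> (q t) *v A t) \<bullet> W t) integrable_on {0..1}" "(\<lambda>t. nderiv 1 B t \<bullet> W t) integrable_on {0..1}"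
      "(\<lambda>t. (D\<pi> (q t) (B t) *v p t) \<bullet> W t) integrable_on {0..1}"
      using bc(1)[OF _ cont(6,6)] bc(2)[OF _ cont(7,2)]
      by (auto intro!: integrable_continuous_real continuous_on_inner continuous_on_minus cont simp del: nderiv.simps)
    have "((\<lambda>t. - (\<pi> (q t) *v A t) \<bullet> W t + (- (nderiv 1 B t \<bullet> W t) + (D\<pi> (q t) (B t) *v p t) \<bullet> W t)) has_integral
      integral {0..1} (\<lambda>t. - (\<pi> (q t) *v A t) \<bullet> W t) + (- integral {0..1} (\<lambda>t. nderiv 1 B t \<bullet> W t)
      + integral {0..1} (\<lambda>t. (D\<pi> (q t) (B t) *v p t) \<bullet> W t))) {0..1}"
      by (intro has_integral_add has_integral_neg integrable_integral i)
    moreover have "- (\<pi> (q t) *v A t) \<bullet> W t + (- (nderiv 1 B t \<bullet> W t) + (D\<pi> (q t) (B t) *v p t) \<bullet> W t) = W t \<bullet> W t" for t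
    proof -
      have "W t \<bullet> w = - (\<pi> (q t) *v A t) \<bullet> w + (- (nderiv 1 B t \<bullet> w) + (D\<pi> (q t) (B t) *v p t) \<bullet> w)" for w
        by (simp add: W_def inner_add_left algebra_simps del: nderiv.simps)
      then show ?thesis by simp
    qed
    ultimately show ?thesis by (simp add: integral_unique)
  qed
  ultimately have "integral {0..1} (\<lambda>t. W t \<bullet> W t) = 0" by simp
  from L2_zero_imp_zero[OF smW this t] have "nderiv 1 B t = D\<pi> (q t) (B t) *v p t - \<pi> (q t) *v A t"
    by (simp add: W_def algebra_simps del: nderiv.simps)
  then show ?thesis using dB[OF t] by simp
qed

text \<open>A covector in the kernel of \<open>\<pi>\<close> is transported along the loop inside the kernel, and
  adding such covectors to \<open>p\<close> stays in the set of cotangent loops.\<close>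

lemma gradient_momentum_range:
  obtains \<xi> where "B 0 = \<pi> (q 0) *v \<xi>"
proof -
  note aD = cotangent_loopsD[OF a]
  note cont = smooth_curve_continuous[OF aD(4)] smooth_curve_continuous[OF aD(5)]
  note bc = anchor_continuous[OF cont(1) aD(6)]
  \<comment> \<open>Orthogonality of \<open>B 0\<close> to the kernel is enough, because the range
    of a skew matrix is the orthogonal complement of its kernel.\<close>
  have ker: "B 0 \<bullet> \<xi> = 0" if \<xi>: "\<pi> (q 0) *v \<xi> = 0" for \<xi>
  proof -
    have Llin: "linear (\<lambda>v. - D\<pi>_adj (q t) (p t) v)" for t
      using D\<pi>_adj_linear[of "q t" "p t"] by (intro linear_compose_neg)
    have Lc: "continuous_on {0..1} (\<lambda>t. - D\<pi>_adj (q t) (p t) v)" for v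
      by (intro continuous_on_minus bc(3) continuous_on_const cont(2))
    \<comment> \<open>The transport equation makes the momentum part of the gauge direction of
      \<gamma> vanish. By the jacobiator identity, \<pi> \<gamma> then solves a homogeneous linear
      equation and stays 0.\<close>
    obtain \<gamma> where \<gamma>0: "\<gamma> 0 = \<xi>" and d\<gamma>': "\<And>t. t \<in> {0..1} \<Longrightarrow> (\<gamma> has_vector_derivative - D\<pi>_adj (q t) (p t) (\<gamma> t) + 0) (at t within {0..1})"
      using linear_ode_interval[OF Llin Lc continuous_on_const, of \<xi> 0] by metis
    have d\<gamma>: "(\<gamma> has_vector_derivative - D\<pi>_adj (q t) (p t) (\<gamma> t)) (at t within {0..1})" if "t \<in> {0..1}" for t
      using d\<gamma>'[OF that] by simp
    \<comment> \<open>Smoothness gains one order at a time, the derivative of \<gamma> being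
      expressed through \<gamma> and smooth coefficients. It is required for \<phi> * \<gamma> to be
      a tangent vector.\<close>
    have sm\<gamma>: "smooth_curve \<gamma>"
    proof -
      have "Ck_family Free {0} k (\<lambda>_. \<gamma>)" for k
      proof (induction k)
        case 0
        have "continuous_on {0..1} \<gamma>"
          using d\<gamma> by (meson continuous_on_eq_continuous_within has_vector_derivative_continuous)
        from continuous_on_compose2[OF this continuous_on_snd[OF continuous_on_id], of "{0} \<times> {0..1}"] show ?case
          by (auto simp: split_beta)
      next
        case (Suc k)
        have fam: "Ck_family Free {0} k (\<lambda>_. u)" if "smooth_curve u" for u :: "real \<Rightarrow> real^'n"
          using that unfolding smooth_ends_simps(1)[symmetric] smooth_ends_iff smooth_family_def by blast
        have pe: "Ck_on k M (partial s i j)" for s i j using partial_smooth by (simp add: smooth_on_def)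
        have vec: "Ck_family Free {0} k (\<lambda>s t. (\<chi> i. h s t i) :: real^'n)" if "\<And>i. Ck_family Free {0} k (\<lambda>s t. h s t i)" for h
          unfolding vec_expand by (intro Ck_family_sum Ck_family_linear[OF bounded_linear_scaleR_left] that)
        have "Ck_family Free {0} k (\<lambda>s t. partial l i j (q t))" for l i j
          by (rule Ck_family_compose[OF M _ pe fam[OF aD(4)]]) (use aD(6) in auto)
        then have "Ck_family Free {0} k (\<lambda>s t. - 1 *\<^sub>R D\<pi>_adj (q t) (p t) (\<gamma> t))"
          unfolding D\<pi>_adj_def
          by (intro Ck_family_linear[OF bounded_linear_scaleR_right] vec Ck_family_sum Ck_family_bilinear[OF bounded_bilinear_mult disjI1[OF refl]]
              Ck_family_linear[OF bounded_linear_vec_nth] Suc fam aD)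
        from Ck_family_SucI[OF Suc this] show ?case using d\<gamma> by simp
      qed
      then show ?thesis by (simp add: smooth_ends_simps(1)[symmetric] smooth_ends_iff smooth_family_def)
    qed
    have \<pi>\<gamma>: "\<pi> (q t) *v \<gamma> t = 0" if t: "t \<in> {0..1}" for t
    proof (rule linear_ode_zero[where L = "\<lambda>t v. D\<pi> (q t) v *v p t" and z = "\<lambda>t. \<pi> (q t) *v \<gamma> t", OF D\<pi>_linear _ _ _ t])
      show "continuous_on {0..1} (\<lambda>t. D\<pi> (q t) v *v p t)" for v
        by (intro bc(2) continuous_on_const cont(2))
      show "\<pi> (q 0) *v \<gamma> 0 = 0" using \<gamma>0 \<xi> by simp
      fix t :: real assume t: "t \<in> {0..1}"
      have "D\<pi> (q t) (\<pi> (q t) *v p t) *v \<gamma> t - D\<pi> (q t) (\<pi> (q t) *v \<gamma> t) *v p t - \<pi> (q t) *v D\<pi>_adj (q t) (p t) (\<gamma> t) = 0"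
        using jacobiator_identity[OF aD(6)[OF t]] poisson_jacobiator[OF P aD(6)[OF t]] by (simp add: vec_eq_iff)
      then have "D\<pi> (q t) (\<pi> (q t) *v p t) *v \<gamma> t + \<pi> (q t) *v (- D\<pi>_adj (q t) (p t) (\<gamma> t)) = D\<pi> (q t) (\<pi> (q t) *v \<gamma> t) *v p t"
        by (simp add: matrix_vector_mult_minus algebra_simps)
      then show "((\<lambda>t. \<pi> (q t) *v \<gamma> t) has_vector_derivative D\<pi> (q t) (\<pi> (q t) *v \<gamma> t) *v p t) (at t within {0..1})"
        using anchor_has_vector_derivative[where q = q, OF aD(7)[OF t] aD(6)[OF t] d\<gamma>[OF t]] by simp
    qed
    have "(\<lambda>t. B t \<bullet> \<gamma> t) 0 = 0"
    proof (rule fundamental_lemma[where u = "\<lambda>t. B t \<bullet> \<gamma> t" and t = 0])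
      show "smooth_curve (\<lambda>t. B t \<bullet> \<gamma> t)"
        using gradient_closed(4) sm\<gamma> smooth_family_bilinear[OF bounded_bilinear_inner, of Free "{0}" "\<lambda>_. B" "\<lambda>_. \<gamma>"]
        unfolding smooth_ends_simps(1)[symmetric] smooth_ends_iff by blast
      fix \<phi> :: "real \<Rightarrow> real" assume \<phi>: "smooth_ends Flat \<phi>"
      \<comment> \<open>\<gamma> has no reason to be periodic; the flat factor makes \<phi> *
        \<gamma> closed. Adding its multiples to p keeps q and \<pi> p fixed, so the loop remains
        cotangent, and the shift is affine in \<epsilon>, so the gradient applies to it
        directly.\<close>
      have fl: "smooth_ends Flat (\<lambda>t. \<phi> t *\<^sub>R \<gamma> t)" by (rule smooth_ends_Flat_product[OF \<phi> sm\<gamma>])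
      then have cl: "smooth_closed (\<lambda>t. \<phi> t *\<^sub>R \<gamma> t)"
        by (auto simp: smooth_ends_def smooth_closed_def)
      have "(\<lambda>t. q t + \<epsilon> *\<^sub>R 0, \<lambda>t. p t + \<epsilon> *\<^sub>R (\<phi> t *\<^sub>R \<gamma> t)) \<in> cotangent_loops M \<pi>" for \<epsilon>
      proof -
        have "smooth_family Closed {0} (\<lambda>_ t. p t + \<epsilon> *\<^sub>R (\<phi> t *\<^sub>R \<gamma> t))"
          using aD(3) cl unfolding smooth_ends_simps(2)[symmetric] smooth_ends_iff
          by (intro smooth_family_add smooth_family_linear[OF bounded_linear_scaleR_right])
        then have "smooth_closed (\<lambda>t. p t + \<epsilon> *\<^sub>R (\<phi> t *\<^sub>R \<gamma> t))"
          by (simp add: smooth_ends_simps(2)[symmetric] smooth_ends_iff)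
        moreover have "\<pi> (q t) *v (p t + \<epsilon> *\<^sub>R (\<phi> t *\<^sub>R \<gamma> t)) = \<pi> (q t) *v p t" if "t \<in> {0..1}" for t
          using \<pi>\<gamma>[OF that] by (simp add: matrix_vector_right_distrib matrix_vector_mult_scaleR)
        ultimately show ?thesis using aD by (auto simp: cotangent_loops_def loops_def cpaths_def smooth_closed_def)
      qed
      then have "F (\<lambda>t. q t + \<epsilon> *\<^sub>R 0, \<lambda>t. p t + \<epsilon> *\<^sub>R (\<phi> t *\<^sub>R \<gamma> t)) = 0" for \<epsilon> by (rule vanish)
      then have "((\<lambda>\<epsilon>. 0) has_real_derivative integral {0..1} (\<lambda>t. A t \<bullet> 0) + integral {0..1} (\<lambda>t. B t \<bullet> (\<phi> t *\<^sub>R \<gamma> t))) (at (0::real))"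
        using AB cl smooth_closed_zero[where 'a = "real^'n"] unfolding has_gradient_def by fastforce
      from DERIV_unique[OF this DERIV_const] show "integral {0..1} (\<lambda>t. B t \<bullet> \<gamma> t * \<phi> t) = 0"
        by (simp add: mult.commute)
    qed simp
    then show ?thesis using \<gamma>0 by simp
  qed
  have q0: "q 0 \<in> M" by (rule aD(6)) simp
  let ?S = "range ((*v) (\<pi> (q 0)))"
  have "subspace ?S" by (intro linear_subspace_image matrix_vector_mul_linear subspace_UNIV)
  then have span: "span ?S = ?S" by (simp add: span_eq_iff)
  obtain y z where y: "y \<in> ?S" and z: "\<And>w. w \<in> ?S \<Longrightarrow> orthogonal z w" and B: "B 0 = y + z"
    using orthogonal_subspace_decomp_exists[of ?S "B 0"] unfolding span by metis
  \<comment> \<open>The part z of \<open>B 0\<close> orthogonal to the range lies in the kernel by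
    skewness. Then \<open>B 0\<close> is orthogonal to z, so z is orthogonal to itself.\<close>
  have "\<pi> (q 0) *v z = 0"
  proof -
    have "(\<pi> (q 0) *v z) \<bullet> (\<pi> (q 0) *v z) = - (z \<bullet> (\<pi> (q 0) *v (\<pi> (q 0) *v z)))" by (rule skew_inner[OF q0])
    also have "\<dots> = 0" using z[of "\<pi> (q 0) *v (\<pi> (q 0) *v z)"] by (simp add: orthogonal_def)
    finally show ?thesis by simp
  qed
  then have "B 0 \<bullet> z = 0" by (rule ker)
  moreover have "y \<bullet> z = 0" using z[OF y] by (simp add: orthogonal_def inner_commute)
  ultimately have "z = 0" by (simp add: B inner_add_left)
  then show ?thesis using that y B by auto
qed

text \<open>The equation for \<alpha> is chosen so that, by the jacobiator identity, \<pi> \<alpha>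
  satisfies the same inhomogeneous linear equation as B in \<open>gradient_tangent\<close>. The
  difference solves the homogeneous equation with initial value 0.\<close>

lemma gradient_potential:
  obtains \<alpha> where "\<And>t. t \<in> {0..1} \<Longrightarrow> (\<alpha> has_vector_derivative - D\<pi>_adj (q t) (p t) (\<alpha> t) - A t) (at t within {0..1})"
    "\<And>t. t \<in> {0..1} \<Longrightarrow> B t = \<pi> (q t) *v \<alpha> t"
proof -
  note aD = cotangent_loopsD[OF a]
  note cont = smooth_curve_continuous[OF aD(4)] smooth_curve_continuous[OF aD(5)]
  note bc = anchor_continuous[OF cont(1) aD(6)]
  obtain \<xi> where \<xi>: "B 0 = \<pi> (q 0) *v \<xi>" by (rule gradient_momentum_range)
  have Llin: "linear (\<lambda>v. - D\<pi>_adj (q t) (p t) v)" for t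
    using D\<pi>_adj_linear[of "q t" "p t"] by (intro linear_compose_neg)
  have Lc: "continuous_on {0..1} (\<lambda>t. - D\<pi>_adj (q t) (p t) v)" for v
    by (intro continuous_on_minus bc(3) continuous_on_const cont(2))
  obtain \<alpha> where \<alpha>0: "\<alpha> 0 = \<xi>" and d\<alpha>: "\<And>t. t \<in> {0..1} \<Longrightarrow> (\<alpha> has_vector_derivative - D\<pi>_adj (q t) (p t) (\<alpha> t) + - A t) (at t within {0..1})"
    using linear_ode_interval[OF Llin Lc continuous_on_minus[OF gradient_closed(5)], of \<xi>] by metis
  have "B t - \<pi> (q t) *v \<alpha> t = 0" if t: "t \<in> {0..1}" for t
  proof (rule linear_ode_zero[where L = "\<lambda>t v. D\<pi> (q t) v *v p t" and z = "\<lambda>t. B t - \<pi> (q t) *v \<alpha> t", OF D\<pi>_linear _ _ _ t])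
    show "continuous_on {0..1} (\<lambda>t. D\<pi> (q t) v *v p t)" for v
      by (intro bc(2) continuous_on_const cont(2))
    show "B 0 - \<pi> (q 0) *v \<alpha> 0 = 0" using \<alpha>0 \<xi> by simp
    fix t :: real assume t: "t \<in> {0..1}"
    have J: "D\<pi> (q t) (\<pi> (q t) *v p t) *v \<alpha> t - D\<pi> (q t) (\<pi> (q t) *v \<alpha> t) *v p t - \<pi> (q t) *v D\<pi>_adj (q t) (p t) (\<alpha> t) = 0"
      using jacobiator_identity[OF aD(6)[OF t]] poisson_jacobiator[OF P aD(6)[OF t]] by (simp add: vec_eq_iff)
    have "(D\<pi> (q t) (B t) *v p t - \<pi> (q t) *v A t) - (D\<pi> (q t) (\<pi> (q t) *v p t) *v \<alpha> t + \<pi> (q t) *v (- D\<pi>_adj (q t) (p t) (\<alpha> t) + - A t))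
        = D\<pi> (q t) (B t - \<pi> (q t) *v \<alpha> t) *v p t"
      using J by (simp add: matrix_vector_mult_minus D\<pi>_diff matrix_vector_mult_diff_rdistrib matrix_vector_right_distrib algebra_simps)
    then show "((\<lambda>t. B t - \<pi> (q t) *v \<alpha> t) has_vector_derivative D\<pi> (q t) (B t - \<pi> (q t) *v \<alpha> t) *v p t) (at t within {0..1})"
      using has_vector_derivative_diff[OF gradient_tangent[OF t] anchor_has_vector_derivative[where q = q, OF aD(7)[OF t] aD(6)[OF t] d\<alpha>[OF t]]]
      by simp
  qed
  then show ?thesis using that[of \<alpha>] d\<alpha> by simp
qed

end

section \<open>Coisotropy from the Jacobi identity\<close>

theorem poisson_imp_coisotropic:
  assumes P: "poisson_bivector M \<pi>"
  shows "coisotropic M (cotangent_loops M \<pi>)"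
  unfolding coisotropic_def
proof (intro conjI ballI impI)
  show "cotangent_loops M \<pi> \<subseteq> loops M" by (auto simp: cotangent_loops_def)
  fix F G
  assume F: "F \<in> vanishing_local M (cotangent_loops M \<pi>)" "has_gradients M F"
    and G: "G \<in> vanishing_local M (cotangent_loops M \<pi>)" "has_gradients M G"
  have lF: "local_on_loops M F" "\<And>a. a \<in> cotangent_loops M \<pi> \<Longrightarrow> F a = 0"
    and lG: "local_on_loops M G" "\<And>a. a \<in> cotangent_loops M \<pi> \<Longrightarrow> G a = 0"
    using F(1) G(1) by (auto simp: vanishing_local_def)
  have "loop_bracket F G a = 0" if a: "a \<in> cotangent_loops M \<pi>" for a
  proof -
    obtain q p where qp: "a = (q, p)" by (cases a)
    note a' = a[unfolded qp]
    note aD = cotangent_loopsD[OF a']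
    obtain A B A' B' where AB: "gradient F a = (A, B)" "gradient G a = (A', B')" by (meson surj_pair)
    have gF: "has_gradient F (q, p) (A, B)" and gG: "has_gradient G (q, p) (A', B')"
      using gradient_works[OF F(2), of a] gradient_works[OF G(2), of a] aD(1) AB by (simp_all add: qp)
    obtain N1 f where f: "coord_smooth_on (jet_domain M) f"
      "\<forall>N'\<ge>N1. depends_only_on (jet_coords N' N') (jet_domain M) f"
      "\<forall>a\<in>loops M. F a = integral {0..1} (\<lambda>t. f (jet_at a t))" using local_on_loops_rep[OF lF(1)] by metis
    obtain N2 g where g: "coord_smooth_on (jet_domain M) g"
      "\<forall>N'\<ge>N2. depends_only_on (jet_coords N' N') (jet_domain M) g"
      "\<forall>a\<in>loops M. G a = integral {0..1} (\<lambda>t. g (jet_at a t))" using local_on_loops_rep[OF lG(1)] by metis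
    note cF = P a' f(1) f(2)[rule_format, OF order_refl] f(3)[rule_format] lF(2) gF
    note cG = P a' g(1) g(2)[rule_format, OF order_refl] g(3)[rule_format] lG(2) gG
    obtain \<alpha> where \<alpha>: "\<And>t. t \<in> {0..1} \<Longrightarrow> (\<alpha> has_vector_derivative - D\<pi>_adj (q t) (p t) (\<alpha> t) - A t) (at t within {0..1})"
      "\<And>t. t \<in> {0..1} \<Longrightarrow> B t = \<pi> (q t) *v \<alpha> t"
      using gradient_potential[OF cF] by metis
    obtain \<xi> where \<xi>: "B' 0 = \<pi> (q 0) *v \<xi>" using gradient_momentum_range[OF cG] by metis
    note dB' = gradient_tangent[OF cG]
    \<comment> \<open>The sum in parentheses is the derivative of \<alpha> paired with B'. By
      adjointness its two terms in D\<pi> cancel, and by skewness and B = \<pi> \<alpha> the pairing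
      of \<alpha> with \<pi> A' is minus that of A' with B. A potential enters for F only; for G it
      is the equation of its momentum gradient and the range of that gradient at 0.\<close>
    have "A t \<bullet> B' t - A' t \<bullet> B t = - (\<alpha> t \<bullet> (D\<pi> (q t) (B' t) *v p t - \<pi> (q t) *v A' t) + (- D\<pi>_adj (q t) (p t) (\<alpha> t) - A t) \<bullet> B' t)"
      if t: "t \<in> {0..1}" for t
      using skew_inner[OF aD(6)[OF t], of "\<alpha> t" "A' t"]
      by (simp add: \<alpha>(2)[OF t] D\<pi>_adj_inner inner_diff_left inner_diff_right inner_commute[of "A' t"])
    moreover have "((\<lambda>t. - (\<alpha> t \<bullet> (D\<pi> (q t) (B' t) *v p t - \<pi> (q t) *v A' t) + (- D\<pi>_adj (q t) (p t) (\<alpha> t) - A t) \<bullet> B' t)) has_integral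
        - (\<alpha> 1 \<bullet> B' 1 - \<alpha> 0 \<bullet> B' 0)) {0..1}"
      by (intro has_integral_neg fundamental_theorem_of_calculus bounded_bilinear.has_vector_derivative[OF bounded_bilinear_inner] \<alpha>(1) dB') auto
    ultimately have "((\<lambda>t. A t \<bullet> B' t - A' t \<bullet> B t) has_integral - (\<alpha> 1 \<bullet> B' 1 - \<alpha> 0 \<bullet> B' 0)) {0..1}"
      by (subst has_integral_cong) auto
    then have "loop_bracket F G a = - (\<alpha> 1 \<bullet> B' 1 - \<alpha> 0 \<bullet> B' 0)" by (simp add: loop_bracket_def AB integral_unique)
    also have "\<dots> = 0"
    proof -
      have per: "B 1 = B 0" "B' 1 = B' 0" "q 1 = q 0"
        using gF gG aD(2) by (auto simp: has_gradient_def smooth_closed_def dest: spec[of _ 0])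
      have q0: "q 0 \<in> M" by (rule aD(6)) simp
      have "\<pi> (q 0) *v (\<alpha> 1 - \<alpha> 0) = 0"
        using \<alpha>(2)[of 0] \<alpha>(2)[of 1] per by (simp add: matrix_vector_mult_diff_distrib)
      then have "(\<alpha> 1 - \<alpha> 0) \<bullet> (\<pi> (q 0) *v \<xi>) = 0" using skew_inner[OF q0, of "\<alpha> 1 - \<alpha> 0" \<xi>] by simp
      then show ?thesis using per \<xi> by (simp add: inner_diff_left)
    qed
    finally show ?thesis .
  qed
  then show "loop_bracket F G \<in> vanishing_local M (cotangent_loops M \<pi>)"
    using loop_bracket_local[OF M lF(1) F(2) lG(1) G(2)] by (simp add: vanishing_local_def)
qed

end

section \<open>Symmetry of second derivatives\<close>

text \<open>The second difference over a parallelogram is a mixed second derivative at some point of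
  it: the mean value theorem is applied in direction u to the difference along v, and then in
  direction v.\<close>

lemma second_derivative_mean_value:
  fixes g :: "'a::euclidean_space \<Rightarrow> real"
  assumes M: "open M" and g: "Ck_on 2 M g" and h: "h > 0"
    and sub: "\<And>r s. r \<in> {0..h} \<Longrightarrow> s \<in> {0..h} \<Longrightarrow> x + r *\<^sub>R u + s *\<^sub>R v \<in> M"
  obtains r s where "r \<in> {0..h}" "s \<in> {0..h}"
    "g (x + h *\<^sub>R u + h *\<^sub>R v) - g (x + h *\<^sub>R u) - g (x + h *\<^sub>R v) + g x
      = h * h * frechet_derivative (\<lambda>y. frechet_derivative g (at y) u) (at (x + r *\<^sub>R u + s *\<^sub>R v)) v"
proof -
  let ?g' = "\<lambda>y. frechet_derivative g (at y) u"
  have g1: "Ck_on (Suc 1) M g" and g2: "Ck_on (Suc 0) M ?g'" using g by (simp_all add: numeral_2_eq_2)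
  have line: "((\<lambda>r. k (a + r *\<^sub>R w)) has_derivative (\<lambda>\<rho>. frechet_derivative k (at (a + r *\<^sub>R w)) w * \<rho>)) (at r within T)"
    if "Ck_on (Suc j) M k" "a + r *\<^sub>R w \<in> M" for k :: "'a \<Rightarrow> real" and a w r j T
  proof -
    note D = Ck_on_has_derivative[OF M that]
    have "((\<lambda>r. a + r *\<^sub>R w) has_vector_derivative w) (at r within T)" by (auto intro!: derivative_eq_intros)
    from vector_derivative_diff_chain_within[OF this has_derivative_at_withinI[OF D]]
    show ?thesis by (simp add: o_def has_vector_derivative_def mult.commute)
  qed
  have "\<exists>r\<in>{0..h}. (g (x + h *\<^sub>R v + h *\<^sub>R u) - g (x + h *\<^sub>R u)) - (g (x + h *\<^sub>R v + 0 *\<^sub>R u) - g (x + 0 *\<^sub>R u))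
      = (frechet_derivative g (at (x + h *\<^sub>R v + r *\<^sub>R u)) u - frechet_derivative g (at (x + r *\<^sub>R u)) u) * (h - 0)"
  proof (rule mvt_very_simple[where f = "\<lambda>r. g (x + h *\<^sub>R v + r *\<^sub>R u) - g (x + r *\<^sub>R u)"
        and f' = "\<lambda>r \<rho>. (frechet_derivative g (at (x + h *\<^sub>R v + r *\<^sub>R u)) u - frechet_derivative g (at (x + r *\<^sub>R u)) u) * \<rho>"])
    fix r assume "0 \<le> r" "r \<le> h"
    then have "x + h *\<^sub>R v + r *\<^sub>R u \<in> M" "x + r *\<^sub>R u \<in> M" using sub[of r h] sub[of r 0] h by (simp_all add: algebra_simps)
    from has_derivative_diff[OF line[OF g1 this(1), of "{0..h}"] line[OF g1 this(2), of "{0..h}"]]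
    show "((\<lambda>r. g (x + h *\<^sub>R v + r *\<^sub>R u) - g (x + r *\<^sub>R u)) has_derivative
        (\<lambda>\<rho>. (frechet_derivative g (at (x + h *\<^sub>R v + r *\<^sub>R u)) u - frechet_derivative g (at (x + r *\<^sub>R u)) u) * \<rho>)) (at r within {0..h})"
      by (simp add: left_diff_distrib)
  qed (use h in simp)
  then obtain r where r: "r \<in> {0..h}" and eq1: "g (x + h *\<^sub>R v + h *\<^sub>R u) - g (x + h *\<^sub>R u) - g (x + h *\<^sub>R v) + g x
      = (?g' (x + h *\<^sub>R v + r *\<^sub>R u) - ?g' (x + r *\<^sub>R u)) * h" by (auto simp: algebra_simps)
  have "\<exists>s\<in>{0..h}. ?g' (x + r *\<^sub>R u + h *\<^sub>R v) - ?g' (x + r *\<^sub>R u + 0 *\<^sub>R v)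
      = frechet_derivative ?g' (at (x + r *\<^sub>R u + s *\<^sub>R v)) v * (h - 0)"
    by (rule mvt_very_simple[where f = "\<lambda>s. ?g' (x + r *\<^sub>R u + s *\<^sub>R v)"
        and f' = "\<lambda>s \<rho>. frechet_derivative ?g' (at (x + r *\<^sub>R u + s *\<^sub>R v)) v * \<rho>"])
       (use h r sub in \<open>auto intro!: line[OF g2]\<close>)
  then obtain s where s: "s \<in> {0..h}" and eq2: "?g' (x + r *\<^sub>R u + h *\<^sub>R v) - ?g' (x + r *\<^sub>R u)
      = frechet_derivative ?g' (at (x + r *\<^sub>R u + s *\<^sub>R v)) v * h" by auto
  have "x + h *\<^sub>R v + r *\<^sub>R u = x + r *\<^sub>R u + h *\<^sub>R v" "x + h *\<^sub>R v + h *\<^sub>R u = x + h *\<^sub>R u + h *\<^sub>R v" by simp_all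
  then show ?thesis using that[OF r s] eq1 eq2 by (simp add: algebra_simps)
qed

text \<open>The second difference is symmetric in u and v, so the two mixed derivatives agree at two
  suitable points, possibly distinct, as near to x as desired. Continuity then excludes a gap at
  x.\<close>

lemma symmetric_second_derivative:
  fixes g :: "'a::euclidean_space \<Rightarrow> real"
  assumes M: "open M" and g: "Ck_on 2 M g" and x: "x \<in> M"
  shows "frechet_derivative (\<lambda>y. frechet_derivative g (at y) u) (at x) v
    = frechet_derivative (\<lambda>y. frechet_derivative g (at y) v) (at x) u"
proof (rule ccontr)
  define H where "H = (\<lambda>u v x. frechet_derivative (\<lambda>y. frechet_derivative g (at y) u) (at x) v)"
  assume "\<not> ?thesis"
  then have ne: "\<bar>H u v x - H v u x\<bar> > 0" by (simp add: H_def)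
  define \<epsilon> where "\<epsilon> = \<bar>H u v x - H v u x\<bar> / 2"
  have \<epsilon>: "\<epsilon> > 0" using ne by (simp add: \<epsilon>_def)
  have "continuous_on M (H u v)" for u v
    using g by (simp add: H_def numeral_2_eq_2)
  then have "continuous (at x) (H u v)" "continuous (at x) (H v u)"
    using M x continuous_on_eq_continuous_at by blast+
  then obtain d1 d2 where d: "d1 > 0" "\<And>y. dist y x < d1 \<Longrightarrow> dist (H u v y) (H u v x) < \<epsilon>"
    "d2 > 0" "\<And>y. dist y x < d2 \<Longrightarrow> dist (H v u y) (H v u x) < \<epsilon>"
    using \<epsilon> unfolding continuous_at_eps_delta by metis
  obtain d3 where d3: "d3 > 0" "ball x d3 \<subseteq> M" using M x open_contains_ball by blast
  define d where "d = min d3 (min d1 d2)"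
  have d0: "d > 0" using d d3 by (simp add: d_def)
  \<comment> \<open>Keeps the whole parallelogram within distance d of x; the added 1 covers u = v =
    0.\<close>
  define h where "h = d / (2 * (norm u + norm v + 1))"
  have hn: "norm u + norm v + 1 > 0" by (simp add: add_nonneg_pos)
  have h: "h > 0" using d0 hn by (simp add: h_def)
  have near: "dist (x + r *\<^sub>R u + s *\<^sub>R v) x < d" if "r \<in> {0..h}" "s \<in> {0..h}" for r s
  proof -
    have "norm (r *\<^sub>R u + s *\<^sub>R v) \<le> h * norm u + h * norm v"
      using that by (intro norm_triangle_mono) (auto intro: mult_right_mono)
    also have "\<dots> \<le> h * (norm u + norm v + 1)" using h by (simp add: algebra_simps)
    also have "\<dots> = d / 2" using hn by (simp add: h_def field_simps)
    finally show ?thesis using d0 by (simp add: dist_norm add.assoc)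
  qed
  have near': "dist (x + r *\<^sub>R v + s *\<^sub>R u) x < d" if "r \<in> {0..h}" "s \<in> {0..h}" for r s
    using near[OF that(2,1)] by (simp add: add.commute add.left_commute)
  have sub: "x + r *\<^sub>R u + s *\<^sub>R v \<in> M" "x + r *\<^sub>R v + s *\<^sub>R u \<in> M" if "r \<in> {0..h}" "s \<in> {0..h}" for r s
    using near[OF that] near'[OF that] d3(2) by (auto simp: d_def dist_commute subset_iff)
  obtain r s where rs: "r \<in> {0..h}" "s \<in> {0..h}"
    "g (x + h *\<^sub>R u + h *\<^sub>R v) - g (x + h *\<^sub>R u) - g (x + h *\<^sub>R v) + g x = h * h * H u v (x + r *\<^sub>R u + s *\<^sub>R v)"
    using second_derivative_mean_value[OF M g h sub(1)] unfolding H_def by blast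
  obtain r' s' where rs': "r' \<in> {0..h}" "s' \<in> {0..h}"
    "g (x + h *\<^sub>R v + h *\<^sub>R u) - g (x + h *\<^sub>R v) - g (x + h *\<^sub>R u) + g x = h * h * H v u (x + r' *\<^sub>R v + s' *\<^sub>R u)"
    using second_derivative_mean_value[OF M g h sub(2)] unfolding H_def by blast
  have "g (x + h *\<^sub>R u + h *\<^sub>R v) = g (x + h *\<^sub>R v + h *\<^sub>R u)" by (simp add: ac_simps)
  then have "h * h * H u v (x + r *\<^sub>R u + s *\<^sub>R v) = h * h * H v u (x + r' *\<^sub>R v + s' *\<^sub>R u)"
    using rs(3) rs'(3) by linarith
  then have "H u v (x + r *\<^sub>R u + s *\<^sub>R v) = H v u (x + r' *\<^sub>R v + s' *\<^sub>R u)" using h by simp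
  moreover have "dist (H u v (x + r *\<^sub>R u + s *\<^sub>R v)) (H u v x) < \<epsilon>"
    using near[OF rs(1,2)] by (intro d) (simp add: d_def)
  moreover have "dist (H v u (x + r' *\<^sub>R v + s' *\<^sub>R u)) (H v u x) < \<epsilon>"
    using near'[OF rs'(1,2)] by (intro d) (simp add: d_def)
  ultimately have "dist (H u v x) (H v u x) < \<epsilon> + \<epsilon>"
    using dist_triangle3[of "H u v x" "H v u x" "H u v (x + r *\<^sub>R u + s *\<^sub>R v)"] by simp
  then show False by (simp add: \<epsilon>_def dist_real_def)
qed

context bivector
begin

section \<open>The Jacobi identity from the jacobiator\<close>

text \<open>By the product rule the Jacobi sum splits into terms with first derivatives of the
  functions only, which assemble to the jacobiator contracted with the three differentials, and
  terms with a Hessian, which cancel.\<close>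

lemma jacobiator_zero_imp_poisson:
  assumes J: "\<And>i j m x. x \<in> M \<Longrightarrow> jacobiator i j m x = 0"
  shows "poisson_bivector M \<pi>"
  unfolding poisson_bivector_def
proof (intro allI impI ballI)
  fix f g h :: "real^'n \<Rightarrow> real" and x assume sm: "smooth_on M f" "smooth_on M g" "smooth_on M h" and x: "x \<in> M"
  define d where "d = (\<lambda>f (i :: 'n). frechet_derivative f (at x) (axis i 1) :: real)"
  define dd where "dd = (\<lambda>f (i :: 'n) (j :: 'n). frechet_derivative (\<lambda>y. frechet_derivative f (at y) (axis i 1)) (at x) (axis j 1) :: real)"
  define P where "P = (\<lambda>i j. \<pi> x $ i $ j)"
  define \<alpha> where "\<alpha> = (\<lambda>f j. \<Sum>i\<in>UNIV. P i j * d f i)"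
  have sk: "P i j = - P j i" for i j unfolding P_def by (rule skew[OF x])
  have dd_sym: "dd f i j = dd f j i" if "smooth_on M f" for f :: "real^'n \<Rightarrow> real" and i j
    unfolding dd_def by (rule symmetric_second_derivative[OF M _ x]) (use that in \<open>simp add: smooth_on_def del: Ck_on.simps\<close>)
  have bi: "biderivation \<pi> f K x = (\<Sum>j\<in>UNIV. \<alpha> f j * d K j)" for f K
    unfolding biderivation_def \<alpha>_def sum_distrib_right d_def P_def by (rule sum.swap)
  define T where "T = (\<lambda>f g h. \<Sum>i\<in>UNIV. \<Sum>k\<in>UNIV. \<Sum>l\<in>UNIV. d f i * d g k * d h l * (\<Sum>j\<in>UNIV. P i j * partial j k l x))"
  \<comment> \<open>The Hessian of g on two vectors; \<open>\<alpha> f\<close> is the Hamiltonian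
    vector field of f. In the cyclic sum each Hessian occurs twice with opposite signs and exchanged
    arguments, so its symmetry cancels the pair.\<close>
  define B where "B = (\<lambda>g a b. \<Sum>j\<in>UNIV. \<Sum>k\<in>UNIV. a j * b k * dd g k j)"
  have B_sym: "B g a b = B g b a" if "smooth_on M g" for g a b
  proof -
    have "B g a b = (\<Sum>k\<in>UNIV. \<Sum>j\<in>UNIV. a j * b k * dd g k j)" unfolding B_def by (rule sum.swap)
    also have "\<dots> = B g b a" unfolding B_def by (intro sum.cong refl, subst dd_sym[OF that]) (simp add: mult_ac)
    finally show ?thesis .
  qed
  have main: "biderivation \<pi> f (biderivation \<pi> g h) x = T f g h - B g (\<alpha> f) (\<alpha> h) + B h (\<alpha> f) (\<alpha> g)"
    if sm: "smooth_on M g" "smooth_on M h" for f g h :: "real^'n \<Rightarrow> real"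
  proof -
    have D1: "(partial_fun has_derivative frechet_derivative partial_fun (at x)) (at x)"
      if "smooth_on M partial_fun" for partial_fun :: "real^'n \<Rightarrow> real"
      by (rule smooth_on_has_derivative[OF M that x])
    have "(biderivation \<pi> g h has_derivative (\<lambda>v. \<Sum>k\<in>UNIV. \<Sum>l\<in>UNIV.
        (\<pi> x $ k $ l * frechet_derivative g (at x) (axis k 1)) * frechet_derivative (\<lambda>y. frechet_derivative h (at y) (axis l 1)) (at x) v
        + (\<pi> x $ k $ l * frechet_derivative (\<lambda>y. frechet_derivative g (at y) (axis k 1)) (at x) v
          + frechet_derivative (\<lambda>x. \<pi> x $ k $ l) (at x) v * frechet_derivative g (at x) (axis k 1)) * frechet_derivative h (at x) (axis l 1))) (at x)"
      unfolding biderivation_def[abs_def]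
      by (intro has_derivative_sum has_derivative_mult D1 entry_smooth smooth_on_frechet sm)
    then have "d (biderivation \<pi> g h) j = (\<Sum>k\<in>UNIV. \<Sum>l\<in>UNIV.
        P k l * d g k * dd h l j + (P k l * dd g k j + partial j k l x * d g k) * d h l)" for j
      unfolding d_def dd_def P_def partial_def by (subst frechet_derivative_at[symmetric]) auto
    also have "\<And>j. (\<Sum>k\<in>UNIV. \<Sum>l\<in>UNIV. P k l * d g k * dd h l j + (P k l * dd g k j + partial j k l x * d g k) * d h l)
        = (\<Sum>k\<in>UNIV. \<Sum>l\<in>UNIV. partial j k l x * d g k * d h l) - (\<Sum>k\<in>UNIV. \<alpha> h k * dd g k j) + (\<Sum>l\<in>UNIV. \<alpha> g l * dd h l j)"
    proof -
      fix j
      have 1: "(\<Sum>k\<in>UNIV. \<Sum>l\<in>UNIV. P k l * d g k * dd h l j) = (\<Sum>l\<in>UNIV. \<alpha> g l * dd h l j)"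
        unfolding \<alpha>_def sum_distrib_right by (rule sum.swap)
      have 2: "(\<Sum>k\<in>UNIV. \<Sum>l\<in>UNIV. P k l * dd g k j * d h l) = - (\<Sum>k\<in>UNIV. \<alpha> h k * dd g k j)"
        unfolding \<alpha>_def sum_distrib_right sum_negf[symmetric]
        by (intro sum.cong refl, subst sk) (simp add: mult_ac)
      show "(\<Sum>k\<in>UNIV. \<Sum>l\<in>UNIV. P k l * d g k * dd h l j + (P k l * dd g k j + partial j k l x * d g k) * d h l)
        = (\<Sum>k\<in>UNIV. \<Sum>l\<in>UNIV. partial j k l x * d g k * d h l) - (\<Sum>k\<in>UNIV. \<alpha> h k * dd g k j) + (\<Sum>l\<in>UNIV. \<alpha> g l * dd h l j)"
        by (simp add: sum.distrib distrib_right 1 2)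
    qed
    finally have dj: "d (biderivation \<pi> g h) j = (\<Sum>k\<in>UNIV. \<Sum>l\<in>UNIV. partial j k l x * d g k * d h l)
        - (\<Sum>k\<in>UNIV. \<alpha> h k * dd g k j) + (\<Sum>l\<in>UNIV. \<alpha> g l * dd h l j)" for j .
    have "(\<Sum>j\<in>UNIV. \<alpha> f j * (\<Sum>k\<in>UNIV. \<Sum>l\<in>UNIV. partial j k l x * d g k * d h l)) = T f g h"
    proof -
      have "(\<Sum>j\<in>UNIV. \<alpha> f j * (\<Sum>k\<in>UNIV. \<Sum>l\<in>UNIV. partial j k l x * d g k * d h l))
          = (\<Sum>j\<in>UNIV. \<Sum>i\<in>UNIV. \<Sum>k\<in>UNIV. \<Sum>l\<in>UNIV. d f i * d g k * d h l * (P i j * partial j k l x))"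
        unfolding \<alpha>_def sum_distrib_right unfolding sum_distrib_left by (intro sum.cong refl) (simp add: mult_ac)
      also have "\<dots> = (\<Sum>i\<in>UNIV. \<Sum>j\<in>UNIV. \<Sum>k\<in>UNIV. \<Sum>l\<in>UNIV. d f i * d g k * d h l * (P i j * partial j k l x))" by (rule sum.swap)
      also have "\<dots> = (\<Sum>i\<in>UNIV. \<Sum>k\<in>UNIV. \<Sum>j\<in>UNIV. \<Sum>l\<in>UNIV. d f i * d g k * d h l * (P i j * partial j k l x))"
        by (intro sum.cong refl sum.swap)
      also have "\<dots> = (\<Sum>i\<in>UNIV. \<Sum>k\<in>UNIV. \<Sum>l\<in>UNIV. \<Sum>j\<in>UNIV. d f i * d g k * d h l * (P i j * partial j k l x))"
        by (intro sum.cong refl sum.swap)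
      also have "\<dots> = T f g h" by (simp add: T_def sum_distrib_left)
      finally show ?thesis .
    qed
    moreover have "(\<Sum>j\<in>UNIV. \<alpha> f j * (\<Sum>k\<in>UNIV. a k * dd g k j)) = B g (\<alpha> f) a" for a g
      by (simp add: B_def sum_distrib_left mult.assoc)
    ultimately show ?thesis unfolding bi dj by (simp add: ring_distribs sum.distrib sum_subtractf)
  qed
  \<comment> \<open>Both cyclic shifts are reindexed so that all three sums acquire the common
    factor \<open>d f i * d g k * d h l\<close>.\<close>
  have cyc: "T f g h = (\<Sum>i\<in>UNIV. \<Sum>k\<in>UNIV. \<Sum>l\<in>UNIV. d h i * d f k * d g l * (\<Sum>j\<in>UNIV. P k j * partial j l i x))" for f g h
  proof -
    have "T f g h = (\<Sum>i\<in>UNIV. \<Sum>l\<in>UNIV. \<Sum>k\<in>UNIV. d f i * d g k * d h l * (\<Sum>j\<in>UNIV. P i j * partial j k l x))"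
      unfolding T_def by (intro sum.cong refl sum.swap)
    also have "\<dots> = (\<Sum>l\<in>UNIV. \<Sum>i\<in>UNIV. \<Sum>k\<in>UNIV. d f i * d g k * d h l * (\<Sum>j\<in>UNIV. P i j * partial j k l x))"
      by (rule sum.swap)
    finally show ?thesis by (simp add: mult_ac)
  qed
  have cyc2: "T f g h = (\<Sum>i\<in>UNIV. \<Sum>k\<in>UNIV. \<Sum>l\<in>UNIV. d g i * d h k * d f l * (\<Sum>j\<in>UNIV. P l j * partial j i k x))" for f g h
  proof -
    have "T f g h = (\<Sum>k\<in>UNIV. \<Sum>i\<in>UNIV. \<Sum>l\<in>UNIV. d f i * d g k * d h l * (\<Sum>j\<in>UNIV. P i j * partial j k l x))"
      unfolding T_def by (rule sum.swap)
    also have "\<dots> = (\<Sum>k\<in>UNIV. \<Sum>l\<in>UNIV. \<Sum>i\<in>UNIV. d f i * d g k * d h l * (\<Sum>j\<in>UNIV. P i j * partial j k l x))"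
      by (intro sum.cong refl sum.swap)
    finally show ?thesis by (simp add: mult_ac)
  qed
  have "T f g h + T g h f + T h f g = (\<Sum>i\<in>UNIV. \<Sum>k\<in>UNIV. \<Sum>l\<in>UNIV. d f i * d g k * d h l *
      ((\<Sum>j\<in>UNIV. P i j * partial j k l x) + (\<Sum>j\<in>UNIV. P k j * partial j l i x) + (\<Sum>j\<in>UNIV. P l j * partial j i k x)))"
    unfolding cyc[of g h f] cyc2[of h f g] unfolding T_def by (simp only: sum.distrib distrib_left)
  also have "\<dots> = (\<Sum>i\<in>UNIV. \<Sum>k\<in>UNIV. \<Sum>l\<in>UNIV. d f i * d g k * d h l * (- jacobiator k l i x))"
  proof -
    have "(\<Sum>j\<in>UNIV. P i j * partial j k l x) + (\<Sum>j\<in>UNIV. P k j * partial j l i x) + (\<Sum>j\<in>UNIV. P l j * partial j i k x)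
        = - jacobiator k l i x" for i k l
      unfolding jacobiator_def sum_negf[symmetric] sum.distrib[symmetric]
      by (intro sum.cong refl, subst sk[of i], subst sk[of k], subst sk[of l]) (simp add: P_def)
    then show ?thesis by simp
  qed
  also have "\<dots> = 0" using J[OF x] by simp
  finally show "biderivation \<pi> f (biderivation \<pi> g h) x + biderivation \<pi> g (biderivation \<pi> h f) x + biderivation \<pi> h (biderivation \<pi> f g) x = 0"
    unfolding main[OF sm(2,3)] main[OF sm(3,1)] main[OF sm(1,2)]
    using B_sym[OF sm(1), of "\<alpha> g" "\<alpha> h"] B_sym[OF sm(2), of "\<alpha> f" "\<alpha> h"] B_sym[OF sm(3), of "\<alpha> f" "\<alpha> g"] by simp
qed

end

lemma smooth_closed_endpoints: "smooth_closed u \<Longrightarrow> u 0 = u 1"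
  by (auto simp: smooth_closed_def dest: spec[of _ 0])

context bivector
begin

section \<open>Linear constraints and their brackets\<close>

text \<open>\<open>constraint w i\<close> is the pairing of \<open>q' - \<pi> p\<close> with \<open>w\<close> times the \<open>i\<close>-th basis covector.\<close>

definition constraint_integrand :: "(real \<Rightarrow> real) \<Rightarrow> 'n \<Rightarrow> 'n jet \<Rightarrow> real" where
  "constraint_integrand w i x =
     w (x Time) * (x (Pos 1 i) - (\<Sum>j\<in>UNIV. \<pi> (\<chi> s. x (Pos 0 s)) $ i $ j * x (Mom 0 j)))"

definition constraint :: "(real \<Rightarrow> real) \<Rightarrow> 'n \<Rightarrow> 'n cpath \<Rightarrow> real" where
  "constraint w i a = integral {0..1} (\<lambda>t. constraint_integrand w i (jet_at a t))"

lemma constraint_integrand_smooth: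
  "smooth_curve w \<Longrightarrow> coord_smooth_on (jet_domain M) (constraint_integrand w i)"
  unfolding constraint_integrand_def[abs_def]
  by (intro coord_smooth_mult[OF M] coord_smooth_diff[OF M] coord_smooth_sum[OF M] coord_smooth_proj[OF M]
      coord_smooth_time[OF M] coord_smooth_position[OF M entry_smooth])

lemma constraint_integrand_depends:
  "depends_only_on (jet_coords 1 0) (jet_domain M) (constraint_integrand w i)"
  unfolding depends_only_on_def
proof (intro ballI impI)
  fix x y :: "'n jet" assume eq: "\<forall>c\<in>jet_coords 1 0. x c = y c"
  have "x Time = y Time" "x (Pos 1 i) = y (Pos 1 i)" "x (Pos 0 s) = y (Pos 0 s)" "x (Mom 0 s) = y (Mom 0 s)" for s
    using eq by (auto simp: jet_coords_def)
  then show "constraint_integrand w i x = constraint_integrand w i y" by (simp add: constraint_integrand_def)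
qed

lemma constraint_integrand_along:
  "constraint_integrand w i (jet_at (q, p) t) = w t * (nderiv 1 q t $ i - (\<pi> (q t) *v p t) $ i)"
proof -
  have "(\<chi> s. jet_at (q, p) t (Pos 0 s)) = q t" by (simp add: vec_eq_iff)
  then show ?thesis by (simp add: constraint_integrand_def matrix_vector_mult_def)
qed

lemma constraint_local: "smooth_curve w \<Longrightarrow> local_on_loops M (constraint w i)"
  unfolding local_on_loops_def local_on_paths_def
  using constraint_integrand_smooth constraint_integrand_depends constraint_def by blast

lemma constraint_vanishes:
  assumes "a \<in> cotangent_loops M \<pi>"
  shows "constraint w i a = 0"
proof -
  obtain q p where a: "a = (q, p)" by (cases a)
  note aD = cotangent_loopsD[OF assms[unfolded a]]
  have q': "nderiv 1 q t = \<pi> (q t) *v p t" if t: "t \<in> {0..1}" for t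
    using vector_derivative_unique_interval[OF _ aD(7)[OF t], of "nderiv 1 q t"] smooth_curve_has_deriv[OF aD(4) t, of 0] t by simp
  have "integral {0..1} (\<lambda>t. constraint_integrand w i (jet_at (q, p) t)) = integral {0..1} (\<lambda>t :: real. 0)"
    by (rule integral_cong) (simp only: constraint_integrand_along q', simp)
  then show ?thesis by (simp add: constraint_def a)
qed

text \<open>The integrand is differentiated along an affine perturbation in two ways, by the chain
  rule for jets and by linearizing q' - \<pi> p directly. Uniqueness of the derivative spares the
  computation of the single partial derivatives \<open>coord_deriv\<close>.\<close>

lemma constraint_variation:
  assumes w: "smooth_curve w" and a: "(q, p) \<in> loops M" and \<delta>: "smooth_closed \<delta>q" "smooth_closed \<delta>p" and t: "t \<in> {0..1}"
  shows "first_variation M 1 (constraint_integrand w i) (q, p) (\<delta>q, \<delta>p) t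
    = w t * (nderiv 1 \<delta>q t $ i - (D\<pi> (q t) (\<delta>q t) *v p t + \<pi> (q t) *v \<delta>p t) $ i)"
proof -
  have sm: "smooth_curve q" "smooth_curve p" "smooth_curve \<delta>q" "smooth_curve \<delta>p"
    using a \<delta> by (auto simp: loops_def smooth_closed_def)
  have qM: "q t \<in> M" using a t by (auto simp: loops_def cpaths_def)
  obtain e where e: "e > 0" "\<And>\<epsilon>. \<bar>\<epsilon>\<bar> \<le> e \<Longrightarrow> (\<lambda>t. q t + \<epsilon> *\<^sub>R \<delta>q t, \<lambda>t. p t + \<epsilon> *\<^sub>R \<delta>p t) \<in> loops M"
    using loops_perturb[OF M a \<delta>] by blast
  define x where "x = (\<lambda>\<epsilon> c. jet_at (q, p) t c + \<epsilon> * variation_jet (\<delta>q, \<delta>p) t c)"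
  have x: "jet_at (\<lambda>t. q t + \<epsilon> *\<^sub>R \<delta>q t, \<lambda>t. p t + \<epsilon> *\<^sub>R \<delta>p t) t = x \<epsilon>" for \<epsilon>
    using jet_at_perturb[OF sm t] by (auto simp: x_def)
  have xd: "x \<epsilon> \<in> jet_domain M" if "\<epsilon> \<in> {-e..e}" for \<epsilon>
    using jet_at_domain[OF loops_cpaths[OF e(2)] t, of \<epsilon>] x that by auto
  have x0: "x 0 = jet_at (q, p) t" by (simp add: x_def)
  have e0: "0 \<in> {-e..e}" using e(1) by simp
  have "depends_only_on (jet_coords 1 1) (jet_domain M) (constraint_integrand w i)"
    by (rule depends_only_on_mono[OF constraint_integrand_depends jet_coords_mono]) auto
  note ch = coord_chain_rule[OF M constraint_integrand_smooth[OF w] finite_jet_coords this]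
  have "((\<lambda>\<epsilon>. constraint_integrand w i (x \<epsilon>)) has_vector_derivative
      (\<Sum>c\<in>jet_coords 1 1. coord_deriv (jet_domain M) c (constraint_integrand w i) (x 0) * variation_jet (\<delta>q, \<delta>p) t c)) (at 0 within {-e..e})"
    by (rule ch[OF xd e0]) (auto simp: x_def intro!: derivative_eq_intros)
  moreover have "((\<lambda>\<epsilon>. constraint_integrand w i (x \<epsilon>)) has_vector_derivative
      w t * (nderiv 1 \<delta>q t $ i - (D\<pi> (q t) (\<delta>q t) *v p t + \<pi> (q t) *v \<delta>p t) $ i)) (at 0 within {-e..e})"
  proof -
    have "((\<lambda>\<epsilon>. \<pi> (q t + \<epsilon> *\<^sub>R \<delta>q t) *v (p t + \<epsilon> *\<^sub>R \<delta>p t)) has_vector_derivative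
        D\<pi> (q t + 0 *\<^sub>R \<delta>q t) (\<delta>q t) *v (p t + 0 *\<^sub>R \<delta>p t) + \<pi> (q t + 0 *\<^sub>R \<delta>q t) *v \<delta>p t) (at 0 within {-e..e})"
      by (rule anchor_has_vector_derivative[where q = "\<lambda>\<epsilon>. q t + \<epsilon> *\<^sub>R \<delta>q t"])
         (use qM in \<open>auto intro!: derivative_eq_intros\<close>)
    then have "((\<lambda>\<epsilon>. (\<pi> (q t + \<epsilon> *\<^sub>R \<delta>q t) *v (p t + \<epsilon> *\<^sub>R \<delta>p t)) $ i) has_vector_derivative
        (D\<pi> (q t) (\<delta>q t) *v p t + \<pi> (q t) *v \<delta>p t) $ i) (at 0 within {-e..e})"
      using bounded_linear.has_vector_derivative[OF bounded_linear_vec_nth] by fastforce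
    moreover have "((\<lambda>\<epsilon>. nderiv 1 q t $ i + \<epsilon> * nderiv 1 \<delta>q t $ i) has_vector_derivative nderiv 1 \<delta>q t $ i) (at 0 within {-e..e})"
      by (auto intro!: derivative_eq_intros simp del: nderiv.simps)
    ultimately have "((\<lambda>\<epsilon>. w t * (nderiv 1 q t $ i + \<epsilon> * nderiv 1 \<delta>q t $ i - (\<pi> (q t + \<epsilon> *\<^sub>R \<delta>q t) *v (p t + \<epsilon> *\<^sub>R \<delta>p t)) $ i)) has_vector_derivative
        w t * (nderiv 1 \<delta>q t $ i - (D\<pi> (q t) (\<delta>q t) *v p t + \<pi> (q t) *v \<delta>p t) $ i)) (at 0 within {-e..e})"
      by (intro has_vector_derivative_mult_right has_vector_derivative_diff)
    moreover have "constraint_integrand w i (x \<epsilon>) = w t * (nderiv 1 q t $ i + \<epsilon> * nderiv 1 \<delta>q t $ i - (\<pi> (q t + \<epsilon> *\<^sub>R \<delta>q t) *v (p t + \<epsilon> *\<^sub>R \<delta>p t)) $ i)" for \<epsilon>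
      unfolding x[symmetric] constraint_integrand_along nderiv_add_scaleR[OF sm(1,3) t] by simp
    ultimately show ?thesis by (simp only:)
  qed
  ultimately show ?thesis
    unfolding x0 by (rule vector_derivative_unique_interval) (use e(1) in auto)
qed

lemma smooth_closed_axis:
  assumes "smooth_closed w"
  shows "smooth_closed (\<lambda>t. w t *\<^sub>R (axis i 1 :: real^'n))"
  using smooth_family_linear[OF bounded_linear_scaleR_left, of Closed "{0}" "\<lambda>_. w" "axis i 1"] assms
  unfolding smooth_ends_simps(2)[symmetric] smooth_ends_iff by blast

text \<open>Writing the gradient as (A, B), the Hamiltonian vector field (B, - A) is exactly the
  gauge direction of \<beta>: the constraints generate the gauge flow. Periodicity of \<beta> and of
  the variation removes the boundary term of the integration by parts.\<close>

lemma constraint_gradient: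
  fixes i :: 'n
  assumes w: "smooth_closed w" and a: "(q, p) \<in> loops M"
  defines "\<beta> \<equiv> \<lambda>t. w t *\<^sub>R (axis i 1 :: real^'n)"
  shows "has_gradient (constraint w i) (q, p)
    (\<lambda>t. - 1 *\<^sub>R (nderiv 1 \<beta> t + D\<pi>_adj (q t) (p t) (\<beta> t)), \<lambda>t. \<pi> (q t) *v \<beta> t)"
proof -
  have sw: "smooth_curve w" using w by (simp add: smooth_closed_def)
  have cl: "smooth_closed q" "smooth_closed p" and qM: "\<And>t. t \<in> {0..1} \<Longrightarrow> q t \<in> M"
    using a by (auto simp: loops_def cpaths_def)
  have \<beta>: "smooth_closed \<beta>" unfolding \<beta>_def by (rule smooth_closed_axis[OF w])
  have s\<beta>: "smooth_curve \<beta>" using \<beta> by (simp add: smooth_closed_def)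
  have fam: "smooth_family Closed {0} (\<lambda>_. u)" if "smooth_closed u" for u :: "real \<Rightarrow> real^'n"
    using that by (simp add: smooth_ends_simps(2)[symmetric] smooth_ends_iff)
  have "smooth_family Closed {0} (\<lambda>_ t. - 1 *\<^sub>R (nderiv 1 \<beta> t + D\<pi>_adj (q t) (p t) (\<beta> t)))"
    by (intro smooth_family_linear[OF bounded_linear_scaleR_right] smooth_family_add smooth_family_nderiv[OF fam[OF \<beta>]]
        anchor_family(3)[OF _ fam[OF cl(1)] qM fam[OF \<beta>] fam[OF cl(2)]]) auto
  then have clA: "smooth_closed (\<lambda>t. - 1 *\<^sub>R (nderiv 1 \<beta> t + D\<pi>_adj (q t) (p t) (\<beta> t)))"
    by (simp add: smooth_ends_simps(2)[symmetric] smooth_ends_iff del: nderiv.simps)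
  have "smooth_family Closed {0} (\<lambda>_ t. \<pi> (q t) *v \<beta> t)"
    by (intro anchor_family(1)[OF _ fam[OF cl(1)] qM fam[OF \<beta>] fam[OF \<beta>]]) auto
  then have clB: "smooth_closed (\<lambda>t. \<pi> (q t) *v \<beta> t)"
    by (simp add: smooth_ends_simps(2)[symmetric] smooth_ends_iff)
  have "((\<lambda>\<epsilon>. constraint w i (\<lambda>t. fst (q, p) t + \<epsilon> *\<^sub>R \<delta>q t, \<lambda>t. snd (q, p) t + \<epsilon> *\<^sub>R \<delta>p t)) has_real_derivative
      integral {0..1} (\<lambda>t. - 1 *\<^sub>R (nderiv 1 \<beta> t + D\<pi>_adj (q t) (p t) (\<beta> t)) \<bullet> \<delta>q t) + integral {0..1} (\<lambda>t. (\<pi> (q t) *v \<beta> t) \<bullet> \<delta>p t)) (at 0)"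
    if \<delta>: "smooth_closed \<delta>q" "smooth_closed \<delta>p" for \<delta>q \<delta>p
  proof -
    have s\<delta>: "smooth_curve \<delta>q" "smooth_curve \<delta>p" using \<delta> by (auto simp: smooth_closed_def)
    have sqp: "smooth_curve q" "smooth_curve p" using cl by (auto simp: smooth_closed_def)
    note c = smooth_curve_continuous[OF sqp(1)] smooth_curve_continuous[OF sqp(2)] smooth_curve_continuous[OF s\<beta>]
      smooth_curve_continuous[OF s\<delta>(1)] smooth_curve_continuous[OF s\<delta>(2)]
      smooth_curve_nderiv_continuous[OF s\<beta>] smooth_curve_nderiv_continuous[OF s\<delta>(1)]
    note cadj = anchor_continuous(3)[OF c(1) qM c(3,2)] and c\<pi> = anchor_continuous(1)[OF c(1) qM c(3,3)]
    have dep: "depends_only_on (jet_coords 1 1) (jet_domain M) (constraint_integrand w i)"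
      by (rule depends_only_on_mono[OF constraint_integrand_depends jet_coords_mono]) auto
    have D: "((\<lambda>\<epsilon>. constraint w i (\<lambda>t. fst (q, p) t + \<epsilon> *\<^sub>R \<delta>q t, \<lambda>t. snd (q, p) t + \<epsilon> *\<^sub>R \<delta>p t)) has_real_derivative
        integral {0..1} (\<lambda>t. first_variation M 1 (constraint_integrand w i) (q, p) (\<delta>q, \<delta>p) t)) (at 0)"
      by (rule action_directional_derivative[OF M constraint_integrand_smooth[OF sw] dep constraint_def a \<delta>])
    have "integral {0..1} (\<lambda>t. first_variation M 1 (constraint_integrand w i) (q, p) (\<delta>q, \<delta>p) t)
        = integral {0..1} (\<lambda>t. \<beta> t \<bullet> nderiv 1 \<delta>q t + (- (D\<pi>_adj (q t) (p t) (\<beta> t) \<bullet> \<delta>q t) + (\<pi> (q t) *v \<beta> t) \<bullet> \<delta>p t))"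
    proof (rule integral_cong)
      fix t :: real assume t: "t \<in> {0..1}"
      have ax: "\<beta> t \<bullet> v = w t * v $ i" for v by (simp add: \<beta>_def inner_axis')
      have "first_variation M 1 (constraint_integrand w i) (q, p) (\<delta>q, \<delta>p) t
          = \<beta> t \<bullet> (nderiv 1 \<delta>q t - (D\<pi> (q t) (\<delta>q t) *v p t + \<pi> (q t) *v \<delta>p t))"
        unfolding constraint_variation[OF sw a \<delta> t] ax by simp
      also have "\<dots> = \<beta> t \<bullet> nderiv 1 \<delta>q t + (- (D\<pi>_adj (q t) (p t) (\<beta> t) \<bullet> \<delta>q t) + (\<pi> (q t) *v \<beta> t) \<bullet> \<delta>p t)"
        unfolding inner_diff_right inner_add_right D\<pi>_adj_inner skew_inner[OF qM[OF t]] by simp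
      finally show "first_variation M 1 (constraint_integrand w i) (q, p) (\<delta>q, \<delta>p) t
          = \<beta> t \<bullet> nderiv 1 \<delta>q t + (- (D\<pi>_adj (q t) (p t) (\<beta> t) \<bullet> \<delta>q t) + (\<pi> (q t) *v \<beta> t) \<bullet> \<delta>p t)" .
    qed
    also have "\<dots> = integral {0..1} (\<lambda>t. \<beta> t \<bullet> nderiv 1 \<delta>q t) + (- integral {0..1} (\<lambda>t. D\<pi>_adj (q t) (p t) (\<beta> t) \<bullet> \<delta>q t)
        + integral {0..1} (\<lambda>t. (\<pi> (q t) *v \<beta> t) \<bullet> \<delta>p t))"
      by (intro integral_unique has_integral_add has_integral_neg integrable_integral integrable_continuous_real
          continuous_on_inner c cadj c\<pi>)
    also have "integral {0..1} (\<lambda>t. \<beta> t \<bullet> nderiv 1 \<delta>q t) = - integral {0..1} (\<lambda>t. nderiv 1 \<beta> t \<bullet> \<delta>q t)"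
    proof (rule integration_by_parts_inner[OF _ c(6) _ c(7)])
      show "(\<beta> has_vector_derivative nderiv 1 \<beta> t) (at t within {0..1})" if "t \<in> {0..1}" for t
        using smooth_curve_has_deriv[OF s\<beta> that, of 0] by simp
      show "(\<delta>q has_vector_derivative nderiv 1 \<delta>q t) (at t within {0..1})" if "t \<in> {0..1}" for t
        using smooth_curve_has_deriv[OF s\<delta>(1) that, of 0] by simp
      show "\<beta> 1 \<bullet> \<delta>q 1 = \<beta> 0 \<bullet> \<delta>q 0"
        using smooth_closed_endpoints[OF \<beta>] smooth_closed_endpoints[OF \<delta>(1)] by simp
    qed
    also have "- integral {0..1} (\<lambda>t. nderiv 1 \<beta> t \<bullet> \<delta>q t) + (- integral {0..1} (\<lambda>t. D\<pi>_adj (q t) (p t) (\<beta> t) \<bullet> \<delta>q t)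
        + integral {0..1} (\<lambda>t. (\<pi> (q t) *v \<beta> t) \<bullet> \<delta>p t))
      = integral {0..1} (\<lambda>t. - 1 *\<^sub>R (nderiv 1 \<beta> t + D\<pi>_adj (q t) (p t) (\<beta> t)) \<bullet> \<delta>q t) + integral {0..1} (\<lambda>t. (\<pi> (q t) *v \<beta> t) \<bullet> \<delta>p t)"
    proof -
      have "((\<lambda>t. - (nderiv 1 \<beta> t \<bullet> \<delta>q t) + - (D\<pi>_adj (q t) (p t) (\<beta> t) \<bullet> \<delta>q t)) has_integral
          - integral {0..1} (\<lambda>t. nderiv 1 \<beta> t \<bullet> \<delta>q t) + - integral {0..1} (\<lambda>t. D\<pi>_adj (q t) (p t) (\<beta> t) \<bullet> \<delta>q t)) {0..1}"
        by (intro has_integral_add has_integral_neg integrable_integral integrable_continuous_real continuous_on_inner c cadj)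
      moreover have "- (nderiv 1 \<beta> t \<bullet> \<delta>q t) + - (D\<pi>_adj (q t) (p t) (\<beta> t) \<bullet> \<delta>q t) = - 1 *\<^sub>R (nderiv 1 \<beta> t + D\<pi>_adj (q t) (p t) (\<beta> t)) \<bullet> \<delta>q t" for t
        by (simp add: inner_add_left inner_diff_left inner_minus_left del: nderiv.simps)
      ultimately show ?thesis by (simp add: integral_unique del: nderiv.simps)
    qed
    finally show ?thesis using D by (simp del: nderiv.simps)
  qed
  then show ?thesis using clA clB by (simp add: has_gradient_def del: nderiv.simps)
qed

lemma smooth_closed_const: "smooth_closed (\<lambda>_. c :: 'a::real_normed_vector)"
  using smooth_family_def Ck_family_const[of Closed "{0}" _ c] smooth_ends_iff[of Closed "\<lambda>_. c"]
  by (auto simp: smooth_ends_simps)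

text \<open>Up to a total t-derivative of a closed function, the integrand is minus the j-th
  component of the left side of \<open>jacobiator_identity\<close>. The constant weight of the
  second constraint makes the derivative of its covector drop out.\<close>

lemma constraint_bracket:
  assumes w: "smooth_closed w" and a: "(q, p) \<in> cotangent_loops M \<pi>"
  shows "loop_bracket (constraint w i) (constraint (\<lambda>_. 1) j) (q, p)
    = - integral {0..1} (\<lambda>t. w t * (\<Sum>m\<in>UNIV. p t $ m * jacobiator j i m (q t)))"
proof -
  note aD = cotangent_loopsD[OF a]
  define \<beta> where "\<beta> = (\<lambda>t. w t *\<^sub>R (axis i 1 :: real^'n))"
  define \<eta> where "\<eta> = (\<lambda>t :: real. 1 *\<^sub>R (axis j 1 :: real^'n))"
  have s\<beta>: "smooth_curve \<beta>" "\<beta> 0 = \<beta> 1" using smooth_closed_axis[OF w, of i] by (auto simp: smooth_closed_def \<beta>_def dest: spec[of _ 0])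
  note G1 = constraint_gradient[OF w aD(1), of i, folded \<beta>_def]
    and G2 = constraint_gradient[where w = "\<lambda>_. 1" and i = j, OF smooth_closed_const aD(1), folded \<eta>_def]
  obtain A B A' B' where AB: "gradient (constraint w i) (q, p) = (A, B)" "gradient (constraint (\<lambda>_. 1) j) (q, p) = (A', B')"
    by (meson surj_pair)
  have gA: "has_gradient (constraint w i) (q, p) (A, B)" "has_gradient (constraint (\<lambda>_. 1) j) (q, p) (A', B')"
    unfolding AB[symmetric] unfolding gradient_def by (rule someI, rule G1, rule someI, rule G2)
  note e1 = has_gradient_unique[OF gA(1) G1] and e2 = has_gradient_unique[OF gA(2) G2]
  define V where "V = (\<lambda>t. D\<pi> (q t) (\<pi> (q t) *v p t) *v \<beta> t - D\<pi> (q t) (\<pi> (q t) *v \<beta> t) *v p t - \<pi> (q t) *v D\<pi>_adj (q t) (p t) (\<beta> t))"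
  \<comment> \<open>By the cotangent equation this is the t-derivative of the j-th component of
    \<pi> \<beta>, which takes equal values at both ends, so it integrates to 0. Its first term is
    the one that completes V to the expression of the jacobiator identity.\<close>
  define E where "E = (\<lambda>t. (D\<pi> (q t) (\<pi> (q t) *v p t) *v \<beta> t + \<pi> (q t) *v nderiv 1 \<beta> t) \<bullet> axis j 1)"
  have d\<eta>: "nderiv 1 \<eta> t = 0" if t: "t \<in> {0..1}" for t
    using nderiv_eq_family[of \<eta> "\<lambda>k t. if k = 0 then axis j 1 else 0" t 1] t by (simp add: \<eta>_def)
  have V: "V t $ j = w t * (\<Sum>m\<in>UNIV. p t $ m * jacobiator j i m (q t))" if "t \<in> {0..1}" for t
    unfolding V_def jacobiator_identity[OF aD(6)[OF that]]
    by (simp add: \<beta>_def axis_def if_distrib[of "\<lambda>z. _ * z"] if_distrib[of "\<lambda>z. z * _"] sum_distrib_left mult_ac cong: if_cong)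
  have int: "A t \<bullet> B' t - A' t \<bullet> B t = E t - V t \<bullet> axis j 1" if t: "t \<in> {0..1}" for t
  proof -
    have x: "q t \<in> M" by (rule aD(6)[OF t])
    have \<eta>: "\<eta> t = axis j 1" by (simp add: \<eta>_def)
    have "A t \<bullet> B' t - A' t \<bullet> B t = - (nderiv 1 \<beta> t \<bullet> (\<pi> (q t) *v axis j 1)) - D\<pi>_adj (q t) (p t) (\<beta> t) \<bullet> (\<pi> (q t) *v axis j 1)
        + D\<pi>_adj (q t) (p t) (axis j 1) \<bullet> (\<pi> (q t) *v \<beta> t)"
      unfolding e1(1)[OF t] e1(2)[OF t] e2(1)[OF t] e2(2)[OF t] d\<eta>[OF t] \<eta>
      by (simp add: \<beta>_def inner_add_left inner_diff_left inner_minus_left del: nderiv.simps)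
    also have "\<dots> = E t - V t \<bullet> axis j 1"
      unfolding E_def V_def D\<pi>_adj_inner[of _ _ "axis j 1"] inner_add_left inner_diff_left skew_inner[OF x]
      by (simp add: inner_commute[of "axis j 1"] del: nderiv.simps)
    finally show ?thesis .
  qed
  have "(E has_integral (\<pi> (q 1) *v \<beta> 1) \<bullet> axis j 1 - (\<pi> (q 0) *v \<beta> 0) \<bullet> axis j 1) {0..1}"
    unfolding E_def
  proof (rule fundamental_theorem_of_calculus)
    fix t :: real assume t: "t \<in> {0..1}"
    have "(\<beta> has_vector_derivative nderiv 1 \<beta> t) (at t within {0..1})"
      using smooth_curve_has_deriv[OF s\<beta>(1) t, of 0] by simp
    then show "((\<lambda>t. (\<pi> (q t) *v \<beta> t) \<bullet> axis j 1) has_vector_derivative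
        (D\<pi> (q t) (\<pi> (q t) *v p t) *v \<beta> t + \<pi> (q t) *v nderiv 1 \<beta> t) \<bullet> axis j 1) (at t within {0..1})"
      by (intro bounded_linear.has_vector_derivative[OF bounded_linear_inner_left] anchor_has_vector_derivative[where q = q] aD(7)[OF t] aD(6)[OF t])
  qed simp
  moreover have "q 1 = q 0" using aD(2) by (auto simp: smooth_closed_def dest: spec[of _ 0])
  ultimately have E0: "(E has_integral 0) {0..1}" using s\<beta>(2) by simp
  have cV: "continuous_on {0..1} V"
  proof -
    have c: "continuous_on {0..1} q" "continuous_on {0..1} p" "continuous_on {0..1} \<beta>" by (intro smooth_curve_continuous aD s\<beta>)+
    note bc = anchor_continuous[OF c(1) aD(6)]
    show ?thesis unfolding V_def
      by (intro continuous_on_diff bc(2)[OF _ bc(1)[OF _ c(2,2)] c(3)] bc(2)[OF _ bc(1)[OF _ c(3,3)] c(2)] bc(1)[OF _ bc(3)[OF _ c(3,2)] c(2)])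
  qed
  have "((\<lambda>t. E t - V t \<bullet> axis j 1) has_integral 0 - integral {0..1} (\<lambda>t. V t \<bullet> axis j 1)) {0..1}"
    by (intro has_integral_diff E0 integrable_integral integrable_continuous_real continuous_on_inner cV continuous_on_const)
  then have "integral {0..1} (\<lambda>t. E t - V t \<bullet> axis j 1) = - integral {0..1} (\<lambda>t. V t \<bullet> axis j 1)" by (simp add: integral_unique)
  moreover have "integral {0..1} (\<lambda>t. A t \<bullet> B' t - A' t \<bullet> B t) = integral {0..1} (\<lambda>t. E t - V t \<bullet> axis j 1)"
    by (rule integral_cong[OF int])
  moreover have "integral {0..1} (\<lambda>t. V t \<bullet> axis j 1) = integral {0..1} (\<lambda>t. w t * (\<Sum>m\<in>UNIV. p t $ m * jacobiator j i m (q t)))"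
    by (rule integral_cong) (simp add: inner_axis V)
  ultimately show ?thesis by (simp add: loop_bracket_def AB)
qed


section \<open>Cotangent loops through a given point\<close>

lemma sine_closed: "smooth_closed (\<lambda>t. sin (2 * pi * t))"
proof -
  \<comment> \<open>Each differentiation multiplies by 2 pi and advances the phase by pi / 2; one
    formula then covers all orders and shows periodicity.\<close>
  define D where "D = (\<lambda>k t. (2 * pi) ^ k * sin (2 * pi * t + k * (pi / 2)))"
  have D: "(D k has_vector_derivative D (Suc k) t) (at t within {0..1})" for k t
  proof -
    have "(D k has_real_derivative (2 * pi) ^ k * (cos (2 * pi * t + k * (pi / 2)) * (2 * pi))) (at t within {0..1})"
      unfolding D_def by (auto intro!: derivative_eq_intros)
    moreover have "cos (2 * pi * t + k * (pi / 2)) = sin (2 * pi * t + Suc k * (pi / 2))"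
    proof -
      have "2 * pi * t + Suc k * (pi / 2) = (2 * pi * t + k * (pi / 2)) + pi / 2" by (simp add: algebra_simps add_divide_distrib)
      then show ?thesis by (simp only: sin_add) simp
    qed
    ultimately show ?thesis by (simp add: D_def has_real_derivative_iff_has_vector_derivative mult_ac)
  qed
  have D0: "sin (2 * pi * t) = D 0 t" for t by (simp add: D_def)
  have "D k 0 = D k 1" for k
    using sin_periodic[of "k * (pi / 2)"] by (simp add: D_def add.commute)
  then show ?thesis
    unfolding smooth_closed_def
    using smooth_curve_family[of "\<lambda>t. sin (2 * pi * t)" D, OF D0 D]
      nderiv_eq_family[of "\<lambda>t. sin (2 * pi * t)" D 0, OF D0 D] nderiv_eq_family[of "\<lambda>t. sin (2 * pi * t)" D 1, OF D0 D] by simp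
qed

text \<open>An integral curve of \<open>\<pi> (axis m 1)\<close> is run back and forth in the time \<open>sin\<^sup>2 (\<pi> t)\<close>,
  which closes it up to a cotangent loop through a given point.\<close>

lemma back_and_forth_loop:
  assumes x: "x \<in> M"
  obtains e \<gamma> where "e > 0" "continuous_on {0..e} \<gamma>" "\<gamma> 0 = x" "\<And>s. s \<in> {0..e} \<Longrightarrow> \<gamma> s \<in> M"
    "\<And>\<epsilon>. 0 < \<epsilon> \<Longrightarrow> \<epsilon> \<le> e \<Longrightarrow>
      (\<lambda>t. \<gamma> (\<epsilon> * (sin (pi * t))\<^sup>2), \<lambda>t. (\<epsilon> * pi * sin (2 * pi * t)) *\<^sub>R axis m 1) \<in> cotangent_loops M \<pi>"
proof -
  define V where "V = (\<lambda>y. \<pi> y *v axis m 1)"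
  have V: "smooth_on M V"
    unfolding V_def matrix_vector_mult_def
    by (intro smooth_on_vec smooth_on_sum smooth_on_bilinear[OF M bounded_bilinear_mult] smooth_on_const M entry_smooth)
  \<comment> \<open>The initial datum is the constant loop at x; of the resulting family only the
    curve at loop parameter 0 is kept.\<close>
  have y0: "smooth_ends Closed (\<lambda>_. x)" using smooth_closed_const by (simp add: smooth_ends_simps)
  show ?thesis
  proof (rule smooth_flow[OF M V _ y0 x])
    fix e and u :: "real \<Rightarrow> real \<Rightarrow> real^'n"
    assume e: "e > 0" and uM: "\<And>s t. s \<in> {0..e} \<Longrightarrow> t \<in> {0..1} \<Longrightarrow> u s t \<in> M"
      and u0: "\<And>t. t \<in> {0..1} \<Longrightarrow> u 0 t = x"
      and du: "\<And>k s t. s \<in> {0..e} \<Longrightarrow> t \<in> {0..1} \<Longrightarrow> ((\<lambda>s. nderiv k (u s) t) has_vector_derivative nderiv k (\<lambda>t. V (u s t)) t) (at s within {0..e})"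
    define \<gamma> where "\<gamma> = (\<lambda>s. u s 0)"
    have d\<gamma>: "(\<gamma> has_vector_derivative V (\<gamma> s)) (at s within {0..e})" if "s \<in> {0..e}" for s
      using du[OF that, of 0 0] by (simp add: \<gamma>_def)
    show thesis
    proof (rule that[OF e])
      show "continuous_on {0..e} \<gamma>"
        using d\<gamma> by (meson continuous_on_eq_continuous_within has_vector_derivative_continuous)
      show "\<gamma> 0 = x" using u0[of 0] by (simp add: \<gamma>_def)
      show \<gamma>M: "\<gamma> s \<in> M" if "s \<in> {0..e}" for s using uM[OF that, of 0] by (simp add: \<gamma>_def)
      fix \<epsilon> assume \<epsilon>: "0 < \<epsilon>" "\<epsilon> \<le> e"
      define q where "q = (\<lambda>t. \<gamma> (\<epsilon> * (sin (pi * t))\<^sup>2))"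
      define p where "p = (\<lambda>t. (\<epsilon> * pi * sin (2 * pi * t)) *\<^sub>R (axis m 1 :: real^'n))"
      have rng: "\<epsilon> * (sin (pi * t))\<^sup>2 \<in> {0..e}" for t
      proof -
        have "\<epsilon> * (sin (pi * t))\<^sup>2 \<le> \<epsilon> * 1" using \<epsilon> by (intro mult_left_mono) (auto simp: abs_square_le_1)
        moreover have "0 \<le> \<epsilon> * (sin (pi * t))\<^sup>2" using \<epsilon> by simp
        ultimately show ?thesis using \<epsilon> unfolding atLeastAtMost_iff by linarith
      qed
      have qM: "q t \<in> M" for t unfolding q_def by (rule \<gamma>M[OF rng])
      \<comment> \<open>The time change has derivative \<epsilon> * pi * sin (2 * pi * t), which is
        the coefficient in p. By linearity the reparametrized velocity is therefore \<pi> applied to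
        p.\<close>
      have dq: "(q has_vector_derivative (\<epsilon> * pi * sin (2 * pi * t)) *\<^sub>R V (q t)) (at t within {0..1})" for t
      proof -
        have "((\<lambda>t. \<epsilon> * (sin (pi * t))\<^sup>2) has_real_derivative \<epsilon> * (2 * sin (pi * t) * (cos (pi * t) * pi))) (at t within {0..1})"
          by (auto intro!: derivative_eq_intros)
        moreover have "\<epsilon> * (2 * sin (pi * t) * (cos (pi * t) * pi)) = \<epsilon> * pi * sin (2 * pi * t)"
          using sin_double[of "pi * t"] by (simp add: mult_ac)
        ultimately have "((\<lambda>t. \<epsilon> * (sin (pi * t))\<^sup>2) has_vector_derivative \<epsilon> * pi * sin (2 * pi * t)) (at t within {0..1})"
          by (simp add: has_real_derivative_iff_has_vector_derivative)
        moreover have "(\<gamma> has_vector_derivative V (q t)) (at (\<epsilon> * (sin (pi * t))\<^sup>2) within (\<lambda>t. \<epsilon> * (sin (pi * t))\<^sup>2) ` {0..1})"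
          unfolding q_def by (rule has_vector_derivative_within_subset[OF d\<gamma>[OF rng]]) (use rng in auto)
        ultimately have "(\<gamma> \<circ> (\<lambda>t. \<epsilon> * (sin (pi * t))\<^sup>2) has_vector_derivative (\<epsilon> * pi * sin (2 * pi * t)) *\<^sub>R V (q t)) (at t within {0..1})"
          by (rule vector_diff_chain_within)
        then show ?thesis by (simp only: q_def o_def)
      qed
      have b: "Ck_family Closed {0} k (\<lambda>_ t. \<epsilon> * pi * sin (2 * pi * t))" for k
      proof -
        have "smooth_family Closed {0} (\<lambda>_ t. (\<epsilon> * pi) *\<^sub>R sin (2 * pi * t))"
          using sine_closed unfolding smooth_ends_simps(2)[symmetric] smooth_ends_iff
          by (rule smooth_family_linear[OF bounded_linear_scaleR_right])
        then show ?thesis by (simp add: smooth_family_def)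
      qed
      \<comment> \<open>Smoothness and closedness of q are bootstrapped from its equation, in which
        q' is a smooth closed factor times \<open>V\<close> along q; no higher derivatives of
        \<gamma> enter. The base case uses q 0 = q 1, as the squared sine vanishes at both
        ends.\<close>
      have "Ck_family Closed {0} k (\<lambda>_. q)" for k
      proof (induction k)
        case 0
        have "continuous_on {0..1} q"
          using dq by (meson continuous_on_eq_continuous_within has_vector_derivative_continuous)
        from continuous_on_compose2[OF this continuous_on_snd[OF continuous_on_id], of "{0} \<times> {0..1}"] show ?case
          by (auto simp: split_beta q_def)
      next
        case (Suc k)
        have "Ck_on k M V" using V by (simp add: smooth_on_def)
        from Ck_family_compose[OF M _ this Suc qM]
        have "Ck_family Closed {0} k (\<lambda>_ t. V (q t))" by simp
        from Ck_family_bilinear[OF bounded_bilinear_scaleR disjI1[OF refl] b this]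
        show ?case by (rule Ck_family_SucI[OF Suc]) (rule dq)
      qed
      then have "smooth_closed q" by (simp add: smooth_ends_simps(2)[symmetric] smooth_ends_iff smooth_family_def)
      moreover have "smooth_closed p"
        using Ck_family_linear[OF bounded_linear_scaleR_left[of "axis m 1 :: real^'n"] b]
        by (simp add: p_def smooth_ends_simps(2)[symmetric] smooth_ends_iff smooth_family_def)
      moreover have "(q has_vector_derivative \<pi> (q t) *v p t) (at t within {0..1})" for t
        using dq[of t] by (simp add: p_def V_def matrix_vector_mult_scaleR)
      ultimately have "(q, p) \<in> cotangent_loops M \<pi>"
        using qM by (auto simp: cotangent_loops_def loops_def cpaths_def smooth_closed_def)
      then show "(\<lambda>t. \<gamma> (\<epsilon> * (sin (pi * t))\<^sup>2), \<lambda>t. (\<epsilon> * pi * sin (2 * pi * t)) *\<^sub>R axis m 1) \<in> cotangent_loops M \<pi>"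
        by (simp add: q_def p_def)
    qed
  qed simp
qed

section \<open>Vanishing of the jacobiator for coisotropic cotangent loops\<close>

lemma jacobiator_continuous: "continuous_on M (jacobiator i j m)"
proof -
  have c: "continuous_on M (\<lambda>x. \<pi> x $ i $ j)" "continuous_on M (partial s i j)" for i j s
    using entry_smooth[of i j] partial_smooth[of s i j] by (auto simp: smooth_on_def dest: spec[of _ 0])
  show ?thesis unfolding jacobiator_def[abs_def]
    by (intro continuous_on_sum continuous_on_add continuous_on_mult c)
qed

text \<open>A nonzero value at x keeps its sign along a small back-and-forth loop. There p is a
  positive multiple of the weight times \<open>axis m 1\<close>, so up to sign and a positive
  constant the bracket is the integral of the squared weight times the jacobiator, which cannot be
  0.\<close>

lemma coisotropic_imp_jacobiator_zero:
  assumes C: "coisotropic M (cotangent_loops M \<pi>)" and x: "x \<in> M"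
  shows "jacobiator j i m x = 0"
proof (rule ccontr)
  assume ne: "jacobiator j i m x \<noteq> 0"
  let ?w = "\<lambda>t. sin (2 * pi * t)" and ?J = "jacobiator j i m"
  have "constraint ?w i \<in> vanishing_local M (cotangent_loops M \<pi>)" "constraint (\<lambda>_. 1) j \<in> vanishing_local M (cotangent_loops M \<pi>)"
    using sine_closed smooth_closed_const[of "1 :: real"] constraint_local constraint_vanishes
    by (auto simp: vanishing_local_def smooth_closed_def)
  moreover have "has_gradients M (constraint w k)" if "smooth_closed w" for w k
    unfolding has_gradients_def using constraint_gradient[OF that] by fastforce
  ultimately have zero: "loop_bracket (constraint ?w i) (constraint (\<lambda>_. 1) j) a = 0" if "a \<in> cotangent_loops M \<pi>" for a
    using C sine_closed smooth_closed_const that unfolding coisotropic_def vanishing_local_def by blast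
  obtain e \<gamma> where e: "e > 0" and \<gamma>: "continuous_on {0..e} \<gamma>" "\<gamma> 0 = x" "\<And>s. s \<in> {0..e} \<Longrightarrow> \<gamma> s \<in> M"
    and loop: "\<And>\<epsilon>. 0 < \<epsilon> \<Longrightarrow> \<epsilon> \<le> e \<Longrightarrow>
      (\<lambda>t. \<gamma> (\<epsilon> * (sin (pi * t))\<^sup>2), \<lambda>t. (\<epsilon> * pi * sin (2 * pi * t)) *\<^sub>R axis m 1) \<in> cotangent_loops M \<pi>"
    using back_and_forth_loop[OF x, of m] by blast
  have c: "continuous_on {0..e} (\<lambda>s. ?J (\<gamma> s))"
    by (rule continuous_on_compose2[OF jacobiator_continuous \<gamma>(1)]) (use \<gamma>(3) in auto)
  have "0 \<in> {0..e}" "0 < \<bar>?J x\<bar>" using e ne by auto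
  then obtain d where d: "d > 0" "\<And>s. s \<in> {0..e} \<Longrightarrow> dist s 0 < d \<Longrightarrow> dist (?J (\<gamma> s)) (?J (\<gamma> 0)) < \<bar>?J x\<bar>"
    using c unfolding continuous_on_iff by blast
  \<comment> \<open>Small enough for the loop to exist and for its base path to stay at flow times
    below d, where the jacobiator keeps its sign; d / 2 makes that inequality strict.\<close>
  define \<epsilon> where "\<epsilon> = min e (d / 2)"
  have \<epsilon>: "0 < \<epsilon>" "\<epsilon> \<le> e" "\<epsilon> < d" using e d(1) by (auto simp: \<epsilon>_def)
  define q where "q = (\<lambda>t. \<gamma> (\<epsilon> * (sin (pi * t))\<^sup>2))"
  have rng: "\<epsilon> * (sin (pi * t))\<^sup>2 \<in> {0..\<epsilon>}" for t
  proof -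
    have "\<epsilon> * (sin (pi * t))\<^sup>2 \<le> \<epsilon> * 1" using \<epsilon> by (intro mult_left_mono) (auto simp: abs_square_le_1)
    moreover have "0 \<le> \<epsilon> * (sin (pi * t))\<^sup>2" using \<epsilon> by simp
    ultimately show ?thesis unfolding atLeastAtMost_iff by linarith
  qed
  have pos: "?J (q t) * ?J x > 0" for t
  proof -
    define r where "r = \<epsilon> * (sin (pi * t))\<^sup>2"
    have "r \<in> {0..e}" "dist r 0 < d" using rng[of t, folded r_def] \<epsilon> by (auto simp: dist_real_def)
    then have "dist (?J (q t)) (?J x) < \<bar>?J x\<bar>" using d(2)[of r] by (simp add: q_def r_def \<gamma>(2))
    then have "?J x > 0 \<and> ?J (q t) > 0 \<or> ?J x < 0 \<and> ?J (q t) < 0"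
      by (auto simp: dist_real_def abs_real_def split: if_splits)
    then show ?thesis by (auto intro: mult_neg_neg)
  qed
  have cont: "continuous_on {0..1} (\<lambda>t. ?w t * (\<epsilon> * pi * ?w t * ?J (q t)) * ?J x)"
  proof -
    have "{0..\<epsilon>} \<subseteq> {0..e}" using \<epsilon> by simp
    then have "(\<lambda>t. \<epsilon> * (sin (pi * t))\<^sup>2) ` {0..1} \<subseteq> {0..e}" using rng by blast
    moreover have "continuous_on {0..1} (\<lambda>t. \<epsilon> * (sin (pi * t))\<^sup>2)" by (intro continuous_intros)
    ultimately have "continuous_on {0..1} (\<lambda>t. ?J (q t))"
      unfolding q_def using continuous_on_compose2[OF c] by blast
    then show ?thesis by (intro continuous_intros)
  qed
  have nonneg: "?w t * (\<epsilon> * pi * ?w t * ?J (q t)) * ?J x \<ge> 0" for t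
  proof -
    have "?w t * (\<epsilon> * pi * ?w t * ?J (q t)) * ?J x = (\<epsilon> * pi) * (?w t * ?w t) * (?J (q t) * ?J x)" by simp
    also have "\<dots> \<ge> 0"
      using \<epsilon>(1) by (intro mult_nonneg_nonneg[OF mult_nonneg_nonneg[OF _ zero_le_square] less_imp_le[OF pos]]) simp
    finally show ?thesis .
  qed
  have "integral {0..1} (\<lambda>t. ?w t * (\<epsilon> * pi * ?w t * ?J (q t))) = 0"
  proof -
    have "(\<Sum>k\<in>UNIV. ((\<epsilon> * pi * ?w t) *\<^sub>R axis m 1 :: real^'n) $ k * jacobiator j i k (q t)) = \<epsilon> * pi * ?w t * ?J (q t)" for t
      by (simp add: axis_def if_distrib[of "\<lambda>z. _ * z"] if_distrib[of "\<lambda>z. z * _"] cong: if_cong)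
    then show ?thesis
      using constraint_bracket[OF sine_closed loop[OF \<epsilon>(1,2), folded q_def], of i j] zero[OF loop[OF \<epsilon>(1,2), folded q_def]] by simp
  qed
  then have "integral {0..1} (\<lambda>t. ?w t * (\<epsilon> * pi * ?w t * ?J (q t)) * ?J x) = 0" by simp
  then have "\<forall>t\<in>{0..1}. ?w t * (\<epsilon> * pi * ?w t * ?J (q t)) * ?J x = 0"
    using integral_eq_0_iff[OF cont] nonneg by auto
  \<comment> \<open>At t = 1/4 the sine equals 1, so the integrand is nonzero there.\<close>
  then have "?w (1/4) * (\<epsilon> * pi * ?w (1/4) * ?J (q (1/4))) * ?J x = 0" by (rule bspec) simp
  moreover have "?w (1/4) = 1" by simp
  ultimately show False using \<epsilon>(1) pos[of "1/4"] by auto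
qed

end

theorem theorem25:
  fixes M :: "(real^'n) set" and \<pi> :: "real^'n \<Rightarrow> real^'n^'n"
  assumes "open M" and "bivector_field M \<pi>"
  shows "coisotropic M (cotangent_loops M \<pi>) \<longleftrightarrow> poisson_bivector M \<pi>"
proof -
  interpret bivector M \<pi> by (rule bivector.intro[OF assms])
  show ?thesis
    using poisson_imp_coisotropic jacobiator_zero_imp_poisson coisotropic_imp_jacobiator_zero by blast
qed

end
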